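(* Let $\Omega\Subset\mathbb{C}$ be open, bounded, strictly convex with smooth boundary, $\sigma\in\{\pm1\}$, and define for $k\in\mathbb{C}$, $|k|\ge1$, $Au(z)=\frac{1}{2\pi}\int_\Omega\frac{e^{-kw+\overline{kw}}}{z-w}u(w)L(dw)$, $Bu(z)=\frac{\sigma}{2\pi}\int_\Omega\frac{e^{kw-\overline{kw}}}{\overline z-\overline w}u(w)L(dw)$. Then there is a constant $C$ (depending on $q$, $\epsilon$, $\Omega$ but not on $k$) such that the operator $AB$ has norm at most $C/|k|$ as an operator $L^q(\mathbb{C})\to L^q(\mathbb{C})$ when $2<q<\infty$, and as an operator $L^q(\mathbb{C})\to\langle\cdot\rangle^\epsilon L^q(\mathbb{C})$ when $1<q\le2$ and $\epsilon>\frac2q-1$.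
   Context: $L(dw)$ is Lebesgue measure on $\mathbb{C}$; $\langle z\rangle=(1+|z|^2)^{1/2}$ and $\langle\cdot\rangle^\epsilon L^q=\{\langle\cdot\rangle^\epsilon v:v\in L^q\}$ with norm $\|\langle\cdot\rangle^{-\epsilon}u\|_{L^q}$. *)

theory Defs
  imports "HOL-Analysis.Analysis"
begin

definition strictly_convex :: "complex set \<Rightarrow> bool" where
  "strictly_convex S \<longleftrightarrow> convex S \<and>
     (\<forall>x\<in>closure S. \<forall>y\<in>closure S. x \<noteq> y \<longrightarrow> open_segment x y \<subseteq> S)"

definition C_inf_on :: "complex set \<Rightarrow> (complex \<Rightarrow> real) \<Rightarrow> bool" where
  "C_inf_on U f \<longleftrightarrow> (\<exists>D. f \<in> D \<and>
     (\<forall>g\<in>D. continuous_on U g \<and>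
        (\<exists>g'. (\<forall>x\<in>U. (g has_derivative g' x) (at x)) \<and>
              (\<lambda>x. g' x 1) \<in> D \<and> (\<lambda>x. g' x \<i>) \<in> D)))"

definition smooth_boundary :: "complex set \<Rightarrow> bool" where
  "smooth_boundary \<Omega> \<longleftrightarrow> (\<forall>p\<in>frontier \<Omega>. \<exists>U \<rho> \<rho>'. open U \<and> p \<in> U \<and> C_inf_on U \<rho> \<and>
      (\<rho> has_derivative \<rho>') (at p) \<and> \<rho>' \<noteq> (\<lambda>_. 0) \<and>
      \<Omega> \<inter> U = {x\<in>U. \<rho> x < 0})"

definition jbr :: "complex \<Rightarrow> real" where
  "jbr z = sqrt (1 + (cmod z)^2)"

definition Lq_pow :: "real \<Rightarrow> (complex \<Rightarrow> complex) \<Rightarrow> ennreal" where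
  "Lq_pow q f = (\<integral>\<^sup>+ z. ennreal (cmod (f z) powr q) \<partial>lborel)"

definition opA :: "complex set \<Rightarrow> complex \<Rightarrow> (complex \<Rightarrow> complex) \<Rightarrow> complex \<Rightarrow> complex" where
  "opA \<Omega> k u z = (1 / (2 * pi)) *\<^sub>R
     (LINT w:\<Omega>|lborel. exp (- (k * w) + cnj (k * w)) / (z - w) * u w)"

definition opB :: "complex set \<Rightarrow> real \<Rightarrow> complex \<Rightarrow> (complex \<Rightarrow> complex) \<Rightarrow> complex \<Rightarrow> complex" where
  "opB \<Omega> \<sigma> k u z = (\<sigma> / (2 * pi)) *\<^sub>R
     (LINT w:\<Omega>|lborel. exp (k * w - cnj (k * w)) / (cnj z - cnj w) * u w)"

end

theory Submission
  imports Defs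
begin

text \<open>
  With \<open>h = 1/|k|\<close>, the kernel of \<open>AB\<close> is
  \<open>\<integral>\<^sub>\<Omega> e(w) / ((z - w) (cnj w - cnj w')) dw\<close>, where the phase \<open>e\<close> oscillates at frequency at
  least \<open>|k|\<close> in one of the two coordinate directions. Each Cauchy factor is smoothed at scale \<open>h\<close>; the error
  is bounded by \<open>r(v) = h\<^sup>2 / (|v| (|v|\<^sup>2 + h\<^sup>2))\<close>, whose \<open>L\<^sup>1\<close> norm is \<open>O(h)\<close>. For the smoothed kernel
  one integrates by parts twice along the chords of \<open>\<Omega>\<close> in the oscillating direction; convexity makes
  each chord an interval. One integration by parts would only give \<open>h log(1/h)\<close>; the second
  derivative is again dominated by \<open>r\<close> times a Cauchy factor, and the end points of the chords contribute
  \<open>h\<close> times a product of Cauchy factors integrated over the boundary against the transversal coordinate. So \<open>AB\<close> is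
  dominated by compositions of positive kernels, which are estimated on \<open>L\<^sup>q\<close> by a weighted Schur
  test; no singular integral theory is needed.
\<close>

text \<open>The phase of \<open>B\<close> sits at the innermost variable, where only absolute values
  are taken; the phase of \<open>A\<close> sits at the intermediate point, and that integration
  alone supplies the gain. Far from \<Omega> the function \<open>A B u\<close> in general decays
  only like 1/|z|. After multiplication by the weight the decay is that of
  \<open>jbr z powr (-(1 + \<epsilon>))\<close>, whose q-th power is integrable when 2 < q (1 +
  \<epsilon>). This single condition contains both claims: \<epsilon> = 0 for q > 2, and \<epsilon>
  > 2/q - 1 for q <= 2. The power of \<open>h\<close> comes either from the L1 norm of
  \<open>r\<close>, through Young's inequality for convolutions, or from the explicit factor at the
  chord ends. The Cauchy operators around it need only be bounded: from the area to itself or to a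
  one-dimensional measure, and from there to the weighted plane. The double integral for
  \<open>A B u\<close> is shown to converge absolutely for almost every z, which suffices for
  norms.\<close>

section \<open>Lebesgue measure on the plane in either order of the coordinates\<close>

lemma lborel_complex_eq: "(lborel :: complex measure) = distr (lborel \<Otimes>\<^sub>M lborel) borel (\<lambda>(x, y). Complex x y)"
proof -
  have m: "(\<lambda>(x, y). Complex x y) \<in> borel_measurable (borel \<Otimes>\<^sub>M borel)"
  proof -
    have "(\<lambda>p::real\<times>real. Complex (fst p) (snd p)) \<in> borel_measurable borel"
      by (intro borel_measurable_continuous_onI) (auto simp: Complex_eq intro!: continuous_intros)
    then show ?thesis by (simp add: borel_prod split_beta')
  qed
  show ?thesis
  \<comment> \<open>\<open>lborel\<close> is characterised by its values on boxes, and a complex box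
    is a product of two intervals.\<close>
  proof (rule lborel_eqI)
    fix l u :: complex
    assume le: "\<And>b. b \<in> Basis \<Longrightarrow> l \<bullet> b \<le> u \<bullet> b"
    have l1: "Re l \<le> Re u" "Im l \<le> Im u" using le[of 1] le[of \<i>] by (auto simp: Basis_complex_def inner_complex_def)
    have "(\<lambda>(x, y). Complex x y) -` box l u \<inter> space (lborel \<Otimes>\<^sub>M lborel) = {Re l<..<Re u} \<times> {Im l<..<Im u}"
      by (auto simp: box_def Basis_complex_def inner_complex_def space_pair_measure)
    then have "emeasure (distr (lborel \<Otimes>\<^sub>M lborel) borel (\<lambda>(x, y). Complex x y)) (box l u) = emeasure (lborel \<Otimes>\<^sub>M lborel) ({Re l<..<Re u} \<times> {Im l<..<Im u})"
      using m by (subst emeasure_distr) auto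
    also have "\<dots> = ennreal (Re u - Re l) * ennreal (Im u - Im l)"
      using l1 by (subst lborel.emeasure_pair_measure_Times) auto
    also have "\<dots> = ennreal (\<Prod>b\<in>Basis. (u - l) \<bullet> b)"
      using l1 by (simp add: Basis_complex_def inner_complex_def ennreal_mult)
    finally show "emeasure (distr (lborel \<Otimes>\<^sub>M lborel) borel (\<lambda>(x, y). Complex x y)) (box l u) = ennreal (\<Prod>b\<in>Basis. (u - l) \<bullet> b)" .
  qed simp
qed

text \<open>The flag selects the coordinate \<open>t\<close> along which one integrates by parts. Treating both coordinates on the
  same footing avoids rotating \<open>\<Omega>\<close> according to the argument of \<open>k\<close>.\<close>

definition axis_point :: "bool \<Rightarrow> real \<Rightarrow> real \<Rightarrow> complex"
  where "axis_point b s t = (if b then Complex s t else Complex t s)"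

lemma measurable_axis_point[measurable]: "(\<lambda>(s, t). axis_point b s t) \<in> borel_measurable (borel \<Otimes>\<^sub>M borel)"
proof -
  have "(\<lambda>p::real\<times>real. axis_point b (fst p) (snd p)) \<in> borel_measurable borel"
    by (intro borel_measurable_continuous_onI; cases b) (auto simp: axis_point_def Complex_eq intro!: continuous_intros)
  then show ?thesis by (simp add: borel_prod split_beta')
qed

lemma measurable_axis_point'[measurable (raw)]:
  assumes "f \<in> borel_measurable M" "g \<in> borel_measurable M"
  shows "(\<lambda>x. axis_point b (f x) (g x)) \<in> borel_measurable M"
  using measurable_compose[OF measurable_Pair[OF assms] measurable_axis_point[of b]] by simp

lemma lborel_axis_point: "lborel = distr (lborel \<Otimes>\<^sub>M lborel) borel (\<lambda>(s, t). axis_point b s t)"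
proof (cases b)
  case True
  then show ?thesis by (simp add: lborel_complex_eq axis_point_def)
next
  case False
  have "distr (lborel \<Otimes>\<^sub>M lborel) borel (\<lambda>(x, y). Complex x y) =
    distr (distr (lborel \<Otimes>\<^sub>M lborel) (lborel \<Otimes>\<^sub>M lborel) (\<lambda>(x, y). (y, x))) borel (\<lambda>(x, y). Complex x y)"
    using lborel_pair.distr_pair_swap[where 'a=real and 'b=real] by simp
  also have "\<dots> = distr (lborel \<Otimes>\<^sub>M lborel) borel ((\<lambda>(x, y). Complex x y) \<circ> (\<lambda>(x, y). (y, x)))"
    using measurable_axis_point[of True] by (intro distr_distr) (auto simp: axis_point_def cong: measurable_cong_sets)
  also have "(\<lambda>(x, y). Complex x y) \<circ> (\<lambda>(x, y). (y, x)) = (\<lambda>(s, t). axis_point b s t)"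
    using False by (auto simp: axis_point_def)
  finally show ?thesis by (simp add: lborel_complex_eq)
qed

lemma nn_integral_axis_point:
  assumes [measurable]: "f \<in> borel_measurable borel"
  shows "(\<integral>\<^sup>+ z. f z \<partial>lborel) = (\<integral>\<^sup>+ s. \<integral>\<^sup>+ t. f (axis_point b s t) \<partial>lborel \<partial>lborel)"
proof -
  have "(\<integral>\<^sup>+ z. f z \<partial>lborel) = (\<integral>\<^sup>+ p. f (case p of (s, t) \<Rightarrow> axis_point b s t) \<partial>(lborel \<Otimes>\<^sub>M lborel))"
    by (subst lborel_axis_point[of b], subst nn_integral_distr) auto
  also have "\<dots> = (\<integral>\<^sup>+ s. \<integral>\<^sup>+ t. f (axis_point b s t) \<partial>lborel \<partial>lborel)"
    by (subst lborel.nn_integral_fst[symmetric]) auto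
  finally show ?thesis .
qed

lemma integral_axis_point:
  fixes f :: "complex \<Rightarrow> complex"
  assumes "integrable lborel f"
  shows "(LINT z|lborel. f z) = (LINT s|lborel. LINT t|lborel. f (axis_point b s t))"
proof -
  have [measurable]: "f \<in> borel_measurable borel" using borel_measurable_integrable[OF assms] by simp
  have "integrable (distr (lborel \<Otimes>\<^sub>M lborel) borel (\<lambda>(s, t). axis_point b s t)) f"
    using assms by (simp flip: lborel_axis_point)
  then have i: "integrable (lborel \<Otimes>\<^sub>M lborel) (\<lambda>p. f (case p of (s, t) \<Rightarrow> axis_point b s t))"
    by (subst (asm) integrable_distr_eq) auto
  have "(LINT z|lborel. f z) = (LINT p|(lborel \<Otimes>\<^sub>M lborel). f (case p of (s, t) \<Rightarrow> axis_point b s t))"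
    by (subst lborel_axis_point[of b], subst integral_distr) auto
  also have "\<dots> = (LINT s|lborel. LINT t|lborel. f (axis_point b s t))"
    using lborel_pair.integral_fst'[OF i] by simp
  finally show ?thesis .
qed

section \<open>The Schur test\<close>

text \<open>\<open>enn2real top\<close> is 0, so the infinite case is split off. Integrals can then
  be raised to powers before they are known to be finite.\<close>

definition ennpow :: "ennreal \<Rightarrow> real \<Rightarrow> ennreal"
  where "ennpow x q = (if x = top then top else ennreal (enn2real x powr q))"

lemma ennpow_ennreal: "0 \<le> x \<Longrightarrow> ennpow (ennreal x) q = ennreal (x powr q)"
  by (simp add: ennpow_def)

lemma ennpow_top [simp]: "ennpow top q = top"
  by (simp add: ennpow_def)

lemma ennpow_0 [simp]: "ennpow 0 q = 0"
  by (simp add: ennpow_def)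

lemma ennpow_1 [simp]: "ennpow 1 q = 1"
  using ennpow_ennreal[of 1 q] by simp

lemma ennpow_eq_0_iff [simp]: "ennpow x q = 0 \<longleftrightarrow> x = 0"
  by (cases x) (auto simp: ennpow_ennreal ennreal_eq_0_iff)

lemma ennpow_less_top [simp]: "ennpow x q < top \<longleftrightarrow> x < top"
  by (cases x) (auto simp: ennpow_ennreal)

lemma measurable_ennpow [measurable]:
  "(\<lambda>x. ennpow x q) \<in> borel_measurable borel"
  unfolding ennpow_def by measurable

lemma measurable_ennpow' [measurable (raw)]:
  "f \<in> borel_measurable M \<Longrightarrow> (\<lambda>x. ennpow (f x) q) \<in> borel_measurable M"
  by (rule measurable_compose[OF _ measurable_ennpow])

lemma ennpow_mono: "x \<le> y \<Longrightarrow> 0 \<le> q \<Longrightarrow> ennpow x q \<le> ennpow y q"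
  by (cases x; cases y) (auto simp: ennpow_ennreal powr_mono2 ennreal_le_iff top_unique)

lemma ennpow_mult: "ennpow (x * y) q = ennpow x q * ennpow y q"
proof (cases "x = 0 \<or> y = 0")
  case False
  show ?thesis
  proof (cases "x = top \<or> y = top")
    case True
    then show ?thesis using False by (auto simp: ennreal_mult_top ennreal_top_mult)
  next
    case notop: False
    then obtain a b where "x = ennreal a" "y = ennreal b" "0 \<le> a" "0 \<le> b" by (metis ennreal_cases)
    then show ?thesis by (simp add: ennpow_ennreal powr_mult flip: ennreal_mult)
  qed
qed auto

lemma ennpow_ennpow: "0 < a \<Longrightarrow> ennpow (ennpow x a) b = ennpow x (a * b)"
  by (cases x) (auto simp: ennpow_ennreal powr_powr)

lemma ennpow_add: "0 < a \<Longrightarrow> 0 < b \<Longrightarrow> ennpow x (a + b) = ennpow x a * ennpow x b"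
  by (cases x) (auto simp: ennpow_ennreal powr_add ennreal_mult)

lemma ennpow_one: "ennpow x 1 = x"
  by (cases x) (auto simp: ennpow_ennreal)

text \<open>A sum is at most twice its larger term; this crude constant serves every nonnegative
  exponent.\<close>

lemma ennpow_add_le:
  assumes "0 \<le> q" shows "ennpow (x + y) q \<le> ennreal (2 powr q) * (ennpow x q + ennpow y q)"
proof -
  have *: "ennpow (x + y) q \<le> ennreal (2 powr q) * ennpow z q" if "x \<le> z" "y \<le> z" for z
  proof -
    have "x + y \<le> 2 * z" using add_mono[OF that] by (simp add: mult_2)
    then have "ennpow (x + y) q \<le> ennpow (ennreal 2 * z) q" using assms by (intro ennpow_mono) auto
    then show ?thesis unfolding ennpow_mult by (simp add: ennpow_ennreal del: ennreal_numeral)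
  qed
  show ?thesis
  proof (cases "x \<le> y")
    case True
    show ?thesis using *[OF True order_refl] by (rule order_trans) (intro mult_left_mono, auto)
  next
    case False
    then have "y \<le> x" by simp
    show ?thesis using *[OF order_refl \<open>y \<le> x\<close>] by (rule order_trans) (intro mult_left_mono, auto)
  qed
qed

text \<open>Convexity of \<open>exp\<close> at the points \<open>q * ln a\<close> and
  \<open>p * ln b\<close> with weights 1/q and 1/p.\<close>

lemma young_real:
  fixes a b p q :: real
  assumes p: "1 < q" "1 < p" "1 / p + 1 / q = 1" and ab: "0 \<le> a" "0 \<le> b"
  shows "a * b \<le> a powr q / q + b powr p / p"
proof (cases "a = 0 \<or> b = 0")
  case True
  then show ?thesis using p by auto
next
  case False
  then have pos: "0 < a" "0 < b" using ab by auto
  have q: "1 - 1 / p = 1 / q" using p by simp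
  have "exp ((1 - 1 / p) *\<^sub>R (q * ln a) + (1 / p) *\<^sub>R (p * ln b)) \<le> (1 - 1 / p) * exp (q * ln a) + (1 / p) * exp (p * ln b)"
    using p by (intro convex_onD[OF exp_convex]) auto
  moreover have "exp ((1 - 1 / p) *\<^sub>R (q * ln a) + (1 / p) *\<^sub>R (p * ln b)) = a * b"
    using p pos by (simp add: q exp_add)
  ultimately show ?thesis using pos by (simp add: q powr_def)
qed

text \<open>\<open>A\<close> and \<open>B\<close> will be the integrals of the q-th and p-th powers.
  With this normalisation the bracket integrates to 1/q + 1/p = 1, and the prefactor is already the
  right-hand side of Hoelder's inequality.\<close>

lemma young_ennreal:
  assumes p: "1 < q" "1 < (p::real)" "1 / p + 1 / q = 1" and AB: "0 < A" "0 < B"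
  shows "x * y \<le> ennreal (A powr (1/q) * B powr (1/p)) *
     (ennreal (1 / (A * q)) * ennpow x q + ennreal (1 / (B * p)) * ennpow y p)"
proof (cases "x = 0 \<or> y = 0")
  case False
  have pos: "0 < A powr (1/q) * B powr (1/p)" "0 < 1/(A*q)" "0 < 1/(B*p)" using AB p by auto
  show ?thesis
  proof (cases "x = top \<or> y = top")
    case True
    then have "ennreal (A powr (1/q) * B powr (1/p)) *
     (ennreal (1 / (A * q)) * ennpow x q + ennreal (1 / (B * p)) * ennpow y p) = top"
      using pos by (auto simp: ennreal_mult_top simp del: ennreal_mult)
    then show ?thesis by simp
  next
    case notop: False
    then obtain a b where ab: "x = ennreal a" "y = ennreal b" "0 \<le> a" "0 \<le> b" by (metis ennreal_cases)
    define a' b' where "a' = a / A powr (1/q)" and "b' = b / B powr (1/p)"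
    have ab': "0 \<le> a'" "0 \<le> b'" "a = A powr (1/q) * a'" "b = B powr (1/p) * b'" using ab AB by (auto simp: a'_def b'_def)
    have yo: "a' * b' \<le> a' powr q / q + b' powr p / p"
      using young_real[of q p a' b'] p ab' by simp
    have e: "a' powr q = a powr q / A" "b' powr p = b powr p / B"
      using ab AB p by (auto simp: a'_def b'_def powr_divide powr_powr)
    have "a * b = A powr (1/q) * B powr (1/p) * (a' * b')" using ab' by simp
    also have "\<dots> \<le> A powr (1/q) * B powr (1/p) * (1/(A*q) * a powr q + 1/(B*p) * b powr p)"
      using yo AB by (intro mult_left_mono) (auto simp: e mult.commute)
    finally have "ennreal (a * b) \<le> ennreal (A powr (1/q) * B powr (1/p) * (1/(A*q) * a powr q + 1/(B*p) * b powr p))"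
      by (rule ennreal_leI)
    also have "\<dots> = ennreal (A powr (1/q) * B powr (1/p)) *
     (ennreal (1 / (A * q)) * ennpow x q + ennreal (1 / (B * p)) * ennpow y p)"
      using pos ab AB p by (simp add: ennpow_ennreal ennreal_mult[symmetric] flip: ennreal_plus)
    finally show ?thesis using ab by (simp add: ennreal_mult)
  qed
qed auto

lemma holder_ennreal:
  assumes p: "1 < q" "1 < (p::real)" "1 / p + 1 / q = 1"
    and [measurable]: "f \<in> borel_measurable M" "g \<in> borel_measurable M"
  shows "(\<integral>\<^sup>+ x. f x * g x \<partial>M) \<le> ennpow (\<integral>\<^sup>+ x. ennpow (f x) q \<partial>M) (1/q) * ennpow (\<integral>\<^sup>+ x. ennpow (g x) p \<partial>M) (1/p)"
proof -
  define I J where "I = (\<integral>\<^sup>+ x. ennpow (f x) q \<partial>M)" and "J = (\<integral>\<^sup>+ x. ennpow (g x) p \<partial>M)"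
  \<comment> \<open>A vanishing integral comes first: the right-hand side is then 0 even if the
    other integral is infinite, because \<open>0 * top = 0\<close>, and the integrand on the left
    vanishes almost everywhere.\<close>
  consider "I = 0 \<or> J = 0" | "I \<noteq> 0" "J \<noteq> 0" "I = top \<or> J = top" | "I \<noteq> 0" "J \<noteq> 0" "I \<noteq> top" "J \<noteq> top" by blast
  then show ?thesis
  proof cases
    case 1
    then have "AE x in M. f x * g x = 0"
      unfolding I_def J_def by (auto simp: nn_integral_0_iff_AE)
    then have "(\<integral>\<^sup>+ x. f x * g x \<partial>M) = 0" by (simp add: nn_integral_0_iff_AE)
    then show ?thesis by simp
  next
    case 2
    then have "ennpow I (1/q) * ennpow J (1/p) = top" by (auto simp: ennreal_mult_top ennreal_top_mult)
    then show ?thesis unfolding I_def J_def by simp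
  next
    case 3
    then obtain A B where AB: "I = ennreal A" "J = ennreal B" "0 < A" "0 < B"
      by (metis ennreal_cases ennreal_0 le_less)
    have "(\<integral>\<^sup>+ x. f x * g x \<partial>M) \<le> (\<integral>\<^sup>+ x. ennreal (A powr (1/q) * B powr (1/p)) *
     (ennreal (1 / (A * q)) * ennpow (f x) q + ennreal (1 / (B * p)) * ennpow (g x) p) \<partial>M)"
      by (intro nn_integral_mono young_ennreal p AB)
    also have "\<dots> = ennreal (A powr (1/q) * B powr (1/p)) * (ennreal (1 / (A * q)) * I + ennreal (1 / (B * p)) * J)"
      unfolding I_def J_def by (simp add: nn_integral_cmult nn_integral_add)
    also have "ennreal (1 / (A * q)) * I + ennreal (1 / (B * p)) * J = ennreal (1/(A*q) * A + 1/(B*p) * B)"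
      using AB p by (simp add: ennreal_mult[symmetric] flip: ennreal_plus)
    also have "1/(A*q) * A + 1/(B*p) * B = 1" using AB p by (simp add: field_simps)
    finally show ?thesis using AB unfolding I_def[symmetric] J_def[symmetric]
      by (simp add: ennpow_ennreal ennreal_mult)
  qed
qed

text \<open>Hoelder in \<open>w\<close> pairs \<open>K1 z w * f w\<close> with
  \<open>K2 z w\<close>. The outer power q turns the L^p norm of \<open>K2\<close> into a power q/p
  = q - 1 of \<open>c2\<close>, and Tonelli then leaves the z-integral on \<open>K1\<close>
  alone.\<close>

lemma schur_test:
  assumes "sigma_finite_measure M" "sigma_finite_measure N"
    and p: "1 < q" "1 < (p::real)" "1 / p + 1 / q = 1"
    and K1 [measurable]: "case_prod K1 \<in> borel_measurable (M \<Otimes>\<^sub>M N)"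
    and K2 [measurable]: "case_prod K2 \<in> borel_measurable (M \<Otimes>\<^sub>M N)"
    and f [measurable]: "f \<in> borel_measurable N"
    and c2: "\<And>z. z \<in> space M \<Longrightarrow> (\<integral>\<^sup>+ w. ennpow (K2 z w) p \<partial>N) \<le> c2"
    and c1: "\<And>w. w \<in> space N \<Longrightarrow> (\<integral>\<^sup>+ z. ennpow (K1 z w) q \<partial>M) \<le> c1"
  shows "(\<integral>\<^sup>+ z. ennpow (\<integral>\<^sup>+ w. K1 z w * K2 z w * f w \<partial>N) q \<partial>M) \<le> ennpow c2 (q - 1) * c1 * (\<integral>\<^sup>+ w. ennpow (f w) q \<partial>N)"
proof -
  interpret M: sigma_finite_measure M by fact
  interpret N: sigma_finite_measure N by fact
  interpret MN: pair_sigma_finite M N ..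
  have qp: "q / p = q - 1" using p by (simp add: field_simps)
  have "ennpow (\<integral>\<^sup>+ w. K1 z w * K2 z w * f w \<partial>N) q \<le> ennpow c2 (q - 1) * (\<integral>\<^sup>+ w. ennpow (K1 z w) q * ennpow (f w) q \<partial>N)"
    if z: "z \<in> space M" for z
  proof -
    have [measurable]: "K1 z \<in> borel_measurable N" "K2 z \<in> borel_measurable N"
      using measurable_Pair2[OF K1 z] measurable_Pair2[OF K2 z] by simp_all
    have "(\<integral>\<^sup>+ w. K1 z w * K2 z w * f w \<partial>N) = (\<integral>\<^sup>+ w. (K1 z w * f w) * K2 z w \<partial>N)"
      by (simp add: mult_ac)
    also have "\<dots> \<le> ennpow (\<integral>\<^sup>+ w. ennpow (K1 z w * f w) q \<partial>N) (1/q) * ennpow (\<integral>\<^sup>+ w. ennpow (K2 z w) p \<partial>N) (1/p)"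
      by (intro holder_ennreal p) measurable
    finally have "ennpow (\<integral>\<^sup>+ w. K1 z w * K2 z w * f w \<partial>N) q \<le>
       ennpow (ennpow (\<integral>\<^sup>+ w. ennpow (K1 z w * f w) q \<partial>N) (1/q) * ennpow (\<integral>\<^sup>+ w. ennpow (K2 z w) p \<partial>N) (1/p)) q"
      using p by (intro ennpow_mono) auto
    also have "\<dots> = (\<integral>\<^sup>+ w. ennpow (K1 z w * f w) q \<partial>N) * ennpow (\<integral>\<^sup>+ w. ennpow (K2 z w) p \<partial>N) (q - 1)"
      using p by (simp add: ennpow_mult ennpow_ennpow ennpow_one qp)
    also have "\<dots> \<le> (\<integral>\<^sup>+ w. ennpow (K1 z w * f w) q \<partial>N) * ennpow c2 (q - 1)"
      using p by (intro mult_left_mono ennpow_mono c2 z) auto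
    finally show ?thesis by (simp add: ennpow_mult mult.commute)
  qed
  then have "(\<integral>\<^sup>+ z. ennpow (\<integral>\<^sup>+ w. K1 z w * K2 z w * f w \<partial>N) q \<partial>M) \<le>
     (\<integral>\<^sup>+ z. ennpow c2 (q - 1) * (\<integral>\<^sup>+ w. ennpow (K1 z w) q * ennpow (f w) q \<partial>N) \<partial>M)"
    by (intro nn_integral_mono)
  also have "\<dots> = ennpow c2 (q - 1) * (\<integral>\<^sup>+ z. \<integral>\<^sup>+ w. ennpow (K1 z w) q * ennpow (f w) q \<partial>N \<partial>M)"
    by (intro nn_integral_cmult) measurable
  also have "(\<integral>\<^sup>+ z. \<integral>\<^sup>+ w. ennpow (K1 z w) q * ennpow (f w) q \<partial>N \<partial>M) = (\<integral>\<^sup>+ w. \<integral>\<^sup>+ z. ennpow (K1 z w) q * ennpow (f w) q \<partial>M \<partial>N)"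
    by (rule MN.Fubini'[symmetric]) measurable
  also have "\<dots> = (\<integral>\<^sup>+ w. (\<integral>\<^sup>+ z. ennpow (K1 z w) q \<partial>M) * ennpow (f w) q \<partial>N)"
  proof (intro nn_integral_cong nn_integral_multc)
    fix w assume "w \<in> space N"
    from measurable_Pair1[OF K1 this] show "(\<lambda>z. ennpow (K1 z w) q) \<in> borel_measurable M" by simp
  qed
  also have "\<dots> \<le> (\<integral>\<^sup>+ w. c1 * ennpow (f w) q \<partial>N)"
    by (intro nn_integral_mono mult_right_mono c1) auto
  also have "\<dots> = c1 * (\<integral>\<^sup>+ w. ennpow (f w) q \<partial>N)"
    by (intro nn_integral_cmult) measurable
  finally show ?thesis by (simp add: mult.assoc mult_left_mono)
qed

section \<open>Integrable kernels\<close>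

lemma nn_integral_powr_unit_finite:
  fixes a :: real assumes "a < 1"
  shows "(\<integral>\<^sup>+ x. ennreal (indicator {-1..1} x * \<bar>x\<bar> powr (-a)) \<partial>lborel) < top"
proof -
  let ?g = "\<lambda>x::real. ennreal (indicator {0..1} x * x powr (-a))"
  have "((\<lambda>x::real. x powr (-a)) has_integral (1 powr (-a+1) / (-a+1))) {0..1}"
    using assms by (intro has_integral_powr_from_0) auto
  then have "(\<integral>\<^sup>+ x. ?g x \<partial>lborel) = ennreal (1 / (1 - a))"
    by (subst nn_integral_has_integral_lebesgue[where I="1/(1-a)"]) auto
  then have fin: "(\<integral>\<^sup>+ x. ?g x \<partial>lborel) < top" by simp
  \<comment> \<open>The reflected copy covers the negative half-line; it is spelled
    \<open>0 + (-1) * x\<close> to match the affine substitution rule.\<close>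
  have "(\<integral>\<^sup>+ x. ennreal (indicator {-1..1} x * \<bar>x\<bar> powr (-a)) \<partial>lborel) \<le> (\<integral>\<^sup>+ x. ?g x + ?g (0 + (-1) * x) \<partial>lborel)"
    by (intro nn_integral_mono) (auto simp: indicator_def)
  also have "\<dots> = (\<integral>\<^sup>+ x. ?g x \<partial>lborel) + (\<integral>\<^sup>+ x. ?g (0 + (-1) * x) \<partial>lborel)"
    by (intro nn_integral_add) measurable
  also have "(\<integral>\<^sup>+ x. ?g (0 + (-1) * x) \<partial>lborel) = (\<integral>\<^sup>+ x. ?g x \<partial>lborel)"
    by (subst (2) nn_integral_real_affine[where c="-1" and t=0]) auto
  finally show ?thesis by (rule le_less_trans) (use fin in simp)
qed

lemma nn_integral_powr_infinity_finite:
  fixes b :: real assumes "1 < b"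
  shows "(\<integral>\<^sup>+ x. ennreal (indicator (- {-1..1}) x * \<bar>x\<bar> powr (-b)) \<partial>lborel) < top"
proof -
  let ?g = "\<lambda>x::real. ennreal (indicator {1..} x * x powr (-b))"
  have "((\<lambda>x::real. x powr (-b)) has_integral (- (1 powr (-b+1)) / (-b+1))) {1..}"
    using assms by (intro has_integral_powr_to_inf) auto
  then have "(\<integral>\<^sup>+ x. ?g x \<partial>lborel) = ennreal (- 1 / (1 - b))"
    by (subst nn_integral_has_integral_lebesgue[where I="- 1/(1-b)"]) auto
  then have fin: "(\<integral>\<^sup>+ x. ?g x \<partial>lborel) < top" by simp
  have "(\<integral>\<^sup>+ x. ennreal (indicator (- {-1..1}) x * \<bar>x\<bar> powr (-b)) \<partial>lborel) \<le> (\<integral>\<^sup>+ x. ?g x + ?g (0 + (-1) * x) \<partial>lborel)"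
    by (intro nn_integral_mono) (auto simp: indicator_def)
  also have "\<dots> = (\<integral>\<^sup>+ x. ?g x \<partial>lborel) + (\<integral>\<^sup>+ x. ?g (0 + (-1) * x) \<partial>lborel)"
    by (intro nn_integral_add) measurable
  also have "(\<integral>\<^sup>+ x. ?g (0 + (-1) * x) \<partial>lborel) = (\<integral>\<^sup>+ x. ?g x \<partial>lborel)"
    by (subst (2) nn_integral_real_affine[where c="-1" and t=0]) auto
  finally show ?thesis by (rule le_less_trans) (use fin in simp)
qed

text \<open>The origin is exempt from the first bound because \<open>0 powr (-a)\<close> is 0, which
  would force \<open>f 0 = 0\<close>.\<close>

lemma nn_integral_two_powers_finite:
  fixes a b :: real assumes "a < 1" "1 < b" 
    and f: "\<And>x. x \<noteq> 0 \<Longrightarrow> \<bar>x\<bar> \<le> 1 \<Longrightarrow> f x \<le> ennreal (\<bar>x\<bar> powr (-a))" "\<And>x. \<bar>x\<bar> > 1 \<Longrightarrow> f x \<le> ennreal (\<bar>x\<bar> powr (-b))"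
  shows "(\<integral>\<^sup>+ x. f x \<partial>lborel) < top"
proof -
  let ?g = "\<lambda>x. ennreal (indicator {-1..1} x * \<bar>x\<bar> powr (-a))" and ?h = "\<lambda>x. ennreal (indicator (- {-1..1}) x * \<bar>x\<bar> powr (-b))"
  have "(\<integral>\<^sup>+ x. f x \<partial>lborel) \<le> (\<integral>\<^sup>+ x. ?g x + ?h x \<partial>lborel)"
    proof (rule nn_integral_mono_AE)
    show "AE x in lborel. f x \<le> ?g x + ?h x"
      using AE_lborel_singleton[of 0]
    proof eventually_elim
      case (elim x)
      then show ?case using f(1)[of x] f(2)[of x] by (cases "x \<in> {-1..1}") auto
    qed
  qed
  also have "\<dots> = (\<integral>\<^sup>+ x. ?g x \<partial>lborel) + (\<integral>\<^sup>+ x. ?h x \<partial>lborel)"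
    by (intro nn_integral_add) measurable
  finally show ?thesis
    by (rule le_less_trans) (use nn_integral_powr_unit_finite[OF \<open>a < 1\<close>] nn_integral_powr_infinity_finite[OF \<open>1 < b\<close>] in simp)
qed

lemma nn_integral_complex_product:
  assumes [measurable]: "f \<in> borel_measurable borel" "g \<in> borel_measurable borel"
  shows "(\<integral>\<^sup>+ z. f (Re z) * g (Im z) \<partial>lborel) = (\<integral>\<^sup>+ x. f x \<partial>lborel) * (\<integral>\<^sup>+ y. g y \<partial>lborel)"
  by (subst nn_integral_axis_point[where b=True]) (auto simp: axis_point_def nn_integral_cmult nn_integral_multc)

lemma cmod_ge_sqrt_mult: "sqrt \<bar>Re z\<bar> * sqrt \<bar>Im z\<bar> \<le> cmod z"
  using mult_mono[of "sqrt \<bar>Re z\<bar>" "sqrt (cmod z)" "sqrt \<bar>Im z\<bar>" "sqrt (cmod z)"] abs_Re_le_cmod[of z] abs_Im_le_cmod[of z]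
  by (simp flip: real_sqrt_mult)

text \<open>Stands in for polar coordinates: a radial singularity is dominated by a product of
  one-dimensional ones with half the exponent each, so s < 2 in the plane becomes s/2 < 1 on each
  axis. The bound would fail on the axes, again because \<open>0 powr\<close> is 0.\<close>

lemma cmod_powr_le:
  assumes "0 \<le> s" "Re z \<noteq> 0" "Im z \<noteq> 0"
  shows "cmod z powr (-s) \<le> \<bar>Re z\<bar> powr (-(s/2)) * \<bar>Im z\<bar> powr (-(s/2))"
proof -
  have "0 < sqrt \<bar>Re z\<bar> * sqrt \<bar>Im z\<bar>" using assms by simp
  then have "cmod z powr (-s) \<le> (sqrt \<bar>Re z\<bar> * sqrt \<bar>Im z\<bar>) powr (-s)"
    using cmod_ge_sqrt_mult[of z] assms by (intro powr_mono2') auto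
  then show ?thesis using assms by (simp add: powr_mult powr_half_sqrt[symmetric] powr_powr)
qed

lemma AE_Re_Im_nonzero: "AE z in lborel. Re z \<noteq> 0 \<and> Im z \<noteq> 0"
proof -
  have "(\<integral>\<^sup>+ z. indicator {0} (Re z) * 1 \<partial>lborel) = 0" "(\<integral>\<^sup>+ z. 1 * indicator {0} (Im z) \<partial>lborel) = 0"
    by (subst nn_integral_complex_product; simp)+
  then have "AE z in lborel. indicator {0} (Re z) = (0::ennreal)" "AE z in lborel. indicator {0} (Im z) = (0::ennreal)"
    by (simp_all add: nn_integral_0_iff_AE)
  then show ?thesis by eventually_elim (auto simp: indicator_def split: if_splits)
qed

lemma nn_integral_cmod_powr_unit_finite:
  assumes "0 \<le> s" "s < 2"
  shows "(\<integral>\<^sup>+ z. ennreal (if cmod z \<le> 1 then cmod z powr (-s) else 0) \<partial>lborel) < top"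
proof -
  let ?g = "\<lambda>x. ennreal (indicator {-1..1} x * \<bar>x\<bar> powr (-(s/2)))"
  have le1: "\<bar>Re z\<bar> \<le> 1 \<and> \<bar>Im z\<bar> \<le> 1" if "cmod z \<le> 1" for z
    using abs_Re_le_cmod[of z] abs_Im_le_cmod[of z] that by linarith
  have "(\<integral>\<^sup>+ z. ennreal (if cmod z \<le> 1 then cmod z powr (-s) else 0) \<partial>lborel) \<le> (\<integral>\<^sup>+ z. ?g (Re z) * ?g (Im z) \<partial>lborel)"
  proof (rule nn_integral_mono_AE)
    show "AE z in lborel. ennreal (if cmod z \<le> 1 then cmod z powr (-s) else 0) \<le> ?g (Re z) * ?g (Im z)"
      using AE_Re_Im_nonzero
    proof eventually_elim
      case (elim z)
      then show ?case using cmod_powr_le[of s z] le1[of z] assms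
        by (auto simp: indicator_def abs_le_iff ennreal_leI simp flip: ennreal_mult)
    qed
  qed
  also have "\<dots> = (\<integral>\<^sup>+ x. ?g x \<partial>lborel) * (\<integral>\<^sup>+ x. ?g x \<partial>lborel)"
    by (rule nn_integral_complex_product) measurable
  also have "\<dots> < top" using nn_integral_powr_unit_finite[of "s/2"] assms by (simp add: ennreal_mult_less_top)
  finally show ?thesis .
qed

lemma jbr_pos: "0 < jbr z" and jbr_ge_1: "1 \<le> jbr z" and jbr_le: "jbr z \<le> 1 + cmod z"
proof -
  show "1 \<le> jbr z" unfolding jbr_def by (auto intro: real_le_rsqrt)
  then show "0 < jbr z" by simp
  show "jbr z \<le> 1 + cmod z" unfolding jbr_def by (rule real_le_lsqrt) (auto simp: power2_eq_square algebra_simps)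
qed

lemma measurable_jbr [measurable]: "jbr \<in> borel_measurable borel"
  unfolding jbr_def by measurable

text \<open>\<open>jbr z\<close> dominates the corresponding bracket of \<open>Re z\<close> and of
  \<open>Im z\<close>. Giving half of the exponent to each leaves s/2 > 1, which is integrable at
  infinity on the line.\<close>

lemma nn_integral_jbr_powr_finite:
  assumes "2 < s"
  shows "(\<integral>\<^sup>+ z. ennreal (jbr z powr (-s)) \<partial>lborel) < top"
proof -
  let ?j = "\<lambda>x::real. sqrt (1 + x\<^sup>2)"
  let ?g = "\<lambda>x. ennreal (?j x powr (-(s/2)))"
  have j1: "1 \<le> ?j x" for x by simp
  have j2: "\<bar>x\<bar> \<le> ?j x" for x by (rule real_le_rsqrt) simp
  have "(\<integral>\<^sup>+ z. ennreal (jbr z powr (-s)) \<partial>lborel) \<le> (\<integral>\<^sup>+ z. ?g (Re z) * ?g (Im z) \<partial>lborel)"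
  proof (rule nn_integral_mono)
    fix z
    have le: "?j (Re z) \<le> jbr z" "?j (Im z) \<le> jbr z"
      by (auto simp: jbr_def cmod_def)
    have "jbr z powr (-s) = jbr z powr (-(s/2)) * jbr z powr (-(s/2))" by (simp flip: powr_add)
    also have "\<dots> \<le> ?j (Re z) powr (-(s/2)) * ?j (Im z) powr (-(s/2))"
      using assms le j1[of "Re z"] j1[of "Im z"] by (intro mult_mono powr_mono2') (auto intro: less_le_trans[OF zero_less_one])
    finally show "ennreal (jbr z powr (-s)) \<le> ?g (Re z) * ?g (Im z)" by (simp add: ennreal_leI flip: ennreal_mult)
  qed
  also have "\<dots> = (\<integral>\<^sup>+ x. ?g x \<partial>lborel) * (\<integral>\<^sup>+ x. ?g x \<partial>lborel)"
    by (rule nn_integral_complex_product) measurable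
  also have "(\<integral>\<^sup>+ x. ?g x \<partial>lborel) < top"
  proof (rule nn_integral_two_powers_finite[of 0 "s/2"])
    show "?g x \<le> ennreal (\<bar>x\<bar> powr (-0))" if "x \<noteq> 0" for x
    proof -
      have "?j x powr (-(s/2)) \<le> ?j x powr 0" using assms j1[of x] by (intro powr_mono) auto
      moreover have "?j x \<noteq> 0" using j1[of x] by linarith
      then have "?j x powr 0 = 1" by (simp only: powr_zero_eq_one if_False)
      ultimately show ?thesis using that by (simp add: ennreal_leI flip: ennreal_1)
    qed
    show "?g x \<le> ennreal (\<bar>x\<bar> powr (-(s/2)))" if "1 < \<bar>x\<bar>" for x
      using that assms j2[of x] by (intro ennreal_leI powr_mono2') auto
  qed (use assms in auto)
  then have "(\<integral>\<^sup>+ x. ?g x \<partial>lborel) * (\<integral>\<^sup>+ x. ?g x \<partial>lborel) < top" by (simp add: ennreal_mult_less_top)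
  finally show ?thesis .
qed

text \<open>All kernels take the value \<open>top\<close> at the origin, so that the pointwise bounds below hold without
  exceptional points although \<open>1 / 0 = 0\<close>.\<close>

definition cauchy_kernel :: "complex \<Rightarrow> ennreal" where "cauchy_kernel z = inverse (ennreal (cmod z))"

definition remainder_kernel :: "real \<Rightarrow> complex \<Rightarrow> ennreal" where
  "remainder_kernel h z = ennreal (h\<^sup>2 / ((cmod z)\<^sup>2 + h\<^sup>2)) * cauchy_kernel z"

text \<open>The floor 1 absorbs the far field: for \<open>w\<close> in a fixed disc,
  \<open>jbr z * cauchy_kernel (z - w)\<close> is at most a multiple of this kernel, so all decay at
  infinity can be moved into the measure.\<close>

definition local_kernel :: "complex \<Rightarrow> ennreal" where "local_kernel z = max 1 (cauchy_kernel z)"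

lemma measurable_cauchy_kernel [measurable]: "cauchy_kernel \<in> borel_measurable borel"
  and measurable_remainder_kernel [measurable]: "remainder_kernel h \<in> borel_measurable borel"
  and measurable_local_kernel [measurable]: "local_kernel \<in> borel_measurable borel"
  unfolding cauchy_kernel_def[abs_def] remainder_kernel_def[abs_def] local_kernel_def[abs_def] by measurable

lemma cauchy_kernel_eq: "z \<noteq> 0 \<Longrightarrow> cauchy_kernel z = ennreal (1 / cmod z)"
  by (simp add: cauchy_kernel_def inverse_ennreal divide_inverse)

lemma cauchy_kernel_0 [simp]: "cauchy_kernel 0 = top" by (simp add: cauchy_kernel_def)

lemma remainder_kernel_minus: "remainder_kernel h (z - w) = remainder_kernel h (w - z)" unfolding remainder_kernel_def cauchy_kernel_def by (subst (1 2) norm_minus_commute) (rule refl)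
lemma local_kernel_minus: "local_kernel (z - w) = local_kernel (w - z)" unfolding local_kernel_def cauchy_kernel_def by (subst norm_minus_commute) (rule refl)

text \<open>Both factors are dominated by products in \<open>Re z\<close> and \<open>Im z\<close>.
  Each one-dimensional integral scales like h^(-1/2) under x -> h x, and two of them together with
  the prefactor h^2 leave exactly h.\<close>

lemma remainder_kernel_finite:
  obtains C :: real where "0 < C" "\<And>h. 0 < h \<Longrightarrow> (\<integral>\<^sup>+ z. remainder_kernel h z \<partial>lborel) \<le> ennreal (C * h)"
proof -
  let ?g = "\<lambda>h x::real. ennreal (\<bar>x\<bar> powr (-(1/2)) * (x\<^sup>2 + h\<^sup>2) powr (-(1/2)))"
  have fin: "(\<integral>\<^sup>+ x. ?g 1 x \<partial>lborel) < top"
  proof (rule nn_integral_two_powers_finite[of "1/2" "3/2"])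
    fix x :: real assume "x \<noteq> 0" 
    have "(x\<^sup>2 + 1\<^sup>2) powr (-(1/2)) \<le> 1 powr (-(1/2))" by (intro powr_mono2') auto
    then show "?g 1 x \<le> ennreal (\<bar>x\<bar> powr (-(1/2)))" by (intro ennreal_leI) (auto intro: mult_left_le)
  next
    fix x :: real assume "1 < \<bar>x\<bar>" 
    then have "(x\<^sup>2 + 1\<^sup>2) powr (-(1/2)) \<le> (\<bar>x\<bar> powr 2) powr (-(1/2))" by (intro powr_mono2') auto
    also have "\<dots> = \<bar>x\<bar> powr (-1)" unfolding powr_powr by simp
    finally have "\<bar>x\<bar> powr (-(1/2)) * (x\<^sup>2 + 1\<^sup>2) powr (-(1/2)) \<le> \<bar>x\<bar> powr (-(1/2)) * \<bar>x\<bar> powr (-1)" by (intro mult_left_mono) auto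
    also have "\<dots> = \<bar>x\<bar> powr (-(1/2) + -1)" by (rule powr_add[symmetric])
    also have "-(1/2) + -1 = -(3/2 :: real)" by simp
    finally show "?g 1 x \<le> ennreal (\<bar>x\<bar> powr (-(3/2)))" by (rule ennreal_leI)
  qed auto
  then obtain c where c: "(\<integral>\<^sup>+ x. ?g 1 x \<partial>lborel) = ennreal c" "0 \<le> c"
    by (cases "\<integral>\<^sup>+ x. ?g 1 x \<partial>lborel") auto
  have sc: "(\<integral>\<^sup>+ x. ?g h x \<partial>lborel) = ennreal (h powr (-(1/2)) * c)" if "0 < h" for h
  proof -
    have "(\<integral>\<^sup>+ x. ?g h x \<partial>lborel) = ennreal h * (\<integral>\<^sup>+ x. ?g h (0 + h * x) \<partial>lborel)"
      using that by (subst nn_integral_real_affine[where c=h and t=0]) auto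
    also have "(\<integral>\<^sup>+ x. ?g h (0 + h * x) \<partial>lborel) = (\<integral>\<^sup>+ x. ennreal (h powr (-(3/2))) * ?g 1 x \<partial>lborel)"
    proof (rule nn_integral_cong)
      fix x
      have e: "(h*x)\<^sup>2 + h\<^sup>2 = h\<^sup>2 * (x\<^sup>2 + 1\<^sup>2)" by (simp add: power_mult_distrib algebra_simps)
      have "h\<^sup>2 = h powr 2" using that by simp
      then have h2: "(h\<^sup>2) powr (-(1/2)) = h powr (-1)" by (simp only: powr_powr) simp
      have "((h*x)\<^sup>2 + h\<^sup>2) powr (-(1/2)) = h powr (-1) * (x\<^sup>2 + 1\<^sup>2) powr (-(1/2))"
        unfolding e h2[symmetric] by (rule powr_mult)
      moreover have "\<bar>h * x\<bar> powr (-(1/2)) = h powr (-(1/2)) * \<bar>x\<bar> powr (-(1/2))"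
        using that by (simp add: abs_mult powr_mult)
      moreover have "h powr (-1) * h powr (-(1/2)) = h powr (-(3/2))" by (subst powr_add[symmetric]) simp
      ultimately have "\<bar>h * x\<bar> powr (-(1/2)) * ((h*x)\<^sup>2 + h\<^sup>2) powr (-(1/2)) = h powr (-(3/2)) * (\<bar>x\<bar> powr (-(1/2)) * (x\<^sup>2 + 1\<^sup>2) powr (-(1/2)))"
        by algebra
      then show "?g h (0 + h * x) = ennreal (h powr (-(3/2))) * ?g 1 x"
        by (simp flip: ennreal_mult)
    qed
    also have "\<dots> = ennreal (h powr (-(3/2)) * c)" using c by (subst nn_integral_cmult) (auto simp: ennreal_mult)
    also have "ennreal h * \<dots> = ennreal (h powr 1 * h powr (-(3/2)) * c)" using that c by (simp flip: ennreal_mult)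
    also have "h powr 1 * h powr (-(3/2)) = h powr (-(1/2))" by (subst powr_add[symmetric]) simp
    finally show ?thesis .
  qed
  show ?thesis
  \<comment> \<open>The added 1 makes the constant positive when only \<open>0 \<le> c\<close> is
    known.\<close>
  proof (rule that[of "c\<^sup>2 + 1"])
    fix h :: real assume h: "0 < h"
    have "(\<integral>\<^sup>+ z. remainder_kernel h z \<partial>lborel) \<le> (\<integral>\<^sup>+ z. ennreal (h\<^sup>2) * (?g h (Re z) * ?g h (Im z)) \<partial>lborel)"
    proof (rule nn_integral_mono_AE)
      show "AE z in lborel. remainder_kernel h z \<le> ennreal (h\<^sup>2) * (?g h (Re z) * ?g h (Im z))"
        using AE_Re_Im_nonzero
      proof eventually_elim
        case (elim z)
        have pos: "0 < (cmod z)\<^sup>2 + h\<^sup>2" using h by (simp add: add_nonneg_pos)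
        have "1 / cmod z \<le> \<bar>Re z\<bar> powr (-(1/2)) * \<bar>Im z\<bar> powr (-(1/2))"
          using cmod_powr_le[of 1 z] elim by (simp add: powr_minus_divide)
        moreover have "1 / ((cmod z)\<^sup>2 + h\<^sup>2) = ((cmod z)\<^sup>2 + h\<^sup>2) powr (-(1/2)) * ((cmod z)\<^sup>2 + h\<^sup>2) powr (-(1/2))"
          using pos by (subst powr_add[symmetric]) (simp add: powr_minus_divide)
        moreover have "\<dots> \<le> ((Re z)\<^sup>2 + h\<^sup>2) powr (-(1/2)) * ((Im z)\<^sup>2 + h\<^sup>2) powr (-(1/2))"
          using h by (intro mult_mono powr_mono2') (auto simp: cmod_power2 add_nonneg_pos)
        ultimately have "(1 / ((cmod z)\<^sup>2 + h\<^sup>2)) * (1 / cmod z) \<le> (((Re z)\<^sup>2 + h\<^sup>2) powr (-(1/2)) * ((Im z)\<^sup>2 + h\<^sup>2) powr (-(1/2)))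
           * (\<bar>Re z\<bar> powr (-(1/2)) * \<bar>Im z\<bar> powr (-(1/2)))" by (intro mult_mono) auto
        then have "h\<^sup>2 * ((1 / ((cmod z)\<^sup>2 + h\<^sup>2)) * (1 / cmod z)) \<le> h\<^sup>2 * ((((Re z)\<^sup>2 + h\<^sup>2) powr (-(1/2)) * ((Im z)\<^sup>2 + h\<^sup>2) powr (-(1/2)))
           * (\<bar>Re z\<bar> powr (-(1/2)) * \<bar>Im z\<bar> powr (-(1/2))))" by (intro mult_left_mono) auto
        moreover have "remainder_kernel h z = ennreal (h\<^sup>2 * ((1 / ((cmod z)\<^sup>2 + h\<^sup>2)) * (1 / cmod z)))"
          using elim pos by (subst remainder_kernel_def, subst cauchy_kernel_eq) (auto simp flip: ennreal_mult)
        ultimately show ?case by (simp add: ennreal_leI mult_ac flip: ennreal_mult)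
      qed
    qed
    also have "\<dots> = ennreal (h\<^sup>2) * (\<integral>\<^sup>+ z. ?g h (Re z) * ?g h (Im z) \<partial>lborel)"
      by (intro nn_integral_cmult) measurable
    also have "(\<integral>\<^sup>+ z. ?g h (Re z) * ?g h (Im z) \<partial>lborel) = (\<integral>\<^sup>+ x. ?g h x \<partial>lborel) * (\<integral>\<^sup>+ x. ?g h x \<partial>lborel)"
      by (rule nn_integral_complex_product) measurable
    also have "ennreal (h\<^sup>2) * \<dots> = ennreal (h\<^sup>2 * (h powr (-(1/2)) * h powr (-(1/2))) * c\<^sup>2)"
      unfolding sc[OF h] using c h by (simp add: power2_eq_square[of c] mult_ac flip: ennreal_mult)
    also have "h powr (-(1/2)) * h powr (-(1/2)) = 1 / h" using h by (subst powr_add[symmetric]) (simp add: powr_minus_divide)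
    also have "ennreal (h\<^sup>2 * (1/h) * c\<^sup>2) \<le> ennreal ((c\<^sup>2 + 1) * h)"
      using h by (intro ennreal_leI) (simp add: power2_eq_square algebra_simps)
    finally show "(\<integral>\<^sup>+ z. remainder_kernel h z \<partial>lborel) \<le> ennreal ((c\<^sup>2 + 1) * h)" .
  qed (simp add: add_nonneg_pos)
qed

section \<open>Regular measures and Schur bounds between them\<close>

lemma ennpow_max:
  assumes "0 \<le> q" shows "ennpow (max x y) q = max (ennpow x q) (ennpow y q)"
  using ennpow_mono[of x y q] ennpow_mono[of y x q] assms by (cases "x \<le> y") (auto simp: max_def intro: antisym)

lemma ennpow_cauchy_kernel: "z \<noteq> 0 \<Longrightarrow> ennpow (cauchy_kernel z) s = ennreal (cmod z powr (-s))"
  by (subst cauchy_kernel_eq) (auto simp: ennpow_ennreal powr_minus_divide powr_divide)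

lemma ennpow_local_kernel_le: "0 \<le> s \<Longrightarrow> ennpow (local_kernel z) s \<le> 1 + ennpow (cauchy_kernel z) s"
  unfolding local_kernel_def ennpow_max by (simp add: max_def add_increasing add_increasing2)

lemma local_kernel_ge: "1 \<le> local_kernel z" "cauchy_kernel z \<le> local_kernel z" by (auto simp: local_kernel_def)

text \<open>A measure of dimension at least \<open>d\<close>, as seen by the kernels \<open>max 1 (1/|z - w|)\<close>.\<close>

definition regular_measure :: "real \<Rightarrow> complex measure \<Rightarrow> bool" where
  "regular_measure d \<nu> \<longleftrightarrow> sigma_finite_measure \<nu> \<and> sets \<nu> = sets borel \<and>
     (\<forall>s. 0 < s \<and> s < d \<longrightarrow> (\<exists>C::real. \<forall>w. (\<integral>\<^sup>+ z. ennpow (local_kernel (z - w)) s \<partial>\<nu>) \<le> ennreal C))"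

lemma nn_integral_lborel_shift:
  fixes f :: "complex \<Rightarrow> ennreal"
  assumes [measurable]: "f \<in> borel_measurable borel"
  shows "(\<integral>\<^sup>+ z. f (z - w) \<partial>lborel) = (\<integral>\<^sup>+ z. f z \<partial>lborel)"
proof -
  have "(\<integral>\<^sup>+ z. f z \<partial>lborel) = (\<integral>\<^sup>+ z. f z \<partial>distr lborel borel ((+) (-w)))"
    using lborel_distr_plus[of "-w"] by simp
  also have "\<dots> = (\<integral>\<^sup>+ z. f (z - w) \<partial>lborel)"
    by (subst nn_integral_distr) auto
  finally show ?thesis by simp
qed

lemma sigma_finite_density_real:
  assumes "V \<in> borel_measurable lborel"
  shows "sigma_finite_measure (density lborel (\<lambda>x. ennreal (V x)))"
  using assms by (intro sigma_finite_measure.sigma_finite_iff_density_finite[THEN iffD2]) 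
    (auto intro: lborel.sigma_finite_measure_axioms)

text \<open>Within distance 1 of \<open>w\<close> the density is at most 1 and |z - w|^(-s) is
  integrable for s < 2; farther away the kernel is bounded and the total mass is finite. Translation
  invariance of \<open>lborel\<close> makes the bound uniform in \<open>w\<close>.\<close>

lemma regular_measure_density:
  fixes V :: "complex \<Rightarrow> real"
  assumes [measurable]: "V \<in> borel_measurable borel" and V: "\<And>z. 0 \<le> V z" "\<And>z. V z \<le> 1"
    and fin: "(\<integral>\<^sup>+ z. ennreal (V z) \<partial>lborel) < top"
  shows "regular_measure 2 (density lborel (\<lambda>z. ennreal (V z)))"
  unfolding regular_measure_def
proof (intro conjI allI impI)
  show "sigma_finite_measure (density lborel (\<lambda>z. ennreal (V z)))" by (rule sigma_finite_density_real) measurable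
  fix s :: real assume s: "0 < s \<and> s < 2"
  let ?g = "\<lambda>z. ennreal (if cmod z \<le> 1 then cmod z powr (-s) else 0)"
  define D where "D = 2 * (\<integral>\<^sup>+ z. ennreal (V z) \<partial>lborel) + (\<integral>\<^sup>+ z. ?g z \<partial>lborel)"
  have D: "D < top" using fin nn_integral_cmod_powr_unit_finite[of s] s
    unfolding D_def by (simp add: ennreal_mult_less_top)
  have "(\<integral>\<^sup>+ z. ennpow (local_kernel (z - w)) s \<partial>density lborel (\<lambda>z. ennreal (V z))) \<le> D" for w
  proof -
    have "(\<integral>\<^sup>+ z. ennpow (local_kernel (z - w)) s \<partial>density lborel (\<lambda>z. ennreal (V z))) = (\<integral>\<^sup>+ z. ennreal (V z) * ennpow (local_kernel (z - w)) s \<partial>lborel)"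
      by (subst nn_integral_density) auto
    also have "\<dots> \<le> (\<integral>\<^sup>+ z. 2 * ennreal (V z) + ?g (z - w) \<partial>lborel)"
    proof (rule nn_integral_mono_AE)
      show "AE z in lborel. ennreal (V z) * ennpow (local_kernel (z - w)) s \<le> 2 * ennreal (V z) + ?g (z - w)"
        using AE_lborel_singleton[of w]
      proof eventually_elim
        case (elim z)
        have "ennpow (local_kernel (z - w)) s \<le> 1 + ennreal (cmod (z - w) powr (-s))"
          using ennpow_local_kernel_le[of s "z - w"] elim s by (simp add: ennpow_cauchy_kernel)
        also have "\<dots> \<le> 2 + ?g (z - w)"
        proof (cases "cmod (z - w) \<le> 1")
          case True
          then show ?thesis by (auto simp: intro!: add_mono)
        next
          case False
          then have "cmod (z - w) powr (-s) \<le> cmod (z - w) powr 0" using s by (intro powr_mono) auto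
          then have "ennreal (cmod (z - w) powr (-s)) \<le> 1" using elim by (simp flip: ennreal_1)
          then have "1 + ennreal (cmod (z - w) powr (-s)) \<le> 1 + 1" by (rule add_left_mono)
          then show ?thesis using False by (simp add: add_increasing2)
        qed
        finally have "ennreal (V z) * ennpow (local_kernel (z - w)) s \<le> ennreal (V z) * (2 + ?g (z - w))" by (rule mult_left_mono) simp
        also have "\<dots> \<le> 2 * ennreal (V z) + ?g (z - w)"
        proof -
          have "ennreal (V z) * ?g (z - w) \<le> 1 * ?g (z - w)" using V by (intro mult_right_mono) (auto simp: ennreal_le_1)
          then show ?thesis by (simp add: distrib_left mult.commute add_left_mono)
        qed
        finally show ?case .
      qed
    qed
    also have "\<dots> = 2 * (\<integral>\<^sup>+ z. ennreal (V z) \<partial>lborel) + (\<integral>\<^sup>+ z. ?g (z - w) \<partial>lborel)"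
      by (subst nn_integral_add) (auto simp: nn_integral_cmult)
    also have "(\<integral>\<^sup>+ z. ?g (z - w) \<partial>lborel) = (\<integral>\<^sup>+ z. ?g z \<partial>lborel)"
      by (rule nn_integral_lborel_shift) measurable
    finally show ?thesis unfolding D_def .
  qed
  then show "\<exists>C::real. \<forall>w. (\<integral>\<^sup>+ z. ennpow (local_kernel (z - w)) s \<partial>density lborel (\<lambda>z. ennreal (V z))) \<le> ennreal C"
    using D by (intro exI[of _ "enn2real D"]) simp
qed simp

lemma regular_measure_mono: "regular_measure d \<nu> \<Longrightarrow> d' \<le> d \<Longrightarrow> regular_measure d' \<nu>"
  unfolding regular_measure_def by (meson order_less_le_trans)

text \<open>Schur's test for the kernel L = \<open>local_kernel (z - w)\<close> split as
  L^(\<tau>/q) times L^(1 - \<tau>/q). The first factor produces the exponent \<tau> against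
  \<open>\<mu>\<close>, the second the exponent (q - \<tau>)/(q - 1) against \<open>\<nu>\<close>;
  each must stay below the dimension of its measure.\<close>

lemma regular_kernel_bound:
  assumes \<mu>: "regular_measure d1 \<mu>" and \<nu>: "regular_measure d2 \<nu>" and q: "1 < q"
    and \<tau>: "0 < \<tau>" "\<tau> < d1" "\<tau> < q" "(q - \<tau>) / (q - 1) < d2"
  shows "\<exists>C::real. \<forall>f\<in>borel_measurable borel.
    (\<integral>\<^sup>+ z. ennpow (\<integral>\<^sup>+ w. local_kernel (z - w) * f w \<partial>\<nu>) q \<partial>\<mu>) \<le> ennreal C * (\<integral>\<^sup>+ w. ennpow (f w) q \<partial>\<nu>)"
proof -
  define p where "p = q / (q - 1)"
  have p: "1 < p" "1 / p + 1 / q = 1" using q by (auto simp: p_def field_simps)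
  define a b where "a = \<tau> / q" and "b = 1 - a"
  have ab: "0 < a" "0 < b" "a + b = 1" "a * q = \<tau>" using \<tau> q by (auto simp: a_def b_def field_simps)
  have bp: "b * p = (q - \<tau>) / (q - 1)" using q by (simp add: b_def a_def p_def field_simps)
  have bp0: "0 < b * p" using ab p by simp
  have [measurable_cong]: "sets \<mu> = sets borel" "sets \<nu> = sets borel" and sf: "sigma_finite_measure \<mu>" "sigma_finite_measure \<nu>"
    using \<mu> \<nu> by (auto simp: regular_measure_def)
  obtain C1 where C1: "\<And>w. (\<integral>\<^sup>+ z. ennpow (local_kernel (z - w)) \<tau> \<partial>\<mu>) \<le> ennreal C1"
    using \<mu> \<tau> unfolding regular_measure_def by blast
  obtain C2 where C2: "\<And>w. (\<integral>\<^sup>+ z. ennpow (local_kernel (z - w)) (b * p) \<partial>\<nu>) \<le> ennreal C2"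
    using \<nu> \<tau> bp bp0 unfolding regular_measure_def by metis
  have L: "local_kernel z = ennpow (local_kernel z) a * ennpow (local_kernel z) b" for z
    using ennpow_add[of a b "local_kernel z"] ab by (simp add: ennpow_one)
  have main: "(\<integral>\<^sup>+ z. ennpow (\<integral>\<^sup>+ w. local_kernel (z - w) * f w \<partial>\<nu>) q \<partial>\<mu>) \<le> ennpow (ennreal C2) (q - 1) * ennreal C1 * (\<integral>\<^sup>+ w. ennpow (f w) q \<partial>\<nu>)"
    if [measurable]: "f \<in> borel_measurable borel" for f
  proof -
    have "(\<integral>\<^sup>+ z. ennpow (\<integral>\<^sup>+ w. ennpow (local_kernel (z - w)) a * ennpow (local_kernel (z - w)) b * f w \<partial>\<nu>) q \<partial>\<mu>)
      \<le> ennpow (ennreal C2) (q - 1) * ennreal C1 * (\<integral>\<^sup>+ w. ennpow (f w) q \<partial>\<nu>)"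
    proof (rule schur_test[OF sf \<open>1 < q\<close> p])
      fix z
      show "(\<integral>\<^sup>+ w. ennpow (ennpow (local_kernel (z - w)) b) p \<partial>\<nu>) \<le> ennreal C2"
        using C2[of z] ab by (simp add: ennpow_ennpow local_kernel_minus[of z])
      show "(\<integral>\<^sup>+ w. ennpow (ennpow (local_kernel (w - z)) a) q \<partial>\<mu>) \<le> ennreal C1"
        using C1[of z] ab by (simp add: ennpow_ennpow)
    qed measurable
    then show ?thesis by (simp flip: L)
  qed
  obtain C where C: "ennpow (ennreal C2) (q - 1) * ennreal C1 = ennreal C"
    by (metis ennreal_cases ennreal_mult_less_top ennpow_less_top ennreal_less_top less_irrefl)
  then show ?thesis using main by auto
qed

text \<open>The exponents \<open>1/q\<close> and \<open>2 - 1/q\<close> below are dual choices under which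
  the two Schur integrals converge for every \<open>q > 1\<close>.\<close>

lemma kernel_to_regular1:
  assumes q: "1 < q" and "regular_measure 1 \<mu>" "regular_measure 2 \<nu>"
  shows "\<exists>C::real. \<forall>f\<in>borel_measurable borel.
    (\<integral>\<^sup>+ z. ennpow (\<integral>\<^sup>+ w. local_kernel (z - w) * f w \<partial>\<nu>) q \<partial>\<mu>) \<le> ennreal C * (\<integral>\<^sup>+ w. ennpow (f w) q \<partial>\<nu>)"
proof (rule regular_kernel_bound[OF assms(2,3,1), where \<tau> = "1/q"])
  have "(q - 1/q) / (q - 1) = 1 + 1/q" using q by (simp add: field_simps)
  then show "(q - 1/q) / (q - 1) < 2" using q by simp
  show "1/q < q" using q less_trans[of "1/q" 1 q] by simp
qed (use q in auto)

lemma kernel_from_regular1: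
  assumes q: "1 < q" and "regular_measure 2 \<mu>" "regular_measure 1 \<nu>"
  shows "\<exists>C::real. \<forall>f\<in>borel_measurable borel.
    (\<integral>\<^sup>+ z. ennpow (\<integral>\<^sup>+ w. local_kernel (z - w) * f w \<partial>\<nu>) q \<partial>\<mu>) \<le> ennreal C * (\<integral>\<^sup>+ w. ennpow (f w) q \<partial>\<nu>)"
proof (rule regular_kernel_bound[OF assms(2,3,1), where \<tau> = "2 - 1/q"])
  have "(q - (2 - 1/q)) / (q - 1) = 1 - 1/q" using q by (simp add: field_simps)
  then show "(q - (2 - 1/q)) / (q - 1) < 1" using q by simp
  have "0 < (q - 1)^2 / q" using q by simp
  also have "(q - 1)^2 / q = q - (2 - 1/q)" using q by (simp add: field_simps power2_eq_square)
  finally show "2 - 1/q < q" by simp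
  have "1/q < 1" using q by simp
  then show "0 < 2 - 1/q" by simp
qed (use q in auto)

text \<open>Young's inequality for an L1 convolution kernel, read off from Schur's test: split as
  the powers 1/q and 1/p, the kernel gives its L1 norm, of order h, in both Schur integrals.\<close>

lemma remainder_kernel_operator_bound:
  assumes q: "1 < (q::real)"
  obtains C :: real where "0 < C" "\<And>h f. 0 < h \<Longrightarrow> f \<in> borel_measurable borel \<Longrightarrow>
    (\<integral>\<^sup>+ z. ennpow (\<integral>\<^sup>+ w. remainder_kernel h (z - w) * f w \<partial>lborel) q \<partial>lborel) \<le> ennreal (C * h powr q) * (\<integral>\<^sup>+ w. ennpow (f w) q \<partial>lborel)"
proof -
  obtain C where C: "0 < C" "\<And>h. 0 < h \<Longrightarrow> (\<integral>\<^sup>+ z. remainder_kernel h z \<partial>lborel) \<le> ennreal (C * h)" by (rule remainder_kernel_finite) blast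
  define p where "p = q / (q - 1)"
  have p: "1 < p" "1 / p + 1 / q = 1" using q by (auto simp: p_def field_simps)
  have sf: "sigma_finite_measure lborel" by (rule lborel.sigma_finite_measure_axioms)
  show ?thesis
  proof (rule that[of "C powr q"])
    fix h :: real and f :: "complex \<Rightarrow> ennreal" assume h: "0 < h" and [measurable]: "f \<in> borel_measurable borel"
    have L: "remainder_kernel h z = ennpow (remainder_kernel h z) (1/q) * ennpow (remainder_kernel h z) (1/p)" for z
      using ennpow_add[of "1/q" "1/p" "remainder_kernel h z"] p q by (simp add: ennpow_one add.commute)
    have "(\<integral>\<^sup>+ z. ennpow (\<integral>\<^sup>+ w. ennpow (remainder_kernel h (z - w)) (1/q) * ennpow (remainder_kernel h (z - w)) (1/p) * f w \<partial>lborel) q \<partial>lborel)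
      \<le> ennpow (ennreal (C * h)) (q - 1) * ennreal (C * h) * (\<integral>\<^sup>+ w. ennpow (f w) q \<partial>lborel)"
    proof (rule schur_test[OF sf sf \<open>1 < q\<close> p])
      fix z :: complex
      have i: "(\<integral>\<^sup>+ w. remainder_kernel h (w - z) \<partial>lborel) \<le> ennreal (C * h)"
        using C(2)[OF h] by (subst nn_integral_lborel_shift) auto
      show "(\<integral>\<^sup>+ w. ennpow (ennpow (remainder_kernel h (z - w)) (1/p)) p \<partial>lborel) \<le> ennreal (C * h)"
        using i p by (simp add: ennpow_ennpow ennpow_one remainder_kernel_minus[of h z])
      show "(\<integral>\<^sup>+ w. ennpow (ennpow (remainder_kernel h (w - z)) (1/q)) q \<partial>lborel) \<le> ennreal (C * h)"
        using i q by (simp add: ennpow_ennpow ennpow_one)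
    qed measurable
    also have "ennpow (ennreal (C * h)) (q - 1) * ennreal (C * h) = ennreal ((C * h) powr (q - 1) * (C * h) powr 1)"
      using C h by (simp add: ennpow_ennreal flip: ennreal_mult)
    also have "(C * h) powr (q - 1) * (C * h) powr 1 = C powr q * h powr q"
      using C h by (subst powr_add[symmetric]) (simp add: powr_mult)
    finally show "(\<integral>\<^sup>+ z. ennpow (\<integral>\<^sup>+ w. remainder_kernel h (z - w) * f w \<partial>lborel) q \<partial>lborel) \<le> ennreal (C powr q * h powr q) * (\<integral>\<^sup>+ w. ennpow (f w) q \<partial>lborel)"
      by (simp flip: L)
  qed (use C in simp)
qed

section \<open>Integration by parts along chords\<close>

lemma has_vector_derivative_complex_of_real:
  "((\<lambda>t. of_real t :: complex) has_vector_derivative 1) (at t)"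
  using bounded_linear.has_vector_derivative[OF bounded_linear_of_real has_vector_derivative_id] by force

text \<open>Two integrations by parts done at once: \<open>G\<close> collects both boundary terms,
  and its derivative is the integrand plus the term with \<open>F2\<close>.\<close>

lemma oscillatory_integral_bound:
  fixes F F1 F2 :: "real \<Rightarrow> complex" and \<omega> :: real
  assumes "\<omega> \<noteq> 0" "a \<le> b"
    and F: "\<And>t. (F has_vector_derivative F1 t) (at t)" and F1: "\<And>t. (F1 has_vector_derivative F2 t) (at t)"
    and F2: "continuous_on UNIV F2"
  shows "ennreal (norm (LINT t|lborel. indicator {a..b} t *\<^sub>R (exp (- (\<i> * of_real (\<omega> * t))) * F t)))
    \<le> ennreal ((norm (F a) + norm (F b)) / \<bar>\<omega>\<bar> + (norm (F1 a) + norm (F1 b)) / \<omega>\<^sup>2)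
      + (\<integral>\<^sup>+ t. indicator {a..b} t * ennreal (norm (F2 t) / \<omega>\<^sup>2) \<partial>lborel)"
proof -
  let ?e = "\<lambda>t. exp (- (\<i> * of_real (\<omega> * t)))"
  \<comment> \<open>With \<open>?e' = - \<i> \<omega> ?e\<close>, the two contributions of
    \<open>F1\<close> to \<open>G'\<close> cancel and \<open>?e * (F + F2 / \<omega>^2)\<close>
    remains.\<close>
  define G where "G t = ?e t * (\<i> * F t / of_real \<omega> + F1 t / of_real (\<omega>\<^sup>2))" for t
  have contF: "continuous_on UNIV F" "continuous_on UNIV F1"
    using F F1 by (meson continuous_at_imp_continuous_on has_vector_derivative_continuous)+
  have e': "(?e has_vector_derivative - (\<i> * of_real \<omega>) * ?e t) (at t)" for t
  proof -
    have "((\<lambda>t. of_real t :: complex) has_vector_derivative 1) (at t)" 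
      by (rule has_vector_derivative_complex_of_real)
    then have "((\<lambda>x. exp (- (\<i> * of_real \<omega>) * x)) \<circ> of_real has_vector_derivative 1 * (- (\<i> * of_real \<omega>) * exp (- (\<i> * of_real \<omega>) * of_real t))) (at t)"
      by (rule field_vector_diff_chain_at) (auto intro!: derivative_eq_intros)
    then show ?thesis by (simp add: o_def mult.assoc)
  qed
  have G': "(G has_vector_derivative ?e t * (F t + F2 t / of_real (\<omega>\<^sup>2))) (at t within {a..b})" for t
  proof -
    have "(G has_vector_derivative ?e t * (\<i> * F1 t / of_real \<omega> + F2 t / of_real (\<omega>\<^sup>2)) + (- (\<i> * of_real \<omega>) * ?e t) * (\<i> * F t / of_real \<omega> + F1 t / of_real (\<omega>\<^sup>2))) (at t)"
      unfolding G_def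
      by (intro has_vector_derivative_mult e' has_vector_derivative_add has_vector_derivative_divide has_vector_derivative_mult_right F F1)
    moreover have "?e t * (\<i> * F1 t / of_real \<omega> + F2 t / of_real (\<omega>\<^sup>2)) + (- (\<i> * of_real \<omega>) * ?e t) * (\<i> * F t / of_real \<omega> + F1 t / of_real (\<omega>\<^sup>2))
       = ?e t * (F t + F2 t / of_real (\<omega>\<^sup>2))"
      using assms(1) by (simp add: field_simps power2_eq_square)
    ultimately show ?thesis by (simp add: has_vector_derivative_at_within)
  qed
  have conts: "continuous_on {a..b} (\<lambda>t. ?e t * F t)" "continuous_on {a..b} (\<lambda>t. ?e t * (F2 t / of_real (\<omega>\<^sup>2)))"
    using contF F2 \<open>\<omega> \<noteq> 0\<close> by (auto intro!: continuous_intros intro: continuous_on_subset)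
  have int: "integrable lborel (\<lambda>t. indicator {a..b} t *\<^sub>R (?e t * F t))" "integrable lborel (\<lambda>t. indicator {a..b} t *\<^sub>R (?e t * (F2 t / of_real (\<omega>\<^sup>2))))"
    using conts by (auto intro!: borel_integrable_compact)
  have "(LINT t|lborel. indicator {a..b} t *\<^sub>R (?e t * (F t + F2 t / of_real (\<omega>\<^sup>2)))) = G b - G a"
  proof (rule integral_FTC_Icc[OF \<open>a \<le> b\<close> G'])
    show "continuous_on {a..b} (\<lambda>t. ?e t * (F t + F2 t / of_real (\<omega>\<^sup>2)))"
      using continuous_on_add[OF conts] by (simp add: distrib_left)
  qed
  moreover have "(LINT t|lborel. indicator {a..b} t *\<^sub>R (?e t * (F t + F2 t / of_real (\<omega>\<^sup>2)))) =
     (LINT t|lborel. indicator {a..b} t *\<^sub>R (?e t * F t)) + (LINT t|lborel. indicator {a..b} t *\<^sub>R (?e t * (F2 t / of_real (\<omega>\<^sup>2))))"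
    using int by (simp add: distrib_left scaleR_add_right)
  ultimately have eq: "(LINT t|lborel. indicator {a..b} t *\<^sub>R (?e t * F t)) = G b - G a - (LINT t|lborel. indicator {a..b} t *\<^sub>R (?e t * (F2 t / of_real (\<omega>\<^sup>2))))"
    by simp
  have nG: "norm (G t) \<le> norm (F t) / \<bar>\<omega>\<bar> + norm (F1 t) / \<omega>\<^sup>2" for t
  proof -
    have "norm (G t) = norm (\<i> * F t / of_real \<omega> + F1 t / of_real (\<omega>\<^sup>2))" by (simp add: G_def norm_mult)
    also have "\<dots> \<le> norm (\<i> * F t / of_real \<omega>) + norm (F1 t / of_real (\<omega>\<^sup>2))" by (rule norm_triangle_ineq)
    finally show ?thesis by (simp add: norm_mult norm_divide norm_power)
  qed
  have "norm (LINT t|lborel. indicator {a..b} t *\<^sub>R (?e t * F t)) \<le> norm (G a) + norm (G b) + norm (LINT t|lborel. indicator {a..b} t *\<^sub>R (?e t * (F2 t / of_real (\<omega>\<^sup>2))))"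
    unfolding eq by (smt (verit) norm_triangle_ineq4)
  also have "\<dots> \<le> ((norm (F a) + norm (F b)) / \<bar>\<omega>\<bar> + (norm (F1 a) + norm (F1 b)) / \<omega>\<^sup>2) + norm (LINT t|lborel. indicator {a..b} t *\<^sub>R (?e t * (F2 t / of_real (\<omega>\<^sup>2))))"
    using nG[of a] nG[of b] by (simp add: add_divide_distrib)
  finally have "ennreal (norm (LINT t|lborel. indicator {a..b} t *\<^sub>R (?e t * F t))) \<le> ennreal ((norm (F a) + norm (F b)) / \<bar>\<omega>\<bar> + (norm (F1 a) + norm (F1 b)) / \<omega>\<^sup>2) + ennreal (norm (LINT t|lborel. indicator {a..b} t *\<^sub>R (?e t * (F2 t / of_real (\<omega>\<^sup>2)))))"
    by (simp add: ennreal_leI flip: ennreal_plus)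
  also have "ennreal (norm (LINT t|lborel. indicator {a..b} t *\<^sub>R (?e t * (F2 t / of_real (\<omega>\<^sup>2))))) \<le> (\<integral>\<^sup>+ t. ennreal (norm (indicator {a..b} t *\<^sub>R (?e t * (F2 t / of_real (\<omega>\<^sup>2))))) \<partial>lborel)"
    using int(2) by (rule integral_norm_bound_ennreal)
  also have "\<dots> = (\<integral>\<^sup>+ t. indicator {a..b} t * ennreal (norm (F2 t) / \<omega>\<^sup>2) \<partial>lborel)"
    by (intro nn_integral_cong) (auto simp: indicator_def norm_mult norm_divide norm_power)
  finally show ?thesis by (simp add: add_left_mono)
qed

text \<open>The shift is orthogonal to the chord and points away from the origin, hence it is constant along the
  chord and keeps the shifted denominators at distance at least \<open>h\<close> from zero.\<close>

definition transversal_shift :: "bool \<Rightarrow> real \<Rightarrow> complex \<Rightarrow> complex" where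
  "transversal_shift b h z = axis_point b (if 0 \<le> (if b then Re z else Im z) then h else -h) 0"

text \<open>The error is a second difference,
  \<open>1/z - recip_comb \<eta> z = 2 \<eta>\<^sup>2 / (z (z + \<eta>) (z + 2 \<eta>))\<close>, so it decays cubically and is integrable over the plane;
  \<open>1/(z + \<eta>)\<close> alone would lose a logarithm.\<close>

definition recip_comb :: "complex \<Rightarrow> complex \<Rightarrow> complex" where
  "recip_comb \<eta> z = 2 / (z + \<eta>) - 1 / (z + 2 * \<eta>)"
definition recip_comb_deriv :: "complex \<Rightarrow> complex \<Rightarrow> complex" where
  "recip_comb_deriv \<eta> z = - 2 / (z + \<eta>)^2 + 1 / (z + 2 * \<eta>)^2"
definition recip_comb_deriv2 :: "complex \<Rightarrow> complex \<Rightarrow> complex" where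
  "recip_comb_deriv2 \<eta> z = 4 / (z + \<eta>)^3 - 2 / (z + 2 * \<eta>)^3"

text \<open>Because the shift depends on the sign of a coordinate of \<open>z\<close>, this function
  jumps across the line through 0 parallel to the chords. It is differentiated only along chords,
  where it is a single rational function.\<close>

definition smoothed_recip :: "bool \<Rightarrow> real \<Rightarrow> complex \<Rightarrow> complex" where
  "smoothed_recip b h z = recip_comb (transversal_shift b h z) z"

definition smoothed_norm :: "real \<Rightarrow> complex \<Rightarrow> real" where "smoothed_norm h z = sqrt ((cmod z)\<^sup>2 + h\<^sup>2)"

lemma smoothed_norm_bounds:
  assumes "0 < h" shows "0 < smoothed_norm h z" "h \<le> smoothed_norm h z" "cmod z \<le> smoothed_norm h z"
proof -
  show "h \<le> smoothed_norm h z" "cmod z \<le> smoothed_norm h z" using assms by (auto simp: smoothed_norm_def intro!: real_le_rsqrt)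
  then show "0 < smoothed_norm h z" using assms by linarith
qed

text \<open>The shift has the sign of the coordinate it changes, so the cross term of the expanded
  square is nonnegative and at least h^2 is added.\<close>

lemma smoothed_norm_le_transversal_shift:
  assumes "0 < h" shows "smoothed_norm h z \<le> cmod (z + transversal_shift b h z)" "smoothed_norm h z \<le> cmod (z + 2 * transversal_shift b h z)"
proof -
  have sq: "a\<^sup>2 + h\<^sup>2 \<le> (a + c * (if 0 \<le> a then h else -h))\<^sup>2" if "1 \<le> c" for a c :: real
  proof -
    have "(a + c * (if 0 \<le> a then h else -h))\<^sup>2 = a\<^sup>2 + 2 * c * (\<bar>a\<bar> * h) + c\<^sup>2 * h\<^sup>2"
      by (auto simp: power2_eq_square algebra_simps)
    moreover have "h\<^sup>2 \<le> c\<^sup>2 * h\<^sup>2" using that mult_right_mono[of 1 "c\<^sup>2" "h\<^sup>2"] by simp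
    moreover have "0 \<le> 2 * c * (\<bar>a\<bar> * h)" using that assms by simp
    ultimately show ?thesis by linarith
  qed
  have "(cmod z)\<^sup>2 + h\<^sup>2 \<le> (cmod (z + of_real c * transversal_shift b h z))\<^sup>2" if "1 \<le> c" for c
    using sq[OF that, of "Re z"] sq[OF that, of "Im z"] by (cases b) (auto simp: transversal_shift_def axis_point_def cmod_power2)
  from this[of 1] this[of 2] show "smoothed_norm h z \<le> cmod (z + transversal_shift b h z)" "smoothed_norm h z \<le> cmod (z + 2 * transversal_shift b h z)"
    by (auto simp: smoothed_norm_def intro!: real_le_lsqrt)
qed

lemma recip_bounds:
  assumes "0 < r" "r \<le> cmod (z + \<eta>)" "r \<le> cmod (z + 2 * \<eta>)"
  shows "cmod (recip_comb \<eta> z) \<le> 3 / r" "cmod (recip_comb_deriv \<eta> z) \<le> 3 / r^2" "cmod (recip_comb_deriv2 \<eta> z) \<le> 6 / r^3"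
proof -
  have i: "c / cmod (z + \<eta>) ^ n \<le> c / r ^ n" "c / cmod (z + 2 * \<eta>) ^ n \<le> c / r ^ n" if "0 \<le> c" for c n
    using assms that by (auto intro!: divide_left_mono power_mono mult_pos_pos zero_less_power)
  have "cmod (recip_comb \<eta> z) \<le> 2 / cmod (z + \<eta>) ^ 1 + 1 / cmod (z + 2 * \<eta>) ^ 1"
    unfolding recip_comb_def by (rule norm_triangle_le_diff) (simp add: norm_divide)
  then show "cmod (recip_comb \<eta> z) \<le> 3 / r" using i(1)[of 2 1] i(2)[of 1 1] by simp
  have "cmod (recip_comb_deriv \<eta> z) \<le> 2 / cmod (z + \<eta>) ^ 2 + 1 / cmod (z + 2 * \<eta>) ^ 2"
    unfolding recip_comb_deriv_def by (rule norm_triangle_le) (simp add: norm_divide norm_power)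
  then show "cmod (recip_comb_deriv \<eta> z) \<le> 3 / r^2" using i(1)[of 2 2] i(2)[of 1 2] by simp
  have "cmod (recip_comb_deriv2 \<eta> z) \<le> 4 / cmod (z + \<eta>) ^ 3 + 2 / cmod (z + 2 * \<eta>) ^ 3"
    unfolding recip_comb_deriv2_def by (rule norm_triangle_le_diff) (simp add: norm_divide norm_power)
  then show "cmod (recip_comb_deriv2 \<eta> z) \<le> 6 / r^3" using i(1)[of 4 3] i(2)[of 2 3] by simp
qed

lemma has_field_derivative_inverse_power:
  fixes x c :: complex
  assumes "x \<noteq> 0"
  shows "((\<lambda>x. c / x ^ Suc n) has_field_derivative - (of_nat (Suc n) * c / x ^ Suc (Suc n))) (at x)"
proof -
  have "((\<lambda>x. c * inverse x ^ Suc n) has_field_derivative c * ((1 + of_nat n) * (- (inverse x ^ Suc (Suc 0)) * inverse x ^ n))) (at x)"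
    by (intro DERIV_cmult DERIV_power_Suc DERIV_inverse assms)
  then show ?thesis by (simp add: divide_inverse power_inverse mult_ac)
qed

lemma has_field_derivative_inverse_power_shift:
  fixes x c e :: complex
  assumes "x + e \<noteq> 0"
  shows "((\<lambda>x. c / (x + e) ^ Suc n) has_field_derivative - (of_nat (Suc n) * c / (x + e) ^ Suc (Suc n))) (at x)"
  using has_field_derivative_inverse_power[OF assms, of c n] by (subst (asm) DERIV_shift)

lemma recip_deriv:
  assumes "z + \<eta> \<noteq> 0" "z + 2 * \<eta> \<noteq> 0"
  shows "(recip_comb \<eta> has_field_derivative recip_comb_deriv \<eta> z) (at z)" "(recip_comb_deriv \<eta> has_field_derivative recip_comb_deriv2 \<eta> z) (at z)"
proof -
  note D = has_field_derivative_inverse_power_shift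
  from DERIV_diff[OF D[OF assms(1), of 2 0] D[OF assms(2), of 1 0]]
  show "(recip_comb \<eta> has_field_derivative recip_comb_deriv \<eta> z) (at z)"
    by (simp add: recip_comb_def[abs_def] recip_comb_deriv_def numeral_2_eq_2)
  from DERIV_add[OF D[OF assms(1), of "-2" 1] D[OF assms(2), of 1 1]]
  show "(recip_comb_deriv \<eta> has_field_derivative recip_comb_deriv2 \<eta> z) (at z)"
    by (simp add: recip_comb_deriv_def[abs_def] recip_comb_deriv2_def power2_eq_square power3_eq_cube mult.assoc)
qed

lemma inverse_smoothed_norm_le_cauchy_kernel:
  assumes "0 < h" shows "ennreal (1 / smoothed_norm h z) \<le> cauchy_kernel z"
proof (cases "z = 0")
  case False
  then show ?thesis using smoothed_norm_bounds[OF assms, of z] by (simp add: cauchy_kernel_eq ennreal_leI frac_le)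
qed simp

text \<open>Two of the three reciprocals form the cutoff factor of \<open>remainder_kernel\<close>
  exactly; the third is given up to \<open>cauchy_kernel\<close>. Second derivatives of the smoothed
  reciprocal have this cubic size, and the factor h^2 comes from
  \<open>1 / \<omega>^2\<close>.\<close>

lemma inverse_rho3_le_remainder_kernel:
  assumes "0 < h" shows "ennreal (h\<^sup>2 / smoothed_norm h z ^ 3) \<le> remainder_kernel h z"
proof -
  have "(smoothed_norm h z)\<^sup>2 = (cmod z)\<^sup>2 + h\<^sup>2" by (simp add: smoothed_norm_def)
  then have "ennreal (h\<^sup>2 / smoothed_norm h z ^ 3) = ennreal (h\<^sup>2 / ((cmod z)\<^sup>2 + h\<^sup>2)) * ennreal (1 / smoothed_norm h z)"
    using smoothed_norm_bounds[OF assms, of z] by (simp add: power3_eq_cube power2_eq_square flip: ennreal_mult)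
  also have "\<dots> \<le> remainder_kernel h z" unfolding remainder_kernel_def by (intro mult_left_mono inverse_smoothed_norm_le_cauchy_kernel assms) simp
  finally show ?thesis .
qed

lemma remainder_kernel_le_cauchy_kernel: "remainder_kernel h z \<le> cauchy_kernel z"
proof -
  have "h\<^sup>2 / ((cmod z)\<^sup>2 + h\<^sup>2) \<le> ((cmod z)\<^sup>2 + h\<^sup>2) / ((cmod z)\<^sup>2 + h\<^sup>2)"
    by (intro divide_right_mono) auto
  also have "\<dots> \<le> 1" by simp
  finally have "ennreal (h\<^sup>2 / ((cmod z)\<^sup>2 + h\<^sup>2)) \<le> 1" by simp
  from mult_right_mono[OF this, of "cauchy_kernel z"] show ?thesis by (simp add: remainder_kernel_def)
qed

lemma smoothed_recip_le_cauchy_kernel: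
  assumes "0 < h" shows "ennreal (cmod (smoothed_recip b h z)) \<le> 3 * cauchy_kernel z"
proof -
  have "cmod (smoothed_recip b h z) \<le> 3 * (1 / smoothed_norm h z)"
    using recip_bounds(1)[OF smoothed_norm_bounds(1)[OF assms] smoothed_norm_le_transversal_shift[OF assms, of z b]] by (simp add: smoothed_recip_def)
  then have "ennreal (cmod (smoothed_recip b h z)) \<le> 3 * ennreal (1 / smoothed_norm h z)" 
    by (metis ennreal_leI ennreal_mult' ennreal_numeral zero_le_numeral)
  also have "\<dots> \<le> 3 * cauchy_kernel z" by (intro mult_left_mono inverse_smoothed_norm_le_cauchy_kernel assms) simp
  finally show ?thesis .
qed

lemma inverse_minus_smoothed_recip_le_remainder_kernel:
  assumes h: "0 < h" shows "ennreal (cmod (1 / z - smoothed_recip b h z)) \<le> 2 * remainder_kernel h z"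
proof (cases "z = 0")
  case True
  have "0 < h\<^sup>2" using h by simp
  with True show ?thesis by (simp add: remainder_kernel_def ennreal_mult_top)
next
  case False
  define \<eta> where "\<eta> = transversal_shift b h z"
  have \<eta>: "cmod \<eta> = h" using h by (cases b) (auto simp: \<eta>_def transversal_shift_def axis_point_def cmod_def)
  have le: "smoothed_norm h z \<le> cmod (z + \<eta>)" "smoothed_norm h z \<le> cmod (z + 2 * \<eta>)" unfolding \<eta>_def by (rule smoothed_norm_le_transversal_shift[OF h])+
  have r0: "0 < smoothed_norm h z" using smoothed_norm_bounds[OF h] by simp
  have nz: "z + \<eta> \<noteq> 0" "z + 2 * \<eta> \<noteq> 0" using le r0 by auto
  have "1 / z - smoothed_recip b h z = 2 * \<eta>\<^sup>2 / (z * ((z + \<eta>) * (z + 2 * \<eta>)))"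
  proof -
    have "1 / z - (2 / a - 1 / b) = (a * b - 2 * b * z + a * z) / (z * (a * b))" if "a \<noteq> 0" "b \<noteq> 0" for a b :: complex
      using that False by (simp add: field_simps)
    from this[OF nz] show ?thesis
      unfolding smoothed_recip_def recip_comb_def \<eta>_def[symmetric] by (simp add: algebra_simps power2_eq_square)
  qed
  then have "cmod (1 / z - smoothed_recip b h z) = 2 * h\<^sup>2 / (cmod z * (cmod (z + \<eta>) * cmod (z + 2 * \<eta>)))"
    by (simp add: norm_mult norm_divide norm_power \<eta>)
  also have "\<dots> \<le> 2 * h\<^sup>2 / (cmod z * (smoothed_norm h z * smoothed_norm h z))"
    using le r0 False by (intro divide_left_mono mult_left_mono mult_mono mult_pos_pos) auto
  also have "smoothed_norm h z * smoothed_norm h z = (cmod z)\<^sup>2 + h\<^sup>2" by (simp add: smoothed_norm_def)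
  finally have "ennreal (cmod (1 / z - smoothed_recip b h z)) \<le> ennreal (2 * (h\<^sup>2 / ((cmod z)\<^sup>2 + h\<^sup>2) * (1 / cmod z)))"
    by (intro ennreal_leI) (simp add: mult_ac)
  also have "\<dots> = 2 * remainder_kernel h z" using False by (simp add: remainder_kernel_def cauchy_kernel_eq flip: ennreal_mult ennreal_numeral)
  finally show ?thesis .
qed

text \<open>With x = 1/r1 and y = 1/r2 the right side minus the left is 9 x y (x - y)^2. This
  removes the mixed first-derivative term of the Leibniz rule, leaving terms in which one factor
  carries both derivatives.\<close>

lemma sum_reciprocal_bounds:
  fixes r1 r2 :: real assumes "0 < r1" "0 < r2"
  shows "6 / r1^3 * (3 / r2) + 2 * (3 / r1^2 * (3 / r2^2)) + 3 / r1 * (6 / r2^3) \<le> 27 * (1 / r1^3 * (1 / r2) + 1 / r1 * (1 / r2^3))"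
proof -
  define x y where "x = 1 / r1" and "y = 1 / r2"
  have xy: "0 < x" "0 < y" using assms by (auto simp: x_def y_def)
  have "0 \<le> 9 * (x * y) * (x - y)^2" using xy by simp
  then have "6 * x^3 * (3 * y) + 2 * (3 * x^2 * (3 * y^2)) + 3 * x * (6 * y^3) \<le> 27 * (x^3 * y + x * y^3)"
    by (simp add: power2_eq_square power3_eq_cube algebra_simps)
  then show ?thesis by (simp add: x_def y_def power_divide)
qed

text \<open>The frequency condition gives 1/|\<omega>| <= h. Both constants are 27: at a chord end 9
  comes from \<open>F\<close> and 18 from \<open>F1\<close>, and in the interior it is the constant
  of \<open>sum_reciprocal_bounds\<close>.\<close>

lemma chord_integral_bound:
  assumes h: "0 < h" and \<omega>: "1 \<le> h * \<bar>\<omega>\<bar>" and ab: "\<alpha> \<le> \<beta>"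
  shows "ennreal (norm (LINT t|lborel. indicator {\<alpha>..\<beta>} t *\<^sub>R
        (exp (- (\<i> * of_real (\<omega> * t))) * (smoothed_recip b h (z - axis_point b s t) * cnj (smoothed_recip b h (axis_point b s t - w))))))
    \<le> 27 * (ennreal h * (cauchy_kernel (z - axis_point b s \<alpha>) * cauchy_kernel (axis_point b s \<alpha> - w) + cauchy_kernel (z - axis_point b s \<beta>) * cauchy_kernel (axis_point b s \<beta> - w)))
      + 27 * (\<integral>\<^sup>+ t. indicator {\<alpha>..\<beta>} t * (remainder_kernel h (z - axis_point b s t) * cauchy_kernel (axis_point b s t - w) + cauchy_kernel (z - axis_point b s t) * remainder_kernel h (axis_point b s t - w)) \<partial>lborel)"
proof -
  let ?d = "axis_point b 0 1"
  \<comment> \<open>The shifts at \<open>t = 0\<close> represent the whole chord, so that each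
    factor is one fixed rational function of the point on it.\<close>
  define \<eta>1 \<eta>2 where "\<eta>1 = transversal_shift b h (z - axis_point b s 0)" and "\<eta>2 = transversal_shift b h (axis_point b s 0 - w)"
  have tr: "transversal_shift b h (z - axis_point b s t) = \<eta>1" "transversal_shift b h (axis_point b s t - w) = \<eta>2" for t
    by (cases b; simp add: \<eta>1_def \<eta>2_def transversal_shift_def axis_point_def)+
  define r1 r2 where "r1 t = smoothed_norm h (z - axis_point b s t)" and "r2 t = smoothed_norm h (axis_point b s t - w)" for t
  have r: "0 < r1 t" "0 < r2 t" "h \<le> r1 t" "h \<le> r2 t" for t
    using smoothed_norm_bounds[OF h] by (auto simp: r1_def r2_def)
  have le: "r1 t \<le> cmod (z - axis_point b s t + \<eta>1)" "r1 t \<le> cmod (z - axis_point b s t + 2 * \<eta>1)"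
    "r2 t \<le> cmod (axis_point b s t - w + \<eta>2)" "r2 t \<le> cmod (axis_point b s t - w + 2 * \<eta>2)" for t
    using smoothed_norm_le_transversal_shift[OF h, of "z - axis_point b s t" b] smoothed_norm_le_transversal_shift[OF h, of "axis_point b s t - w" b]
    by (auto simp: r1_def r2_def tr)
  have nz: "z - axis_point b s t + \<eta>1 \<noteq> 0" "z - axis_point b s t + 2 * \<eta>1 \<noteq> 0" "axis_point b s t - w + \<eta>2 \<noteq> 0" "axis_point b s t - w + 2 * \<eta>2 \<noteq> 0" for t
    using le[of t] r[of t] by auto
  define P0 P1 P2 Q0 Q1 Q2 where "P0 t = recip_comb \<eta>1 (z - axis_point b s t)" and "P1 t = - ?d * recip_comb_deriv \<eta>1 (z - axis_point b s t)"
    and "P2 t = ?d\<^sup>2 * recip_comb_deriv2 \<eta>1 (z - axis_point b s t)" and "Q0 t = cnj (recip_comb \<eta>2 (axis_point b s t - w))"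
    and "Q1 t = cnj (?d * recip_comb_deriv \<eta>2 (axis_point b s t - w))" and "Q2 t = cnj (?d\<^sup>2 * recip_comb_deriv2 \<eta>2 (axis_point b s t - w))" for t
  have lin: "axis_point b s t = axis_point b s 0 + of_real t * ?d" for t by (cases b) (auto simp: axis_point_def complex_eq_iff)
  have line: "((\<lambda>t. axis_point b s t) has_vector_derivative ?d) (at t)" for t
  proof -
    have "((\<lambda>t. axis_point b s 0 + of_real t * ?d) has_vector_derivative 0 + 1 * ?d) (at t)"
      by (intro has_vector_derivative_add has_vector_derivative_mult_left has_vector_derivative_const has_vector_derivative_complex_of_real)
    then show ?thesis by (subst lin) simp
  qed
  have l1: "((\<lambda>t. z - axis_point b s t) has_vector_derivative - ?d) (at t)" and l2: "((\<lambda>t. axis_point b s t - w) has_vector_derivative ?d) (at t)" for t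
    using has_vector_derivative_diff[OF has_vector_derivative_const[of z] line[of t]]
      has_vector_derivative_diff[OF line[of t] has_vector_derivative_const[of w]] by auto
  have P: "(P0 has_vector_derivative P1 t) (at t)" "(P1 has_vector_derivative P2 t) (at t)" for t
  proof -
    from field_vector_diff_chain_at[OF l1 recip_deriv(1)[OF nz(1,2)], of t]
    show "(P0 has_vector_derivative P1 t) (at t)" by (simp add: o_def P0_def[abs_def] P1_def)
    from has_vector_derivative_mult_right[OF field_vector_diff_chain_at[OF l1 recip_deriv(2)[OF nz(1,2)], of t], of "- ?d"]
    show "(P1 has_vector_derivative P2 t) (at t)" by (simp add: o_def P1_def[abs_def] P2_def power2_eq_square mult.assoc)
  qed
  \<comment> \<open>Although \<open>cnj\<close> is not holomorphic, it commutes with differentiation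
    in the real parameter \<open>t\<close>.\<close>
  have Q: "(Q0 has_vector_derivative Q1 t) (at t)" "(Q1 has_vector_derivative Q2 t) (at t)" for t
  proof -
    from has_vector_derivative_cnj[OF field_vector_diff_chain_at[OF l2 recip_deriv(1)[OF nz(3,4)], of t]]
    show "(Q0 has_vector_derivative Q1 t) (at t)" by (simp add: o_def Q0_def[abs_def] Q1_def)
    from has_vector_derivative_cnj[OF has_vector_derivative_mult_right[OF field_vector_diff_chain_at[OF l2 recip_deriv(2)[OF nz(3,4)], of t], of "?d"]]
    show "(Q1 has_vector_derivative Q2 t) (at t)" by (simp add: o_def Q1_def[abs_def] Q2_def power2_eq_square mult.assoc)
  qed
  define F F1 F2 where "F t = P0 t * Q0 t" and "F1 t = P0 t * Q1 t + P1 t * Q0 t"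
    and "F2 t = (P0 t * Q2 t + P1 t * Q1 t) + (P1 t * Q1 t + P2 t * Q0 t)" for t
  have dF: "(F has_vector_derivative F1 t) (at t)" "(F1 has_vector_derivative F2 t) (at t)" for t
    unfolding F_def[abs_def] F1_def[abs_def] F2_def by (intro has_vector_derivative_add has_vector_derivative_mult P Q)+
  have cont: "continuous_on UNIV F2"
  proof -
    have c: "continuous_on UNIV P0" "continuous_on UNIV P1" "continuous_on UNIV Q0" "continuous_on UNIV Q1"
      using P Q by (meson continuous_at_imp_continuous_on has_vector_derivative_continuous)+
    have contc: "continuous_on UNIV (axis_point b s)" using line by (meson continuous_at_imp_continuous_on has_vector_derivative_continuous)
    have "continuous_on UNIV P2" "continuous_on UNIV Q2"
      unfolding P2_def[abs_def] Q2_def[abs_def] recip_comb_deriv2_def using nz by (intro continuous_intros contc; simp)+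
    with c show ?thesis unfolding F2_def[abs_def] by (intro continuous_intros)
  qed
  have d1: "cmod ?d = 1" by (cases b) (auto simp: axis_point_def cmod_def)
  have nP: "cmod (P0 t) \<le> 3 / r1 t" "cmod (P1 t) \<le> 3 / r1 t ^ 2" "cmod (P2 t) \<le> 6 / r1 t ^ 3"
    and nQ: "cmod (Q0 t) \<le> 3 / r2 t" "cmod (Q1 t) \<le> 3 / r2 t ^ 2" "cmod (Q2 t) \<le> 6 / r2 t ^ 3" for t
    using recip_bounds[OF r(1) le(1,2), of t] recip_bounds[OF r(2) le(3,4), of t]
    by (auto simp: P0_def P1_def P2_def Q0_def Q1_def Q2_def norm_mult norm_power d1)
  have l0: "\<omega> \<noteq> 0" using \<omega> by auto
  have l1': "1 / \<bar>\<omega>\<bar> \<le> h" using \<omega> l0 by (simp add: field_simps)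
  have l2': "1 / \<omega>\<^sup>2 \<le> h\<^sup>2" using power_mono[OF l1', of 2] by (simp add: power_divide)
  have NN: "ennreal (1 / r1 t * (1 / r2 t)) \<le> cauchy_kernel (z - axis_point b s t) * cauchy_kernel (axis_point b s t - w)" for t
    using mult_mono[OF inverse_smoothed_norm_le_cauchy_kernel[OF h, of "z - axis_point b s t"] inverse_smoothed_norm_le_cauchy_kernel[OF h, of "axis_point b s t - w"]] r[of t]
    by (simp add: r1_def r2_def less_imp_le flip: ennreal_mult)
  have bdry: "norm (F t) / \<bar>\<omega>\<bar> + norm (F1 t) / \<omega>\<^sup>2 \<le> 27 * (h * (1 / r1 t * (1 / r2 t)))" for t
  proof -
    have "norm (F t) \<le> 9 * (1 / r1 t * (1 / r2 t))"
      using mult_mono[OF nP(1) nQ(1), of t t] r[of t] by (simp add: F_def norm_mult)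
    then have 1: "norm (F t) * (1 / \<bar>\<omega>\<bar>) \<le> 9 * (1 / r1 t * (1 / r2 t)) * h"
      using l1' r[of t] by (intro mult_mono) (auto simp: less_imp_le)
    \<comment> \<open>Each product in \<open>F1\<close> has one reciprocal too many; as the radii
      are at least h it is traded for 1/h, which lowers the prefactor h^2 to h.\<close>
    have x: "1 / r ^ 2 \<le> (1 / r) * (1 / h)" if "h \<le> r" for r
      using that h by (simp add: power2_eq_square frac_le)
    have "norm (F1 t) \<le> norm (P0 t) * norm (Q1 t) + norm (P1 t) * norm (Q0 t)"
      unfolding F1_def using norm_triangle_ineq by (metis norm_mult)
    also have "\<dots> \<le> 3 / r1 t * (3 / r2 t ^ 2) + 3 / r1 t ^ 2 * (3 / r2 t)"
      using nP[of t] nQ[of t] r[of t] by (intro add_mono mult_mono) (auto simp: less_imp_le)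
    also have "\<dots> = 9 * (1 / r1 t * (1 / r2 t ^ 2) + (1 / r1 t ^ 2) * (1 / r2 t))" by simp
    also have "\<dots> \<le> 9 * (1 / r1 t * ((1 / r2 t) * (1 / h)) + ((1 / r1 t) * (1 / h)) * (1 / r2 t))"
      using x r[of t] by (intro mult_left_mono add_mono mult_right_mono) (auto simp: less_imp_le)
    also have "\<dots> = 18 * (1 / r1 t * (1 / r2 t)) * (1 / h)" by simp
    finally have "norm (F1 t) * (1 / \<omega>\<^sup>2) \<le> 18 * (1 / r1 t * (1 / r2 t)) * (1 / h) * h\<^sup>2"
      using l2' r[of t] h by (intro mult_mono) (auto simp: less_imp_le)
    also have "\<dots> = 18 * (1 / r1 t * (1 / r2 t)) * h" using h by (simp add: power2_eq_square)
    finally have 2: "norm (F1 t) * (1 / \<omega>\<^sup>2) \<le> 18 * (1 / r1 t * (1 / r2 t)) * h" .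
    define A where "A = 1 / r1 t * (1 / r2 t)"
    show ?thesis using 1 2 unfolding A_def[symmetric] by (simp add: mult_ac)
  qed
  have inner: "ennreal (norm (F2 t) / \<omega>\<^sup>2) \<le> 27 * (remainder_kernel h (z - axis_point b s t) * cauchy_kernel (axis_point b s t - w) + cauchy_kernel (z - axis_point b s t) * remainder_kernel h (axis_point b s t - w))" for t
  proof -
    have "norm (F2 t) \<le> norm (P0 t * Q2 t) + norm (P1 t * Q1 t) + (norm (P1 t * Q1 t) + norm (P2 t * Q0 t))"
      unfolding F2_def by (intro norm_triangle_mono order_refl norm_triangle_ineq)
    also have "\<dots> = norm (P2 t) * norm (Q0 t) + 2 * (norm (P1 t) * norm (Q1 t)) + norm (P0 t) * norm (Q2 t)" by (simp add: norm_mult)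
    also have "\<dots> \<le> 6 / r1 t^3 * (3 / r2 t) + 2 * (3 / r1 t^2 * (3 / r2 t^2)) + 3 / r1 t * (6 / r2 t^3)"
      using nP[of t] nQ[of t] r[of t] by (intro add_mono mult_mono) (auto simp: less_imp_le)
    also have "\<dots> \<le> 27 * (1 / r1 t^3 * (1 / r2 t) + 1 / r1 t * (1 / r2 t^3))" by (rule sum_reciprocal_bounds[OF r(1,2)])
    finally have "norm (F2 t) * (1 / \<omega>\<^sup>2) \<le> 27 * (1 / r1 t^3 * (1 / r2 t) + 1 / r1 t * (1 / r2 t^3)) * h\<^sup>2"
      using l2' r[of t] h by (intro mult_mono) (auto simp: less_imp_le)
    also have "\<dots> = 27 * (h\<^sup>2 / r1 t^3 * (1 / r2 t) + 1 / r1 t * (h\<^sup>2 / r2 t^3))" by (simp add: algebra_simps)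
    finally have "ennreal (norm (F2 t) / \<omega>\<^sup>2) \<le> ennreal (27 * (h\<^sup>2 / r1 t^3 * (1 / r2 t) + 1 / r1 t * (h\<^sup>2 / r2 t^3)))"
      by (simp add: ennreal_leI)
    also have "\<dots> = 27 * (ennreal (h\<^sup>2 / r1 t^3) * ennreal (1 / r2 t) + ennreal (1 / r1 t) * ennreal (h\<^sup>2 / r2 t^3))"
      using r[of t] by (simp add: ennreal_mult[symmetric] ennreal_plus[symmetric] less_imp_le del: ennreal_plus flip: ennreal_numeral)
    also have "\<dots> \<le> 27 * (remainder_kernel h (z - axis_point b s t) * cauchy_kernel (axis_point b s t - w) + cauchy_kernel (z - axis_point b s t) * remainder_kernel h (axis_point b s t - w))"
      unfolding r1_def r2_def by (intro mult_left_mono add_mono mult_mono inverse_smoothed_norm_le_cauchy_kernel[OF h] inverse_rho3_le_remainder_kernel[OF h]) auto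
    finally show ?thesis .
  qed
  have eqF: "smoothed_recip b h (z - axis_point b s t) * cnj (smoothed_recip b h (axis_point b s t - w)) = F t" for t
    by (simp add: smoothed_recip_def tr F_def P0_def Q0_def)
  have "ennreal (norm (LINT t|lborel. indicator {\<alpha>..\<beta>} t *\<^sub>R (exp (- (\<i> * of_real (\<omega> * t))) * F t)))
     \<le> ennreal ((norm (F \<alpha>) + norm (F \<beta>)) / \<bar>\<omega>\<bar> + (norm (F1 \<alpha>) + norm (F1 \<beta>)) / \<omega>\<^sup>2)
      + (\<integral>\<^sup>+ t. indicator {\<alpha>..\<beta>} t * ennreal (norm (F2 t) / \<omega>\<^sup>2) \<partial>lborel)"
    by (rule oscillatory_integral_bound[OF l0 ab dF cont])
  also have "\<dots> \<le> 27 * (ennreal h * (cauchy_kernel (z - axis_point b s \<alpha>) * cauchy_kernel (axis_point b s \<alpha> - w) + cauchy_kernel (z - axis_point b s \<beta>) * cauchy_kernel (axis_point b s \<beta> - w))) +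
     (\<integral>\<^sup>+ t. 27 * (indicator {\<alpha>..\<beta>} t * (remainder_kernel h (z - axis_point b s t) * cauchy_kernel (axis_point b s t - w) + cauchy_kernel (z - axis_point b s t) * remainder_kernel h (axis_point b s t - w))) \<partial>lborel)"
  proof (rule add_mono)
    have "ennreal ((norm (F \<alpha>) + norm (F \<beta>)) / \<bar>\<omega>\<bar> + (norm (F1 \<alpha>) + norm (F1 \<beta>)) / \<omega>\<^sup>2)
        \<le> ennreal (27 * (h * (1 / r1 \<alpha> * (1 / r2 \<alpha>) + 1 / r1 \<beta> * (1 / r2 \<beta>))))"
      using bdry[of \<alpha>] bdry[of \<beta>] by (intro ennreal_leI) (simp add: add_divide_distrib distrib_left)
    also have "\<dots> = 27 * (ennreal h * (ennreal (1 / r1 \<alpha> * (1 / r2 \<alpha>)) + ennreal (1 / r1 \<beta> * (1 / r2 \<beta>))))"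
      using r[of \<alpha>] r[of \<beta>] h by (simp add: ennreal_mult[symmetric] ennreal_plus[symmetric] less_imp_le del: ennreal_plus flip: ennreal_numeral)
    also have "\<dots> \<le> 27 * (ennreal h * (cauchy_kernel (z - axis_point b s \<alpha>) * cauchy_kernel (axis_point b s \<alpha> - w) + cauchy_kernel (z - axis_point b s \<beta>) * cauchy_kernel (axis_point b s \<beta> - w)))"
      by (intro mult_left_mono add_mono NN) auto
    finally show "ennreal ((norm (F \<alpha>) + norm (F \<beta>)) / \<bar>\<omega>\<bar> + (norm (F1 \<alpha>) + norm (F1 \<beta>)) / \<omega>\<^sup>2) \<le> \<dots>" .
    show "(\<integral>\<^sup>+ t. indicator {\<alpha>..\<beta>} t * ennreal (norm (F2 t) / \<omega>\<^sup>2) \<partial>lborel) \<le>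
      (\<integral>\<^sup>+ t. 27 * (indicator {\<alpha>..\<beta>} t * (remainder_kernel h (z - axis_point b s t) * cauchy_kernel (axis_point b s t - w) + cauchy_kernel (z - axis_point b s t) * remainder_kernel h (axis_point b s t - w))) \<partial>lborel)"
      using inner by (intro nn_integral_mono) (auto simp: indicator_def)
  qed
  also have "(\<integral>\<^sup>+ t. 27 * (indicator {\<alpha>..\<beta>} t * (remainder_kernel h (z - axis_point b s t) * cauchy_kernel (axis_point b s t - w) + cauchy_kernel (z - axis_point b s t) * remainder_kernel h (axis_point b s t - w))) \<partial>lborel)
    = 27 * (\<integral>\<^sup>+ t. indicator {\<alpha>..\<beta>} t * (remainder_kernel h (z - axis_point b s t) * cauchy_kernel (axis_point b s t - w) + cauchy_kernel (z - axis_point b s t) * remainder_kernel h (axis_point b s t - w)) \<partial>lborel)"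
    by (intro nn_integral_cmult) measurable
  finally show ?thesis by (simp add: eqF)
qed

section \<open>Chords and boundary measures of convex sets\<close>

definition chord :: "bool \<Rightarrow> complex set \<Rightarrow> real \<Rightarrow> real set" where
  "chord b \<Omega> s = {t. axis_point b s t \<in> \<Omega>}"

definition shadow :: "bool \<Rightarrow> complex set \<Rightarrow> real set" where
  "shadow b \<Omega> = {s. chord b \<Omega> s \<noteq> {}}"

text \<open>The value 0 off the shadow is a filler: it avoids \<open>Sup\<close> and
  \<open>Inf\<close> of the empty set, keeps the function measurable, and
  \<open>boundary_measure\<close> puts no mass on such \<open>s\<close>.\<close>

definition chord_end :: "bool \<Rightarrow> bool \<Rightarrow> complex set \<Rightarrow> real \<Rightarrow> real" where
  "chord_end up b \<Omega> s = (if s \<in> shadow b \<Omega> then (if up then Sup (chord b \<Omega> s) else Inf (chord b \<Omega> s)) else 0)"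

text \<open>The boundary carries the transversal coordinate measure \<open>ds\<close> rather than arc length. As
  \<open>|z - w|\<close> is at least the difference of the \<open>s\<close>-coordinates, regularity needs no smoothness.\<close>

definition boundary_measure :: "bool \<Rightarrow> bool \<Rightarrow> complex set \<Rightarrow> complex measure" where
  "boundary_measure up b \<Omega> = distr (density lborel (\<lambda>s. indicator (shadow b \<Omega>) s)) borel (\<lambda>s. axis_point b s (chord_end up b \<Omega> s))"

lemma continuous_on_axis_point: "continuous_on UNIV (\<lambda>s. axis_point b s t)" "continuous_on UNIV (\<lambda>t. axis_point b s t)"
  by (cases b; auto simp: axis_point_def Complex_eq intro!: continuous_intros)+

lemma abs_le_cmod_axis_point: "\<bar>s\<bar> \<le> cmod (axis_point b s t)" "\<bar>t\<bar> \<le> cmod (axis_point b s t)"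
  using abs_Re_le_cmod[of "axis_point b s t"] abs_Im_le_cmod[of "axis_point b s t"] by (cases b; simp add: axis_point_def)+

section \<open>Positive kernel operators and the oscillating phase\<close>

definition area :: "complex set \<Rightarrow> complex measure" where
  "area \<Omega> = density lborel (indicator \<Omega>)"

definition kernel_op :: "(complex \<Rightarrow> ennreal) \<Rightarrow> complex measure \<Rightarrow> (complex \<Rightarrow> ennreal) \<Rightarrow> complex \<Rightarrow> ennreal" where
  "kernel_op K \<nu> f z = (\<integral>\<^sup>+ w. K (z - w) * f w \<partial>\<nu>)"

lemma measurable_kernel_op:
  assumes [measurable]: "K \<in> borel_measurable borel" "f \<in> borel_measurable borel"
    and s: "sets \<nu> = sets borel" "sigma_finite_measure \<nu>"
  shows "kernel_op K \<nu> f \<in> borel_measurable borel"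
proof -
  interpret sigma_finite_measure \<nu> by fact
  note [measurable_cong] = s(1)
  show ?thesis unfolding kernel_op_def[abs_def] by measurable
qed

lemma exp_imaginary_phase: "exp (- (k * w) + cnj (k * w)) = exp (- (\<i> * of_real (2 * Im (k * w))))"
proof -
  have "- x + cnj x = - (\<i> * of_real (2 * Im x))" for x by (simp add: complex_eq_iff)
  then show ?thesis by metis
qed

lemma cmod_phase [simp]: "cmod (exp (- (k * w) + cnj (k * w))) = 1" "cmod (exp (k * w - cnj (k * w))) = 1"
  by (simp_all add: norm_exp_eq_Re)

text \<open>2 Im (k w) = 2 Re k Im w + 2 Im k Re w, and since |k| <= |Re k| + |Im k|, one of the two
  frequencies is at least |k| in modulus. \<open>b\<close> selects that coordinate; the other
  contributes the unimodular factor \<open>e s\<close>.\<close>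

lemma phase_split:
  obtains b \<omega> e where "cmod k \<le> \<bar>\<omega>\<bar>" "\<And>s. cmod (e s) = 1"
    "\<And>s t. exp (- (k * axis_point b s t) + cnj (k * axis_point b s t)) = e s * exp (- (\<i> * of_real (\<omega> * t)))"
proof -
  have "cmod k \<le> \<bar>2 * Re k\<bar> \<or> cmod k \<le> \<bar>2 * Im k\<bar>" using cmod_le[of k] by linarith
  then show ?thesis
  proof
    assume *: "cmod k \<le> \<bar>2 * Re k\<bar>"
    show ?thesis
    proof (rule that[OF *, of "\<lambda>s. exp (- (\<i> * of_real (2 * Im k * s)))" True])
      show "exp (- (k * axis_point True s t) + cnj (k * axis_point True s t)) = exp (- (\<i> * of_real (2 * Im k * s))) * exp (- (\<i> * of_real (2 * Re k * t)))" for s t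
        unfolding exp_imaginary_phase exp_add[symmetric] by (simp add: axis_point_def algebra_simps)
    qed (simp add: norm_exp_eq_Re)
  next
    assume *: "cmod k \<le> \<bar>2 * Im k\<bar>"
    show ?thesis
    proof (rule that[OF *, of "\<lambda>s. exp (- (\<i> * of_real (2 * Re k * s)))" False])
      show "exp (- (k * axis_point False s t) + cnj (k * axis_point False s t)) = exp (- (\<i> * of_real (2 * Re k * s))) * exp (- (\<i> * of_real (2 * Im k * t)))" for s t
        unfolding exp_imaginary_phase exp_add[symmetric] by (simp add: axis_point_def algebra_simps)
    qed (simp add: norm_exp_eq_Re)
  qed
qed

text \<open>A non-integrable function has Bochner integral 0, so the inequality holds for every
  \<open>f\<close>.\<close>

lemma norm_integral_le_nn_integral:
  fixes f :: "'a \<Rightarrow> 'b::{banach, second_countable_topology}"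
  shows "ennreal (norm (LINT x|M. f x)) \<le> (\<integral>\<^sup>+ x. ennreal (norm (f x)) \<partial>M)"
  by (cases "integrable M f") (auto simp: integral_norm_bound_ennreal not_integrable_integral_eq)

lemma measurable_cnj [measurable (raw)]:
  assumes "f \<in> borel_measurable M" shows "(\<lambda>x. cnj (f x)) \<in> borel_measurable M"
proof -
  have "cnj \<in> borel_measurable borel" by (intro borel_measurable_continuous_onI continuous_intros)
  from measurable_compose[OF assms this] show ?thesis .
qed

lemma measurable_smoothed_recip [measurable]: "smoothed_recip b h \<in> borel_measurable borel"
  unfolding smoothed_recip_def[abs_def] recip_comb_def transversal_shift_def by (cases b) (simp_all; measurable)+

context
  fixes \<Omega> :: "complex set" and R :: real
  assumes op: "open \<Omega>" and cv: "convex \<Omega>" and bd: "\<Omega> \<subseteq> cball 0 R"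
begin

lemma open_chord: "open (chord b \<Omega> s)"
  using open_vimage[OF op continuous_on_axis_point(2)] by (simp add: chord_def vimage_def)

lemma open_axis_point_fst: "open {s. axis_point b s t \<in> \<Omega>}"
  using open_vimage[OF op continuous_on_axis_point(1)] by (simp add: vimage_def)

lemma chord_bound: "t \<in> chord b \<Omega> s \<Longrightarrow> \<bar>t\<bar> \<le> R"
  using bd abs_le_cmod_axis_point(2)[of t b s] by (force simp: chord_def)

lemma bdd_chord: "bdd_above (chord b \<Omega> s)" "bdd_below (chord b \<Omega> s)"
  using chord_bound by (auto simp: abs_le_iff intro!: bdd_aboveI[of _ R] bdd_belowI[of _ "-R"]) (metis minus_le_iff)

lemma shadow_bound: "s \<in> shadow b \<Omega> \<Longrightarrow> \<bar>s\<bar> \<le> R"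
  using bd order_trans[OF abs_le_cmod_axis_point(1)[of s b]] by (fastforce simp: shadow_def chord_def)

lemma open_shadow: "open (shadow b \<Omega>)"
proof -
  have "shadow b \<Omega> = (\<Union>t. {s. axis_point b s t \<in> \<Omega>})" by (auto simp: shadow_def chord_def)
  then show ?thesis using open_axis_point_fst by auto
qed

lemma convex_chord: "convex (chord b \<Omega> s)"
proof (rule convexI)
  fix x y u v :: real assume *: "x \<in> chord b \<Omega> s" "y \<in> chord b \<Omega> s" "0 \<le> u" "0 \<le> v" "u + v = 1"
  have "u *\<^sub>R axis_point b s x + v *\<^sub>R axis_point b s y \<in> \<Omega>" using * cv by (auto simp: chord_def intro: convexD)
  also have "u *\<^sub>R axis_point b s x + v *\<^sub>R axis_point b s y = axis_point b s (u *\<^sub>R x + v *\<^sub>R y)"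
    using * by (cases b) (auto simp: axis_point_def complex_eq_iff simp flip: distrib_right)
  finally show "u *\<^sub>R x + v *\<^sub>R y \<in> chord b \<Omega> s" by (simp add: chord_def)
qed

text \<open>Openness keeps the extrema out of the chord, convexity puts everything between them into
  it. Hence each chord has exactly two end-point terms.\<close>

lemma chord_eq:
  assumes "s \<in> shadow b \<Omega>"
  shows "chord b \<Omega> s = {chord_end False b \<Omega> s<..<chord_end True b \<Omega> s}" "chord_end False b \<Omega> s \<le> chord_end True b \<Omega> s"
proof -
  let ?I = "chord b \<Omega> s"
  have ne: "?I \<noteq> {}" using assms by (simp add: shadow_def)
  have e: "chord_end False b \<Omega> s = Inf ?I" "chord_end True b \<Omega> s = Sup ?I" using assms by (auto simp: chord_end_def)
  have lt: "Inf ?I < x \<and> x < Sup ?I" if x: "x \<in> ?I" for x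
  proof -
    obtain d where d: "0 < d" "ball x d \<subseteq> ?I" using openE[OF open_chord x] by blast
    then have "x + d/2 \<in> ?I" "x - d/2 \<in> ?I" by (auto simp: subset_iff dist_real_def)
    then have "x + d/2 \<le> Sup ?I" "Inf ?I \<le> x - d/2" using bdd_chord by (auto intro: cSup_upper cInf_lower)
    then show ?thesis using d by linarith
  qed
  have ge: "x \<in> ?I" if x: "Inf ?I < x" "x < Sup ?I" for x
  proof -
    obtain y where y: "y \<in> ?I" "y < x" using x ne bdd_chord by (meson cInf_less_iff)
    obtain z where z: "z \<in> ?I" "x < z" using x ne bdd_chord by (meson less_cSup_iff)
    have "is_interval ?I" using convex_chord is_interval_convex_1 by blast
    then show ?thesis using y z by (meson less_imp_le mem_is_interval_1_I)
  qed
  show "?I = {chord_end False b \<Omega> s<..<chord_end True b \<Omega> s}" unfolding e using lt ge by auto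
  show "chord_end False b \<Omega> s \<le> chord_end True b \<Omega> s" unfolding e using ne lt by (meson all_not_in_conv less_imp_le less_trans)
qed

text \<open>On the shadow the ends are semicontinuous: a superlevel set of the supremum, and a
  sublevel set of the infimum, is a union of open slices of \<Omega>. The filler 0 adds the
  complement of the shadow or nothing.\<close>

lemma measurable_chord_end [measurable]: "chord_end up b \<Omega> \<in> borel_measurable borel"
proof -
  have I: "shadow b \<Omega> \<in> sets borel" using open_shadow by simp
  have S: "{s \<in> shadow b \<Omega>. y < Sup (chord b \<Omega> s)} = (\<Union>t\<in>{y<..}. {s. axis_point b s t \<in> \<Omega>})" for y
    using less_cSup_iff[OF _ bdd_chord(1)[of b]] by (fastforce simp: shadow_def chord_def)
  have J: "{s \<in> shadow b \<Omega>. Inf (chord b \<Omega> s) < y} = (\<Union>t\<in>{..<y}. {s. axis_point b s t \<in> \<Omega>})" for y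
    using cInf_less_iff[OF _ bdd_chord(2)[of b]] by (fastforce simp: shadow_def chord_def)
  show ?thesis
  proof (cases up)
    case True
    show ?thesis unfolding borel_measurable_iff_greater
    proof
      fix y
      have "{w \<in> space borel. y < chord_end up b \<Omega> w} = {s \<in> shadow b \<Omega>. y < Sup (chord b \<Omega> s)} \<union> (if y < 0 then - shadow b \<Omega> else {})"
        using True by (auto simp: chord_end_def)
      moreover have "{s \<in> shadow b \<Omega>. y < Sup (chord b \<Omega> s)} \<in> sets borel"
        unfolding S using open_axis_point_fst by (intro borel_open open_UN) auto
      ultimately show "{w \<in> space borel. y < chord_end up b \<Omega> w} \<in> sets borel" using I by auto
    qed
  next
    case False
    show ?thesis unfolding borel_measurable_iff_less
    proof
      fix y
      have "{w \<in> space borel. chord_end up b \<Omega> w < y} = {s \<in> shadow b \<Omega>. Inf (chord b \<Omega> s) < y} \<union> (if 0 < y then - shadow b \<Omega> else {})"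
        using False by (auto simp: chord_end_def)
      moreover have "{s \<in> shadow b \<Omega>. Inf (chord b \<Omega> s) < y} \<in> sets borel"
        unfolding J using open_axis_point_fst by (intro borel_open open_UN) auto
      ultimately show "{w \<in> space borel. chord_end up b \<Omega> w < y} \<in> sets borel" using I by auto
    qed
  qed
qed

text \<open>Places the boundary measures in the same disc as \<Omega>, as the comparison of the
  weight with the Cauchy kernel requires.\<close>

lemma chord_end_in_closure:
  assumes s: "s \<in> shadow b \<Omega>" shows "cmod (axis_point b s (chord_end up b \<Omega> s)) \<le> R"
proof -
  let ?I = "chord b \<Omega> s"
  have "chord_end up b \<Omega> s \<in> closure ?I"
    using s bdd_chord closure_contains_Sup[of ?I] closure_contains_Inf[of ?I] by (auto simp: chord_end_def shadow_def)
  moreover have "closure ?I \<subseteq> {t. cmod (axis_point b s t) \<le> R}"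
  proof (rule closure_minimal)
    show "?I \<subseteq> {t. cmod (axis_point b s t) \<le> R}" using bd by (auto simp: chord_def)
    show "closed {t. cmod (axis_point b s t) \<le> R}" by (intro closed_Collect_le continuous_intros continuous_on_axis_point)
  qed
  ultimately show ?thesis by auto
qed

lemma nn_integral_boundary_measure:
  assumes [measurable]: "f \<in> borel_measurable borel"
  shows "(\<integral>\<^sup>+ z. f z \<partial>boundary_measure up b \<Omega>) = (\<integral>\<^sup>+ s. indicator (shadow b \<Omega>) s * f (axis_point b s (chord_end up b \<Omega> s)) \<partial>lborel)"
proof -
  have [measurable]: "shadow b \<Omega> \<in> sets borel" using open_shadow by simp
  show ?thesis unfolding boundary_measure_def by (simp add: nn_integral_distr nn_integral_density)
qed

lemma regular_boundary_measure: "regular_measure 1 (boundary_measure up b \<Omega>)"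
  unfolding regular_measure_def
proof (intro conjI allI impI)
  have [measurable]: "shadow b \<Omega> \<in> sets borel" using open_shadow by simp
  show "sigma_finite_measure (boundary_measure up b \<Omega>)"
  proof (intro finite_measure.axioms(1) finite_measureI)
    have "emeasure (boundary_measure up b \<Omega>) (space (boundary_measure up b \<Omega>)) = (\<integral>\<^sup>+ z. 1 \<partial>boundary_measure up b \<Omega>)" by simp
    also have "\<dots> = emeasure lborel (shadow b \<Omega>)" by (subst nn_integral_boundary_measure) auto
    also have "\<dots> \<le> emeasure lborel {-R..R}" using shadow_bound by (intro emeasure_mono) (auto simp: abs_le_iff minus_le_iff)
    also have "\<dots> < \<infinity>" by (rule emeasure_compact_finite) simp
    finally show "emeasure (boundary_measure up b \<Omega>) (space (boundary_measure up b \<Omega>)) \<noteq> \<infinity>" by simp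
  qed
  fix s :: real assume s: "0 < s \<and> s < 1"
  let ?g = "\<lambda>x::real. ennreal (indicator {-1..1} x * \<bar>x\<bar> powr (-s))"
  define D where "D = 2 * emeasure lborel {-R..R} + (\<integral>\<^sup>+ x. ?g x \<partial>lborel)"
  have D: "D < top" using nn_integral_powr_unit_finite[of s] s
    emeasure_compact_finite[of "{-R..R}"]
    unfolding D_def by (simp add: ennreal_mult_less_top)
  have "(\<integral>\<^sup>+ z. ennpow (local_kernel (z - w)) s \<partial>boundary_measure up b \<Omega>) \<le> D" for w
  proof -
    \<comment> \<open>In the coordinates of the chords the kernel is controlled by |x - a| alone, so
      the claim becomes integrability of |x - a|^(-s) near \<open>a\<close> for s < 1; the far part
      is bounded and the shadow lies in [-R, R].\<close>
    obtain a c where w: "w = axis_point b a c" by (cases b; cases w) (auto simp: axis_point_def)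
    have "(\<integral>\<^sup>+ z. ennpow (local_kernel (z - w)) s \<partial>boundary_measure up b \<Omega>) = (\<integral>\<^sup>+ x. indicator (shadow b \<Omega>) x * ennpow (local_kernel (axis_point b x (chord_end up b \<Omega> x) - w)) s \<partial>lborel)"
      by (rule nn_integral_boundary_measure) measurable
    also have "\<dots> \<le> (\<integral>\<^sup>+ x. 2 * indicator {-R..R} x + ?g (-a + 1 * x) \<partial>lborel)"
    proof (rule nn_integral_mono_AE)
      show "AE x in lborel. indicator (shadow b \<Omega>) x * ennpow (local_kernel (axis_point b x (chord_end up b \<Omega> x) - w)) s \<le> 2 * indicator {-R..R} x + ?g (-a + 1 * x)"
        using AE_lborel_singleton[of a]
      proof eventually_elim
        case (elim x)
        let ?v = "axis_point b x (chord_end up b \<Omega> x) - w"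
        have le: "\<bar>x - a\<bar> \<le> cmod ?v"
          using abs_le_cmod_axis_point(1)[of "x - a" b "chord_end up b \<Omega> x - c"] by (cases b) (auto simp: w axis_point_def complex_diff)
        have nz: "?v \<noteq> 0" using le elim by auto
        have "ennpow (local_kernel ?v) s \<le> 1 + ennreal (cmod ?v powr (-s))"
          using ennpow_local_kernel_le[of s ?v] nz s by (simp add: ennpow_cauchy_kernel)
        also have "\<dots> \<le> 1 + ennreal (\<bar>x - a\<bar> powr (-s))"
          using le elim s by (intro add_left_mono ennreal_leI powr_mono2') auto
        also have "\<dots> \<le> 2 + ?g (x - a)"
        proof (cases "\<bar>x - a\<bar> \<le> 1")
          case True
          then show ?thesis by (auto simp: indicator_def abs_le_iff intro!: add_mono)
        next
          case False
          then have "\<bar>x - a\<bar> powr (-s) \<le> \<bar>x - a\<bar> powr 0" using s by (intro powr_mono) auto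
          then have "ennreal (\<bar>x - a\<bar> powr (-s)) \<le> 1" using elim by (simp flip: ennreal_1)
          then have "1 + ennreal (\<bar>x - a\<bar> powr (-s)) \<le> 1 + 1" by (rule add_left_mono)
          then show ?thesis by (simp add: add_increasing2)
        qed
        finally have "ennpow (local_kernel ?v) s \<le> 2 + ?g (x - a)" .
        then show ?case using shadow_bound[of x b] by (auto simp: indicator_def abs_le_iff minus_le_iff)
      qed
    qed
    also have "\<dots> = 2 * emeasure lborel {-R..R} + (\<integral>\<^sup>+ x. ?g (-a + 1 * x) \<partial>lborel)"
      by (subst nn_integral_add) (auto simp: nn_integral_cmult_indicator simp del: mult_1)
    also have "(\<integral>\<^sup>+ x. ?g (-a + 1 * x) \<partial>lborel) = (\<integral>\<^sup>+ x. ?g x \<partial>lborel)"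
      by (subst (2) nn_integral_real_affine[where c=1 and t="-a"]) auto
    finally show ?thesis unfolding D_def .
  qed
  then show "\<exists>C::real. \<forall>w. (\<integral>\<^sup>+ z. ennpow (local_kernel (z - w)) s \<partial>boundary_measure up b \<Omega>) \<le> ennreal C"
    using D by (intro exI[of _ "enn2real D"]) simp
qed (simp add: boundary_measure_def)

section \<open>Pointwise domination of the composition by positive operators\<close>

lemma measurable_domain [measurable]: "\<Omega> \<in> sets borel" using op by simp

lemma sets_area [measurable_cong]: "sets (area \<Omega>) = sets borel"
  and sets_boundary_measure [measurable_cong]: "sets (boundary_measure up b \<Omega>) = sets borel"
  by (simp_all add: area_def boundary_measure_def)

lemma nn_integral_area:
  assumes [measurable]: "f \<in> borel_measurable borel"
  shows "(\<integral>\<^sup>+ z. f z \<partial>area \<Omega>) = (\<integral>\<^sup>+ z. indicator \<Omega> z * f z \<partial>lborel)"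
  unfolding area_def by (subst nn_integral_density) auto

lemma integral_area:
  fixes f :: "complex \<Rightarrow> complex"
  assumes [measurable]: "f \<in> borel_measurable borel"
  shows "(LINT z|area \<Omega>. f z) = (LINT z:\<Omega>|lborel. f z)"
proof -
  have "area \<Omega> = density lborel (\<lambda>z. ennreal (indicator \<Omega> z))" by (simp add: area_def ennreal_indicator)
  then show ?thesis unfolding set_lebesgue_integral_def by (simp add: integral_density)
qed

lemma emeasure_area_finite: "emeasure (area \<Omega>) (space (area \<Omega>)) < top"
proof -
  have "emeasure (area \<Omega>) (space (area \<Omega>)) = emeasure lborel \<Omega>"
    by (simp add: area_def emeasure_density)
  also have "\<dots> \<le> emeasure lborel (cball (0::complex) R)" using bd by (intro emeasure_mono) auto
  also have "\<dots> < \<infinity>" by (rule emeasure_compact_finite) simp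
  finally show ?thesis by simp
qed

lemma finite_area: "finite_measure (area \<Omega>)"
  using emeasure_area_finite by (intro finite_measureI) simp

lemma sigma_finite_area: "sigma_finite_measure (area \<Omega>)"
  using finite_area by (rule finite_measure.axioms(1))

lemma sigma_finite_boundary_measure: "sigma_finite_measure (boundary_measure up b \<Omega>)"
  using regular_boundary_measure by (simp add: regular_measure_def)

text \<open>The chord estimate integrated over \<open>s\<close>: the end-point terms assemble into
  the two boundary measures of direction \<open>b\<close>, the chord integrals into the area
  measure.\<close>

lemma area_phase_integral_bound:
  assumes h: "0 < h" and \<omega>: "1 \<le> h * \<bar>\<omega>\<bar>" and e1: "\<And>s. cmod (e s) = 1"
    and E: "\<And>s t. E (axis_point b s t) = e s * exp (- (\<i> * of_real (\<omega> * t)))" and [measurable]: "E \<in> borel_measurable borel"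
  shows "ennreal (cmod (LINT x|area \<Omega>. E x * (smoothed_recip b h (z - x) * cnj (smoothed_recip b h (x - w)))))
   \<le> 27 * (ennreal h * ((\<integral>\<^sup>+ x. cauchy_kernel (z - x) * cauchy_kernel (x - w) \<partial>boundary_measure False b \<Omega>) + (\<integral>\<^sup>+ x. cauchy_kernel (z - x) * cauchy_kernel (x - w) \<partial>boundary_measure True b \<Omega>)))
     + 27 * (\<integral>\<^sup>+ x. remainder_kernel h (z - x) * cauchy_kernel (x - w) + cauchy_kernel (z - x) * remainder_kernel h (x - w) \<partial>area \<Omega>)"
proof -
  have [measurable]: "shadow b \<Omega> \<in> sets borel" using open_shadow by simp
  let ?f = "\<lambda>x. E x * (smoothed_recip b h (z - x) * cnj (smoothed_recip b h (x - w)))"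
  let ?K = "\<lambda>x. remainder_kernel h (z - x) * cauchy_kernel (x - w) + cauchy_kernel (z - x) * remainder_kernel h (x - w)"
  let ?B = "\<lambda>up s. cauchy_kernel (z - axis_point b s (chord_end up b \<Omega> s)) * cauchy_kernel (axis_point b s (chord_end up b \<Omega> s) - w)"
  \<comment> \<open>This bound degenerates as h tends to 0; it serves only to justify Fubini for
    fixed h.\<close>
  have rgb: "cmod (smoothed_recip b h v) \<le> 3 / h" for v
  proof -
    have "cmod (smoothed_recip b h v) \<le> 3 / smoothed_norm h v"
      using recip_bounds(1)[OF smoothed_norm_bounds(1)[OF h] smoothed_norm_le_transversal_shift[OF h, of v b]] by (simp add: smoothed_recip_def)
    also have "\<dots> \<le> 3 / h" using smoothed_norm_bounds[OF h, of v] h by (intro divide_left_mono) auto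
    finally show ?thesis .
  qed
  have E1: "cmod (E x) = 1" for x
  proof -
    obtain s t where "x = axis_point b s t" by (cases b; cases x) (auto simp: axis_point_def)
    then show ?thesis by (simp add: E norm_mult e1 norm_exp_eq_Re)
  qed
  have int: "integrable lborel (\<lambda>x. indicator \<Omega> x *\<^sub>R ?f x)"
  proof (rule integrableI_bounded_set[of \<Omega> _ _ "(3/h) * (3/h)"])
    show "emeasure lborel \<Omega> < \<infinity>" using emeasure_area_finite by (simp add: area_def emeasure_density)
    show "AE x in lborel. x \<in> \<Omega> \<longrightarrow> norm (indicator \<Omega> x *\<^sub>R ?f x) \<le> (3/h) * (3/h)"
    proof (intro AE_I2 impI)
      fix x
      have "cmod (smoothed_recip b h (z - x)) * cmod (smoothed_recip b h (x - w)) \<le> (3/h) * (3/h)"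
        using h by (intro mult_mono rgb) auto
      then show "norm (indicator \<Omega> x *\<^sub>R ?f x) \<le> (3/h) * (3/h)" using h by (simp add: norm_mult E1 indicator_def)
    qed
    show "(\<lambda>x. indicator \<Omega> x *\<^sub>R ?f x) \<in> borel_measurable lborel" by measurable
  qed (auto simp: indicator_def)
  have slice: "ennreal (norm (LINT t|lborel. indicator \<Omega> (axis_point b s t) *\<^sub>R ?f (axis_point b s t)))
     \<le> 27 * (ennreal h * (indicator (shadow b \<Omega>) s * ?B False s + indicator (shadow b \<Omega>) s * ?B True s)) + 27 * (\<integral>\<^sup>+ t. indicator \<Omega> (axis_point b s t) * ?K (axis_point b s t) \<partial>lborel)" for s
  proof (cases "s \<in> shadow b \<Omega>")
    case False
    then have "axis_point b s t \<notin> \<Omega>" for t by (auto simp: shadow_def chord_def)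
    then show ?thesis by simp
  next
    case True
    let ?\<alpha> = "chord_end False b \<Omega> s" and ?\<beta> = "chord_end True b \<Omega> s"
    note ch = chord_eq[OF True]
    have mem: "axis_point b s t \<in> \<Omega> \<longleftrightarrow> ?\<alpha> < t \<and> t < ?\<beta>" for t using ch(1) by (auto simp: chord_def set_eq_iff)
    \<comment> \<open>The chord is open and the integration by parts uses the closed interval; they
      differ by a null set.\<close>
    have AE: "AE t in lborel. indicator \<Omega> (axis_point b s t) = (indicator {?\<alpha>..?\<beta>} t :: real)"
      using AE_lborel_singleton[of ?\<alpha>] AE_lborel_singleton[of ?\<beta>]
      by eventually_elim (auto simp: indicator_def mem)
    have "(LINT t|lborel. indicator \<Omega> (axis_point b s t) *\<^sub>R ?f (axis_point b s t)) = (LINT t|lborel. e s * (indicator {?\<alpha>..?\<beta>} t *\<^sub>R (exp (- (\<i> * of_real (\<omega> * t))) * (smoothed_recip b h (z - axis_point b s t) * cnj (smoothed_recip b h (axis_point b s t - w))))))"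
    proof (rule integral_cong_AE)
      show "AE t in lborel. indicator \<Omega> (axis_point b s t) *\<^sub>R ?f (axis_point b s t) = e s * (indicator {?\<alpha>..?\<beta>} t *\<^sub>R (exp (- (\<i> * of_real (\<omega> * t))) * (smoothed_recip b h (z - axis_point b s t) * cnj (smoothed_recip b h (axis_point b s t - w)))))"
        using AE by eventually_elim (simp add: E)
    qed measurable
    also have "\<dots> = e s * (LINT t|lborel. indicator {?\<alpha>..?\<beta>} t *\<^sub>R (exp (- (\<i> * of_real (\<omega> * t))) * (smoothed_recip b h (z - axis_point b s t) * cnj (smoothed_recip b h (axis_point b s t - w)))))"
      by (rule integral_mult_right_zero)
    finally have "ennreal (norm (LINT t|lborel. indicator \<Omega> (axis_point b s t) *\<^sub>R ?f (axis_point b s t))) = ennreal (norm (LINT t|lborel. indicator {?\<alpha>..?\<beta>} t *\<^sub>R (exp (- (\<i> * of_real (\<omega> * t))) * (smoothed_recip b h (z - axis_point b s t) * cnj (smoothed_recip b h (axis_point b s t - w))))))"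
      by (simp add: norm_mult e1)
    also have "\<dots> \<le> 27 * (ennreal h * (?B False s + ?B True s)) + 27 * (\<integral>\<^sup>+ t. indicator {?\<alpha>..?\<beta>} t * ?K (axis_point b s t) \<partial>lborel)"
      by (rule chord_integral_bound[OF h \<omega> ch(2)])
    also have "(\<integral>\<^sup>+ t. indicator {?\<alpha>..?\<beta>} t * ?K (axis_point b s t) \<partial>lborel) = (\<integral>\<^sup>+ t. indicator \<Omega> (axis_point b s t) * ?K (axis_point b s t) \<partial>lborel)"
    proof (rule nn_integral_cong_AE)
      show "AE t in lborel. indicator {?\<alpha>..?\<beta>} t * ?K (axis_point b s t) = indicator \<Omega> (axis_point b s t) * ?K (axis_point b s t)"
        using AE by eventually_elim (auto simp: indicator_def split: if_splits)
    qed
    finally show ?thesis using True by simp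
  qed
  have "(LINT x|area \<Omega>. ?f x) = (LINT x|lborel. indicator \<Omega> x *\<^sub>R ?f x)"
    by (subst integral_area) (auto simp: set_lebesgue_integral_def)
  also have "\<dots> = (LINT s|lborel. LINT t|lborel. indicator \<Omega> (axis_point b s t) *\<^sub>R ?f (axis_point b s t))"
    by (rule integral_axis_point[OF int])
  finally have "ennreal (cmod (LINT x|area \<Omega>. ?f x)) \<le> (\<integral>\<^sup>+ s. ennreal (norm (LINT t|lborel. indicator \<Omega> (axis_point b s t) *\<^sub>R ?f (axis_point b s t))) \<partial>lborel)"
    by (simp only: norm_integral_le_nn_integral)
  also have "\<dots> \<le> (\<integral>\<^sup>+ s. 27 * (ennreal h * (indicator (shadow b \<Omega>) s * ?B False s + indicator (shadow b \<Omega>) s * ?B True s)) + 27 * (\<integral>\<^sup>+ t. indicator \<Omega> (axis_point b s t) * ?K (axis_point b s t) \<partial>lborel) \<partial>lborel)"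
    by (intro nn_integral_mono slice)
  also have "\<dots> = 27 * (ennreal h * ((\<integral>\<^sup>+ s. indicator (shadow b \<Omega>) s * ?B False s \<partial>lborel) + (\<integral>\<^sup>+ s. indicator (shadow b \<Omega>) s * ?B True s \<partial>lborel)))
      + 27 * (\<integral>\<^sup>+ s. \<integral>\<^sup>+ t. indicator \<Omega> (axis_point b s t) * ?K (axis_point b s t) \<partial>lborel \<partial>lborel)"
    by (simp add: nn_integral_add nn_integral_cmult)
  also have "(\<integral>\<^sup>+ s. \<integral>\<^sup>+ t. indicator \<Omega> (axis_point b s t) * ?K (axis_point b s t) \<partial>lborel \<partial>lborel) = (\<integral>\<^sup>+ x. ?K x \<partial>area \<Omega>)"
    by (subst nn_integral_area, measurable, subst nn_integral_axis_point[where b=b]) auto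
  finally have *: "ennreal (cmod (LINT x|area \<Omega>. ?f x)) \<le> 27 * (ennreal h * ((\<integral>\<^sup>+ s. indicator (shadow b \<Omega>) s * ?B False s \<partial>lborel) + (\<integral>\<^sup>+ s. indicator (shadow b \<Omega>) s * ?B True s \<partial>lborel)))
      + 27 * (\<integral>\<^sup>+ x. ?K x \<partial>area \<Omega>)" .
  have "(\<integral>\<^sup>+ x. cauchy_kernel (z - x) * cauchy_kernel (x - w) \<partial>boundary_measure up b \<Omega>) = (\<integral>\<^sup>+ s. indicator (shadow b \<Omega>) s * ?B up s \<partial>lborel)" for up
    by (subst nn_integral_boundary_measure) auto
  with * show ?thesis by simp
qed

text \<open>Tonelli turns a kernel that is itself an integral over the intermediate point into a
  composition of two operators, which can be estimated one after the other.\<close>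

lemma nn_integral_kernel_op_swap:
  assumes [measurable]: "K1 \<in> borel_measurable borel" "K2 \<in> borel_measurable borel" "v \<in> borel_measurable borel"
    and s: "sets \<nu> = sets borel" "sigma_finite_measure \<nu>"
  shows "(\<integral>\<^sup>+ w. v w * (\<integral>\<^sup>+ x. K1 (z - x) * K2 (x - w) \<partial>\<nu>) \<partial>area \<Omega>) = kernel_op K1 \<nu> (kernel_op K2 (area \<Omega>) v) z"
proof -
  interpret A: sigma_finite_measure "area \<Omega>" by (rule sigma_finite_area)
  interpret N: sigma_finite_measure \<nu> by fact
  interpret P: pair_sigma_finite "area \<Omega>" \<nu> ..
  note [measurable_cong] = s(1)
  have "(\<integral>\<^sup>+ w. v w * (\<integral>\<^sup>+ x. K1 (z - x) * K2 (x - w) \<partial>\<nu>) \<partial>area \<Omega>) = (\<integral>\<^sup>+ w. \<integral>\<^sup>+ x. v w * (K1 (z - x) * K2 (x - w)) \<partial>\<nu> \<partial>area \<Omega>)"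
    by (intro nn_integral_cong nn_integral_cmult[symmetric]) measurable
  also have "\<dots> = (\<integral>\<^sup>+ x. \<integral>\<^sup>+ w. v w * (K1 (z - x) * K2 (x - w)) \<partial>area \<Omega> \<partial>\<nu>)"
    by (rule P.Fubini'[symmetric]) measurable
  also have "\<dots> = (\<integral>\<^sup>+ x. K1 (z - x) * (\<integral>\<^sup>+ w. K2 (x - w) * v w \<partial>area \<Omega>) \<partial>\<nu>)"
    by (subst nn_integral_cmult[symmetric]) (auto simp: mult_ac)
  finally show ?thesis by (simp add: kernel_op_def)
qed

lemma kernel_op_area_mult:
  assumes [measurable]: "K1 \<in> borel_measurable borel" "K2 \<in> borel_measurable borel" "v \<in> borel_measurable borel"
  shows "(\<integral>\<^sup>+ x. \<integral>\<^sup>+ w. c * (K1 (z - x) * K2 (x - w) * v w) \<partial>area \<Omega> \<partial>area \<Omega>) = c * kernel_op K1 (area \<Omega>) (kernel_op K2 (area \<Omega>) v) z"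
proof -
  interpret A: sigma_finite_measure "area \<Omega>" by (rule sigma_finite_area)
  show ?thesis unfolding kernel_op_def
    by (simp add: nn_integral_cmult mult.assoc)
qed

lemma integrable_double_kernel:
  fixes X :: "complex \<Rightarrow> complex \<Rightarrow> complex"
  assumes [measurable]: "case_prod X \<in> borel_measurable (borel \<Otimes>\<^sub>M borel)" 
    and m[measurable]: "K1 \<in> borel_measurable borel" "K2 \<in> borel_measurable borel" "v \<in> borel_measurable borel"
    and le: "\<And>x w. ennreal (cmod (X x w)) \<le> c * (K1 (z - x) * K2 (x - w) * v w)"
    and fin: "c * kernel_op K1 (area \<Omega>) (kernel_op K2 (area \<Omega>) v) z < top"
  shows "integrable (area \<Omega> \<Otimes>\<^sub>M area \<Omega>) (case_prod X)"
    and "ennreal (cmod (LINT p|(area \<Omega> \<Otimes>\<^sub>M area \<Omega>). case_prod X p)) \<le> c * kernel_op K1 (area \<Omega>) (kernel_op K2 (area \<Omega>) v) z"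
proof -
  interpret A: sigma_finite_measure "area \<Omega>" by (rule sigma_finite_area)
  have "(\<integral>\<^sup>+ p. ennreal (norm (case_prod X p)) \<partial>(area \<Omega> \<Otimes>\<^sub>M area \<Omega>)) = (\<integral>\<^sup>+ x. \<integral>\<^sup>+ w. ennreal (norm (X x w)) \<partial>area \<Omega> \<partial>area \<Omega>)"
    by (subst A.nn_integral_fst[symmetric]) auto
  also have "\<dots> \<le> (\<integral>\<^sup>+ x. \<integral>\<^sup>+ w. c * (K1 (z - x) * K2 (x - w) * v w) \<partial>area \<Omega> \<partial>area \<Omega>)"
    by (intro nn_integral_mono le)
  finally have *: "(\<integral>\<^sup>+ p. ennreal (norm (case_prod X p)) \<partial>(area \<Omega> \<Otimes>\<^sub>M area \<Omega>)) \<le> c * kernel_op K1 (area \<Omega>) (kernel_op K2 (area \<Omega>) v) z"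
    by (simp only: kernel_op_area_mult[OF m])
  show "ennreal (cmod (LINT p|(area \<Omega> \<Otimes>\<^sub>M area \<Omega>). case_prod X p)) \<le> c * kernel_op K1 (area \<Omega>) (kernel_op K2 (area \<Omega>) v) z"
    by (rule order_trans[OF norm_integral_le_nn_integral *])
  show "integrable (area \<Omega> \<Otimes>\<^sub>M area \<Omega>) (case_prod X)"
    using * fin by (intro integrableI_bounded) auto
qed

text \<open>Only the piece with both factors smoothed needs the oscillation; the pieces containing
  an error factor are bounded by absolute values. The remainder-Cauchy composition receives 27 + 6 =
  33, its mirror image 27 + 2 and the boundary terms 27, so 33 dominates. The assumption
  \<open>fin\<close> makes all double integrals absolutely convergent at this
  \<open>z\<close>.\<close>

lemma opA_opB_pointwise:
  assumes h: "0 < h" "1 \<le> h * cmod k" and \<sigma>: "\<bar>\<sigma>\<bar> = 1" and u[measurable]: "u \<in> borel_measurable borel"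
    and fin: "kernel_op cauchy_kernel (area \<Omega>) (kernel_op cauchy_kernel (area \<Omega>) (\<lambda>w. ennreal (cmod (u w)))) z < top"
  shows "ennreal (cmod (opA \<Omega> k (opB \<Omega> \<sigma> k u) z)) \<le> 33 *
    (kernel_op (remainder_kernel h) (area \<Omega>) (kernel_op cauchy_kernel (area \<Omega>) (\<lambda>w. ennreal (cmod (u w)))) z
     + kernel_op cauchy_kernel (area \<Omega>) (kernel_op (remainder_kernel h) (area \<Omega>) (\<lambda>w. ennreal (cmod (u w)))) z
     + ennreal h * (\<Sum>(up, b)\<in>UNIV. kernel_op cauchy_kernel (boundary_measure up b \<Omega>) (kernel_op cauchy_kernel (area \<Omega>) (\<lambda>w. ennreal (cmod (u w)))) z))"
proof -
  interpret A: sigma_finite_measure "area \<Omega>" by (rule sigma_finite_area)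
  interpret AA: pair_sigma_finite "area \<Omega>" "area \<Omega>" ..
  define U where "U w = ennreal (cmod (u w))" for w
  have [measurable]: "U \<in> borel_measurable borel" unfolding U_def[abs_def] by measurable
  define E E' where "E w = exp (- (k * w) + cnj (k * w))" and "E' w = exp (k * w - cnj (k * w))" for w
  have [measurable]: "E \<in> borel_measurable borel" "E' \<in> borel_measurable borel"
    unfolding E_def[abs_def] E'_def[abs_def] by (intro borel_measurable_continuous_onI continuous_intros)+
  have E1: "cmod (E w) = 1" "cmod (E' w) = 1" for w by (simp_all add: E_def E'_def)
  obtain b \<omega> e where ph: "cmod k \<le> \<bar>\<omega>\<bar>" "\<And>s. cmod (e s) = 1"
    "\<And>s t. exp (- (k * axis_point b s t) + cnj (k * axis_point b s t)) = e s * exp (- (\<i> * of_real (\<omega> * t)))" by (rule phase_split[of k]) (rule that)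
  have \<omega>: "1 \<le> h * \<bar>\<omega>\<bar>" using h ph(1) mult_left_mono[of "cmod k" "\<bar>\<omega>\<bar>" h] by linarith
  have Eph: "E (axis_point b s t) = e s * exp (- (\<i> * of_real (\<omega> * t)))" for s t unfolding E_def by (rule ph(3))
  define a where "a x w = E x * (E' w * u w)" for x w
  have na: "cmod (a x w * c * d) = cmod c * cmod d * cmod (u w)" for x w c d by (simp add: a_def norm_mult E1)
  define X where "X x w = a x w * (1 / (z - x)) * cnj (1 / (x - w))" for x w
  define X1 where "X1 x w = a x w * smoothed_recip b h (z - x) * cnj (smoothed_recip b h (x - w))" for x w
  define X2 where "X2 x w = a x w * (1 / (z - x) - smoothed_recip b h (z - x)) * cnj (smoothed_recip b h (x - w))" for x w
  define X3 where "X3 x w = a x w * (1 / (z - x)) * cnj (1 / (x - w) - smoothed_recip b h (x - w))" for x w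
  \<comment> \<open>Telescoping: the first Cauchy factor is replaced by its smoothed version while
    the second is already smoothed, and the second while the first is still exact.\<close>
  have Xeq: "X x w = X1 x w + X2 x w + X3 x w" for x w
    by (simp add: X_def X1_def X2_def X3_def algebra_simps)
  have [measurable]: "case_prod X1 \<in> borel_measurable (borel \<Otimes>\<^sub>M borel)" "case_prod X2 \<in> borel_measurable (borel \<Otimes>\<^sub>M borel)"
     "case_prod X3 \<in> borel_measurable (borel \<Otimes>\<^sub>M borel)" "case_prod X \<in> borel_measurable (borel \<Otimes>\<^sub>M borel)"
    unfolding X_def[abs_def] X1_def[abs_def] X2_def[abs_def] X3_def[abs_def] a_def split_beta' by measurable
  have N1: "ennreal (cmod (1 / v)) \<le> cauchy_kernel v" for v
    by (cases "v = 0") (auto simp: cauchy_kernel_eq norm_divide)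
  have prod: "ennreal (cmod c * cmod d * cmod (u w)) \<le> m * (A * B * U w)"
    if "ennreal (cmod c) \<le> m1 * A" "ennreal (cmod d) \<le> m2 * B" "m1 * m2 = m" for c d A B m1 m2 m w
  proof -
    have "ennreal (cmod c * cmod d * cmod (u w)) = ennreal (cmod c) * ennreal (cmod d) * U w"
      by (simp add: ennreal_mult U_def)
    also have "\<dots> \<le> (m1 * A) * (m2 * B) * U w" by (intro mult_mono that order_refl) auto
    also have "\<dots> = m * (A * B * U w)" unfolding that(3)[symmetric] by (simp add: mult_ac)
    finally show ?thesis .
  qed
  have b1: "ennreal (cmod (X1 x w)) \<le> 9 * (cauchy_kernel (z - x) * cauchy_kernel (x - w) * U w)" for x w
    unfolding X1_def na by (rule prod[where ?m1.0=3 and ?m2.0=3]) (auto simp: smoothed_recip_le_cauchy_kernel[OF h(1)])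
  have b2: "ennreal (cmod (X2 x w)) \<le> 6 * (remainder_kernel h (z - x) * cauchy_kernel (x - w) * U w)" for x w
    unfolding X2_def na by (rule prod[where ?m1.0=2 and ?m2.0=3]) (auto simp: smoothed_recip_le_cauchy_kernel[OF h(1)] inverse_minus_smoothed_recip_le_remainder_kernel[OF h(1)])
  have b3: "ennreal (cmod (X3 x w)) \<le> 2 * (cauchy_kernel (z - x) * remainder_kernel h (x - w) * U w)" for x w
    unfolding X3_def na by (rule prod[where ?m1.0=1 and ?m2.0=2]) (use N1[of "z - x"] inverse_minus_smoothed_recip_le_remainder_kernel[OF h(1), of "x - w" b] in \<open>auto simp del: complex_cnj_diff\<close>)
  have fU: "kernel_op cauchy_kernel (area \<Omega>) (kernel_op cauchy_kernel (area \<Omega>) U) z < top" using fin by (simp add: U_def[abs_def])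
  \<comment> \<open>The remainder kernel lies below the Cauchy kernel, so the one finiteness
    assumption serves all pieces.\<close>
  have f2: "kernel_op (remainder_kernel h) (area \<Omega>) (kernel_op cauchy_kernel (area \<Omega>) U) z < top"
    by (rule le_less_trans[OF _ fU]) (auto simp: kernel_op_def intro!: nn_integral_mono mult_right_mono remainder_kernel_le_cauchy_kernel)
  have f3: "kernel_op cauchy_kernel (area \<Omega>) (kernel_op (remainder_kernel h) (area \<Omega>) U) z < top"
    by (rule le_less_trans[OF _ fU]) (auto simp: kernel_op_def intro!: nn_integral_mono mult_right_mono mult_left_mono remainder_kernel_le_cauchy_kernel)
  have mk: "cauchy_kernel \<in> borel_measurable borel" "remainder_kernel h \<in> borel_measurable borel" "U \<in> borel_measurable borel" by measurable
  have i1: "integrable (area \<Omega> \<Otimes>\<^sub>M area \<Omega>) (case_prod X1)"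
    by (rule integrable_double_kernel(1)[OF _ mk(1,1,3) b1]) (auto simp: ennreal_mult_less_top fU)
  have i2: "integrable (area \<Omega> \<Otimes>\<^sub>M area \<Omega>) (case_prod X2)"
    and n2: "ennreal (cmod (LINT p|(area \<Omega> \<Otimes>\<^sub>M area \<Omega>). case_prod X2 p)) \<le> 6 * kernel_op (remainder_kernel h) (area \<Omega>) (kernel_op cauchy_kernel (area \<Omega>) U) z"
    by (rule integrable_double_kernel[OF _ mk(2,1,3) b2]; simp add: ennreal_mult_less_top f2)+
  have i3: "integrable (area \<Omega> \<Otimes>\<^sub>M area \<Omega>) (case_prod X3)"
    and n3: "ennreal (cmod (LINT p|(area \<Omega> \<Otimes>\<^sub>M area \<Omega>). case_prod X3 p)) \<le> 2 * kernel_op cauchy_kernel (area \<Omega>) (kernel_op (remainder_kernel h) (area \<Omega>) U) z"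
    by (rule integrable_double_kernel[OF _ mk(1,2,3) b3]; simp add: ennreal_mult_less_top f3)+
  let ?J = "\<lambda>Y. LINT p|(area \<Omega> \<Otimes>\<^sub>M area \<Omega>). case_prod Y p"
  have Xsum: "case_prod X = (\<lambda>p. case_prod X1 p + case_prod X2 p + case_prod X3 p)" by (auto simp: Xeq)
  have iX: "integrable (area \<Omega> \<Otimes>\<^sub>M area \<Omega>) (case_prod X)" unfolding Xsum using i1 i2 i3 by simp
  have JX: "?J X = ?J X1 + ?J X2 + ?J X3" unfolding Xsum using i1 i2 i3 by simp
  have AB: "opA \<Omega> k (opB \<Omega> \<sigma> k u) z = of_real (\<sigma> / (2 * pi) * (1 / (2 * pi))) * ?J X"
  proof -
    have inner: "opB \<Omega> \<sigma> k u x = of_real (\<sigma> / (2 * pi)) * (LINT w|area \<Omega>. E' w * u w * cnj (1 / (x - w)))" for x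
      unfolding opB_def by (subst integral_area) (auto simp: E'_def scaleR_conv_of_real set_lebesgue_integral_def)
    have "opA \<Omega> k (opB \<Omega> \<sigma> k u) z = of_real (1 / (2 * pi)) * (LINT x|area \<Omega>. E x / (z - x) * opB \<Omega> \<sigma> k u x)"
      unfolding opA_def by (subst integral_area) (auto simp: inner E_def scaleR_conv_of_real set_lebesgue_integral_def)
    also have "(LINT x|area \<Omega>. E x / (z - x) * opB \<Omega> \<sigma> k u x) = (LINT x|area \<Omega>. of_real (\<sigma> / (2 * pi)) * (LINT w|area \<Omega>. X x w))"
    proof (rule Bochner_Integration.integral_cong[OF refl])
      fix x
      \<comment> \<open>Pulling the constant out of the Bochner integral is valid for every
        \<open>x\<close>, including those where the inner integral diverges and has value 0.\<close>
      have "(LINT w|area \<Omega>. X x w) = (LINT w|area \<Omega>. E x / (z - x) * (E' w * u w * cnj (1 / (x - w))))"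
        by (rule Bochner_Integration.integral_cong) (auto simp: X_def a_def)
      also have "\<dots> = E x / (z - x) * (LINT w|area \<Omega>. E' w * u w * cnj (1 / (x - w)))" by (rule integral_mult_right_zero)
      finally show "E x / (z - x) * opB \<Omega> \<sigma> k u x = of_real (\<sigma> / (2 * pi)) * (LINT w|area \<Omega>. X x w)" by (simp add: inner mult_ac)
    qed
    also have "\<dots> = of_real (\<sigma> / (2 * pi)) * (LINT x|area \<Omega>. LINT w|area \<Omega>. X x w)" by (rule integral_mult_right_zero)
    also have "(LINT x|area \<Omega>. LINT w|area \<Omega>. X x w) = ?J X" using AA.integral_fst'[OF iX] by simp
    finally show ?thesis by (simp add: mult_ac)
  qed
  have c1: "\<bar>\<sigma> / (2 * pi) * (1 / (2 * pi))\<bar> \<le> 1"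
  proof -
    have "1 \<le> 2 * pi" using pi_gt3 by linarith
    then have "1 / (2 * pi) \<le> 1" "0 \<le> 1 / (2 * pi)" by auto
    then have "1 / (2 * pi) * (1 / (2 * pi)) \<le> 1 * 1" by (intro mult_mono) auto
    then show ?thesis using \<sigma> by (simp add: abs_mult)
  qed
  let ?N = "\<lambda>up b. kernel_op cauchy_kernel (boundary_measure up b \<Omega>) (kernel_op cauchy_kernel (area \<Omega>) U) z"
  have n1: "ennreal (cmod (?J X1)) \<le> 27 * (ennreal h * (?N False b + ?N True b)) + 27 * (kernel_op (remainder_kernel h) (area \<Omega>) (kernel_op cauchy_kernel (area \<Omega>) U) z + kernel_op cauchy_kernel (area \<Omega>) (kernel_op (remainder_kernel h) (area \<Omega>) U) z)"
  proof -
    let ?I = "\<lambda>w. LINT x|area \<Omega>. E x * (smoothed_recip b h (z - x) * cnj (smoothed_recip b h (x - w)))"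
    \<comment> \<open>The order is reversed compared with \<open>opA\<close> after
      \<open>opB\<close>: the intermediate point \<open>x\<close>, which carries the phase of
      \<open>A\<close>, must be integrated first for the oscillation to act.\<close>
    have "?J X1 = (LINT w|area \<Omega>. LINT x|area \<Omega>. X1 x w)"
      using AA.integral_snd[OF i1] by simp
    also have "\<dots> = (LINT w|area \<Omega>. (E' w * u w) * ?I w)"
    proof (rule Bochner_Integration.integral_cong[OF refl])
      fix w
      have "(LINT x|area \<Omega>. X1 x w) = (LINT x|area \<Omega>. (E' w * u w) * (E x * (smoothed_recip b h (z - x) * cnj (smoothed_recip b h (x - w)))))"
        by (rule Bochner_Integration.integral_cong) (auto simp: X1_def a_def)
      then show "(LINT x|area \<Omega>. X1 x w) = (E' w * u w) * ?I w" by simp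
    qed
    finally have "ennreal (cmod (?J X1)) \<le> (\<integral>\<^sup>+ w. ennreal (cmod ((E' w * u w) * ?I w)) \<partial>area \<Omega>)"
      by (simp only: norm_integral_le_nn_integral)
    also have "\<dots> = (\<integral>\<^sup>+ w. U w * ennreal (cmod (?I w)) \<partial>area \<Omega>)"
      by (simp add: norm_mult E1 ennreal_mult U_def)
    also have "\<dots> \<le> (\<integral>\<^sup>+ w. U w * (27 * (ennreal h * ((\<integral>\<^sup>+ x. cauchy_kernel (z - x) * cauchy_kernel (x - w) \<partial>boundary_measure False b \<Omega>) + (\<integral>\<^sup>+ x. cauchy_kernel (z - x) * cauchy_kernel (x - w) \<partial>boundary_measure True b \<Omega>)))
     + 27 * (\<integral>\<^sup>+ x. remainder_kernel h (z - x) * cauchy_kernel (x - w) + cauchy_kernel (z - x) * remainder_kernel h (x - w) \<partial>area \<Omega>)) \<partial>area \<Omega>)"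
      by (intro nn_integral_mono mult_left_mono area_phase_integral_bound[OF h(1) \<omega> ph(2) Eph]) auto
    also have "\<dots> = (\<integral>\<^sup>+ w. 27 * (ennreal h * (U w * (\<integral>\<^sup>+ x. cauchy_kernel (z - x) * cauchy_kernel (x - w) \<partial>boundary_measure False b \<Omega>) + U w * (\<integral>\<^sup>+ x. cauchy_kernel (z - x) * cauchy_kernel (x - w) \<partial>boundary_measure True b \<Omega>)))
     + 27 * (U w * (\<integral>\<^sup>+ x. remainder_kernel h (z - x) * cauchy_kernel (x - w) \<partial>area \<Omega>) + U w * (\<integral>\<^sup>+ x. cauchy_kernel (z - x) * remainder_kernel h (x - w) \<partial>area \<Omega>)) \<partial>area \<Omega>)"
      by (intro nn_integral_cong) (simp add: nn_integral_add distrib_left mult_ac)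
    also have "\<dots> = 27 * (ennreal h * (?N False b + ?N True b)) + 27 * (kernel_op (remainder_kernel h) (area \<Omega>) (kernel_op cauchy_kernel (area \<Omega>) U) z + kernel_op cauchy_kernel (area \<Omega>) (kernel_op (remainder_kernel h) (area \<Omega>) U) z)"
    proof -
      interpret B: sigma_finite_measure "boundary_measure up b \<Omega>" for up by (rule sigma_finite_boundary_measure)
      note sw = nn_integral_kernel_op_swap[OF mk(1,1,3) sets_boundary_measure sigma_finite_boundary_measure]
        nn_integral_kernel_op_swap[OF mk(2,1,3) sets_area sigma_finite_area]
        nn_integral_kernel_op_swap[OF mk(1,2,3) sets_area sigma_finite_area]
      show ?thesis by (simp add: nn_integral_add nn_integral_cmult sw)
    qed
    finally show ?thesis .
  qed
  have sumUNIV: "(\<Sum>(up, b)\<in>UNIV. ?N up b) = ?N True True + ?N True False + ?N False True + ?N False False"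
  proof -
    have univ: "(UNIV :: (bool \<times> bool) set) = {(True, True), (True, False), (False, True), (False, False)}" by auto
    show ?thesis unfolding univ by (simp add: add.assoc)
  qed
  \<comment> \<open>The direction \<open>b\<close> depends on \<open>k\<close>; summing over both
    directions gives a bound that sees \<open>k\<close> only through h.\<close>
  have Nle: "?N False b + ?N True b \<le> (\<Sum>(up, b)\<in>UNIV. ?N up b)"
    unfolding sumUNIV by (cases b) (simp_all add: add_ac add_increasing add_increasing2)
  define r1 r2 r3 where "r1 = kernel_op (remainder_kernel h) (area \<Omega>) (kernel_op cauchy_kernel (area \<Omega>) U) z" and "r2 = kernel_op cauchy_kernel (area \<Omega>) (kernel_op (remainder_kernel h) (area \<Omega>) U) z"
    and "r3 = ennreal h * (\<Sum>(up, b)\<in>UNIV. ?N up b)"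
  have "cmod (opA \<Omega> k (opB \<Omega> \<sigma> k u) z) \<le> 1 * cmod (?J X)"
    unfolding AB norm_mult norm_of_real using c1 by (intro mult_right_mono) auto
  also have "\<dots> \<le> cmod (?J X1) + cmod (?J X2) + cmod (?J X3)"
    unfolding JX by (simp add: norm_triangle_le)
  finally have "ennreal (cmod (opA \<Omega> k (opB \<Omega> \<sigma> k u) z)) \<le> ennreal (cmod (?J X1)) + ennreal (cmod (?J X2)) + ennreal (cmod (?J X3))"
    by (simp add: ennreal_leI flip: ennreal_plus)
  also have "\<dots> \<le> (27 * r3 + 27 * (r1 + r2)) + 6 * r1 + 2 * r2"
  proof (intro add_mono n2[folded r1_def] n3[folded r2_def])
    show "ennreal (cmod (?J X1)) \<le> 27 * r3 + 27 * (r1 + r2)"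
      using n1 unfolding r1_def[symmetric] r2_def[symmetric]
      by (rule order_trans) (auto simp: r3_def intro!: add_right_mono mult_left_mono Nle)
  qed
  also have "\<dots> = 33 * r1 + 29 * r2 + 27 * r3"
  proof -
    have "33 * r1 = 27 * r1 + 6 * r1" "29 * r2 = 27 * r2 + 2 * r2" by (simp_all flip: distrib_right)
    then show ?thesis by (simp add: distrib_left add_ac)
  qed
  also have "\<dots> \<le> 33 * r1 + 33 * r2 + 33 * r3"
    by (intro add_mono mult_right_mono) auto
  also have "\<dots> = 33 * (r1 + r2 + r3)" by (simp add: distrib_left)
  finally show ?thesis unfolding r1_def r2_def r3_def U_def[abs_def] .
qed

end

section \<open>Weighted operator bounds\<close>

text \<open>A full power of \<open>jbr z\<close> is gained: with d = |z - w| one has jbr z <= 1 + R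
  + d, so jbr z / d <= (1 + R)/d + 1 <= (2 + R) max 1 (1/d). At z = w the right side is
  \<open>top\<close>, its coefficient being positive.\<close>

lemma weighted_kernel_le:
  assumes "cmod w \<le> R"
  shows "ennreal (jbr z powr (-\<epsilon>)) * cauchy_kernel (z - w) \<le> ennreal ((2 + R) * jbr z powr (-(1 + \<epsilon>))) * local_kernel (z - w)"
proof -
  have R: "0 \<le> R" using assms norm_ge_zero order_trans by blast
  have pos: "0 < (2 + R) * jbr z powr (-(1 + \<epsilon>))" using R jbr_pos[of z] by simp
  show ?thesis
  proof (cases "z = w")
    case True
    have "local_kernel 0 = top" by (simp add: local_kernel_def max_def top_unique)
    moreover have "ennreal ((2 + R) * jbr z powr (-(1 + \<epsilon>))) \<noteq> 0" using pos by (simp only: ennreal_eq_0_iff not_le)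
    ultimately show ?thesis using True by (simp add: ennreal_mult_top)
  next
    case False
    let ?d = "cmod (z - w)"
    have d: "0 < ?d" using False by simp
    have "jbr z \<le> 1 + R + ?d" using jbr_le[of z] norm_triangle_ineq2[of z w] assms by linarith
    then have "jbr z * (1 / ?d) \<le> (1 + R) * (1 / ?d) + 1" using d by (simp add: field_simps)
    also have "\<dots> \<le> (1 + R) * max 1 (1 / ?d) + max 1 (1 / ?d)" using R by (intro add_mono mult_left_mono) auto
    also have "\<dots> = (2 + R) * max 1 (1 / ?d)" by (simp add: algebra_simps)
    finally have *: "jbr z * (1 / ?d) \<le> (2 + R) * max 1 (1 / ?d)" .
    have e: "jbr z powr (-\<epsilon>) = jbr z powr (-(1 + \<epsilon>)) * jbr z"
      using jbr_pos[of z] powr_add[of "jbr z" "-(1 + \<epsilon>)" 1] by simp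
    have "jbr z powr (-\<epsilon>) * (1 / ?d) = jbr z powr (-(1 + \<epsilon>)) * (jbr z * (1 / ?d))" by (simp add: e)
    also have "\<dots> \<le> jbr z powr (-(1 + \<epsilon>)) * ((2 + R) * max 1 (1 / ?d))" by (intro mult_left_mono *) simp
    finally have "ennreal (jbr z powr (-\<epsilon>) * (1 / ?d)) \<le> ennreal ((2 + R) * jbr z powr (-(1 + \<epsilon>)) * max 1 (1 / ?d))"
      by (intro ennreal_leI) (simp add: mult_ac)
    moreover have "local_kernel (z - w) = ennreal (max 1 (1 / ?d))"
      using False by (simp add: local_kernel_def cauchy_kernel_eq max_def flip: ennreal_1)
    moreover have "ennreal (jbr z powr (-\<epsilon>)) * cauchy_kernel (z - w) = ennreal (jbr z powr (-\<epsilon>) * (1 / ?d))"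
      using False by (simp add: cauchy_kernel_eq flip: ennreal_mult)
    moreover have "ennreal ((2 + R) * jbr z powr (-(1 + \<epsilon>)) * max 1 (1 / ?d)) = ennreal ((2 + R) * jbr z powr (-(1 + \<epsilon>))) * ennreal (max 1 (1 / ?d))"
      using pos by (intro ennreal_mult) auto
    ultimately show ?thesis by (simp only:)
  qed
qed

text \<open>The gained weight, raised to the power q, becomes the density of a measure on the plane,
  and the Schur bound from dimension 1 to dimension 2 applies to it. The condition 2 < q (1 +
  \<epsilon>) gives this density finite mass.\<close>

lemma weighted_bound_from_regular:
  assumes q: "1 < q" and \<epsilon>: "0 \<le> \<epsilon>" "2 < q * (1 + \<epsilon>)" and \<nu>: "regular_measure 1 \<nu>" and ae: "AE x in \<nu>. cmod x \<le> R" and R: "0 \<le> R"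
  shows "\<exists>C::real. 0 \<le> C \<and> (\<forall>g\<in>borel_measurable borel.
    (\<integral>\<^sup>+ z. ennpow (ennreal (jbr z powr (-\<epsilon>)) * kernel_op cauchy_kernel \<nu> g z) q \<partial>lborel) \<le> ennreal C * (\<integral>\<^sup>+ w. ennpow (g w) q \<partial>\<nu>))"
proof -
  have [measurable_cong]: "sets \<nu> = sets borel" and sf: "sigma_finite_measure \<nu>" using \<nu> by (auto simp: regular_measure_def)
  let ?V = "\<lambda>z. jbr z powr (-(q * (1 + \<epsilon>)))"
  have "regular_measure 2 (density lborel (\<lambda>z. ennreal (?V z)))"
  proof (rule regular_measure_density)
    show "?V z \<le> 1" for z
      using powr_mono2'[of "-(q * (1 + \<epsilon>))" 1 "jbr z"] jbr_ge_1[of z] \<epsilon> by simp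
    show "(\<integral>\<^sup>+ z. ennreal (?V z) \<partial>lborel) < top" by (rule nn_integral_jbr_powr_finite[OF \<epsilon>(2)])
  qed auto
  from kernel_from_regular1[OF q this \<nu>] obtain C where C: "\<And>g. g \<in> borel_measurable borel \<Longrightarrow>
    (\<integral>\<^sup>+ z. ennpow (\<integral>\<^sup>+ w. local_kernel (z - w) * g w \<partial>\<nu>) q \<partial>density lborel (\<lambda>z. ennreal (?V z))) \<le> ennreal C * (\<integral>\<^sup>+ w. ennpow (g w) q \<partial>\<nu>)"
    by blast
  define c where "c = (2 + R) powr q"
  show ?thesis
  proof (intro exI[of _ "c * max 0 C"] conjI ballI)
    fix g :: "complex \<Rightarrow> ennreal" assume g[measurable]: "g \<in> borel_measurable borel"
    have [measurable]: "kernel_op local_kernel \<nu> g \<in> borel_measurable borel" by (rule measurable_kernel_op) (auto simp: sf \<nu>[unfolded regular_measure_def])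
    have "(\<integral>\<^sup>+ z. ennpow (ennreal (jbr z powr (-\<epsilon>)) * kernel_op cauchy_kernel \<nu> g z) q \<partial>lborel) \<le> (\<integral>\<^sup>+ z. ennreal c * (ennreal (?V z) * ennpow (kernel_op local_kernel \<nu> g z) q) \<partial>lborel)"
    proof (rule nn_integral_mono)
      fix z
      have "ennreal (jbr z powr (-\<epsilon>)) * kernel_op cauchy_kernel \<nu> g z = (\<integral>\<^sup>+ w. ennreal (jbr z powr (-\<epsilon>)) * cauchy_kernel (z - w) * g w \<partial>\<nu>)"
        unfolding kernel_op_def by (subst nn_integral_cmult[symmetric]) (auto simp: mult.assoc)
      also have "\<dots> \<le> (\<integral>\<^sup>+ w. ennreal ((2 + R) * jbr z powr (-(1 + \<epsilon>))) * local_kernel (z - w) * g w \<partial>\<nu>)"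
      proof (rule nn_integral_mono_AE)
        show "AE w in \<nu>. ennreal (jbr z powr (-\<epsilon>)) * cauchy_kernel (z - w) * g w \<le> ennreal ((2 + R) * jbr z powr (-(1 + \<epsilon>))) * local_kernel (z - w) * g w"
          using ae by eventually_elim (intro mult_right_mono weighted_kernel_le, auto)
      qed
      also have "\<dots> = ennreal ((2 + R) * jbr z powr (-(1 + \<epsilon>))) * kernel_op local_kernel \<nu> g z"
        unfolding kernel_op_def by (subst nn_integral_cmult[symmetric]) (auto simp: mult.assoc)
      finally have "ennpow (ennreal (jbr z powr (-\<epsilon>)) * kernel_op cauchy_kernel \<nu> g z) q \<le> ennpow (ennreal ((2 + R) * jbr z powr (-(1 + \<epsilon>))) * kernel_op local_kernel \<nu> g z) q"
        using q by (intro ennpow_mono) auto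
      also have "\<dots> = ennreal c * (ennreal (?V z) * ennpow (kernel_op local_kernel \<nu> g z) q)"
      proof -
        have "(jbr z powr (-(1 + \<epsilon>))) powr q = ?V z" by (simp only: powr_powr mult_minus_left mult.commute[of _ q] mult_minus_right)
        then have "((2 + R) * jbr z powr (-(1 + \<epsilon>))) powr q = c * ?V z" by (simp only: powr_mult c_def)
        then have "ennpow (ennreal ((2 + R) * jbr z powr (-(1 + \<epsilon>)))) q = ennreal c * ennreal (?V z)"
          using R by (subst ennpow_ennreal) (auto simp: c_def ennreal_mult)
        then show ?thesis by (simp only: ennpow_mult mult.assoc)
      qed
      finally show "ennpow (ennreal (jbr z powr (-\<epsilon>)) * kernel_op cauchy_kernel \<nu> g z) q \<le> ennreal c * (ennreal (?V z) * ennpow (kernel_op local_kernel \<nu> g z) q)" .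
    qed
    also have "\<dots> = ennreal c * (\<integral>\<^sup>+ z. ennpow (kernel_op local_kernel \<nu> g z) q \<partial>density lborel (\<lambda>z. ennreal (?V z)))"
      by (subst nn_integral_density) (auto simp: nn_integral_cmult)
    also have "\<dots> \<le> ennreal c * (ennreal C * (\<integral>\<^sup>+ w. ennpow (g w) q \<partial>\<nu>))"
      using C[OF g] unfolding kernel_op_def by (rule mult_left_mono) simp
    also have "\<dots> \<le> ennreal (c * max 0 C) * (\<integral>\<^sup>+ w. ennpow (g w) q \<partial>\<nu>)"
    proof -
      have "ennreal C \<le> ennreal (max 0 C)" by (intro ennreal_leI) simp
      then have "ennreal c * ennreal C \<le> ennreal (c * max 0 C)" by (subst ennreal_mult) (auto simp: c_def intro: mult_left_mono)
      then show ?thesis unfolding mult.assoc[symmetric] by (rule mult_right_mono) simp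
    qed
    finally show "(\<integral>\<^sup>+ z. ennpow (ennreal (jbr z powr (-\<epsilon>)) * kernel_op cauchy_kernel \<nu> g z) q \<partial>lborel) \<le> ennreal (c * max 0 C) * (\<integral>\<^sup>+ w. ennpow (g w) q \<partial>\<nu>)" .
  qed (simp add: c_def)
qed

section \<open>Operators of norm O(h) into the weighted space\<close>

context
  fixes \<Omega> :: "complex set" and R q \<epsilon> :: real
  assumes op: "open \<Omega>" and cv: "convex \<Omega>" and bd: "\<Omega> \<subseteq> cball 0 R" and R: "0 \<le> R"
    and q: "1 < q" and \<epsilon>: "0 \<le> \<epsilon>" "2 < q * (1 + \<epsilon>)"
begin

lemma regular_area: "regular_measure 2 (area \<Omega>)"
proof -
  note [measurable] = measurable_domain[OF op cv bd]
  have "(\<integral>\<^sup>+ z. ennreal (indicator \<Omega> z) \<partial>lborel) < top"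
    using emeasure_area_finite[OF op cv bd] by (simp add: area_def emeasure_density ennreal_indicator)
  then have "regular_measure 2 (density lborel (\<lambda>z. ennreal (indicator \<Omega> z)))"
    by (intro regular_measure_density) (auto simp: indicator_def)
  then show ?thesis by (simp add: area_def ennreal_indicator)
qed

lemma AE_area: "AE x in area \<Omega>. cmod x \<le> R"
  unfolding area_def using bd measurable_domain[OF op cv bd] by (subst AE_density) (auto simp: indicator_def split: if_splits intro!: AE_I2)

lemma AE_boundary_measure: "AE x in boundary_measure up b \<Omega>. cmod x \<le> R"
proof -
  have [measurable]: "shadow b \<Omega> \<in> sets borel" using open_shadow[OF op cv bd] by simp
  note [measurable] = measurable_chord_end[OF op cv bd]
  show ?thesis unfolding boundary_measure_def using chord_end_in_closure[OF op cv bd, of _ b up]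
    by (subst AE_distr_iff) (auto simp: AE_density indicator_def split: if_splits)
qed

text \<open>Norm O(h) from L^q of the area to the weighted space, uniformly in h and written in q-th
  powers, whence \<open>h powr q\<close>. Measurability is included because sums of such operators
  are integrated termwise.\<close>

definition uniformly_bounded :: "(real \<Rightarrow> (complex \<Rightarrow> ennreal) \<Rightarrow> complex \<Rightarrow> ennreal) \<Rightarrow> bool" where
  "uniformly_bounded T \<longleftrightarrow> (\<exists>C::real. 0 \<le> C \<and> (\<forall>h U. 0 < h \<longrightarrow> U \<in> borel_measurable borel \<longrightarrow> T h U \<in> borel_measurable borel \<and>
     (\<integral>\<^sup>+ z. ennpow (ennreal (jbr z powr (-\<epsilon>)) * T h U z) q \<partial>lborel) \<le> ennreal (C * h powr q) * (\<integral>\<^sup>+ w. ennpow (U w) q \<partial>area \<Omega>)))"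

lemma uniformly_bounded_add:
  assumes "uniformly_bounded S" "uniformly_bounded T"
  shows "uniformly_bounded (\<lambda>h U z. S h U z + T h U z)"
proof -
  let ?J = "\<lambda>z. ennreal (jbr z powr (-\<epsilon>))"
  obtain C where C: "0 \<le> C" "\<And>h U. 0 < h \<Longrightarrow> U \<in> borel_measurable borel \<Longrightarrow> S h U \<in> borel_measurable borel"
    "\<And>h U. 0 < h \<Longrightarrow> U \<in> borel_measurable borel \<Longrightarrow> (\<integral>\<^sup>+ z. ennpow (?J z * S h U z) q \<partial>lborel) \<le> ennreal (C * h powr q) * (\<integral>\<^sup>+ w. ennpow (U w) q \<partial>area \<Omega>)"
    using assms(1) unfolding uniformly_bounded_def by blast
  obtain D where D: "0 \<le> D" "\<And>h U. 0 < h \<Longrightarrow> U \<in> borel_measurable borel \<Longrightarrow> T h U \<in> borel_measurable borel"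
    "\<And>h U. 0 < h \<Longrightarrow> U \<in> borel_measurable borel \<Longrightarrow> (\<integral>\<^sup>+ z. ennpow (?J z * T h U z) q \<partial>lborel) \<le> ennreal (D * h powr q) * (\<integral>\<^sup>+ w. ennpow (U w) q \<partial>area \<Omega>)"
    using assms(2) unfolding uniformly_bounded_def by blast
  show ?thesis unfolding uniformly_bounded_def
  proof (intro exI[of _ "2 powr q * (C + D)"] conjI allI impI)
    fix h :: real and U :: "complex \<Rightarrow> ennreal" assume h: "0 < h" and U: "U \<in> borel_measurable borel"
    note [measurable] = C(2)[OF h U] D(2)[OF h U]
    let ?I = "\<integral>\<^sup>+ w. ennpow (U w) q \<partial>area \<Omega>"
    show "(\<lambda>z. S h U z + T h U z) \<in> borel_measurable borel" by measurable
    have "(\<integral>\<^sup>+ z. ennpow (?J z * (S h U z + T h U z)) q \<partial>lborel) \<le> (\<integral>\<^sup>+ z. ennreal (2 powr q) * (ennpow (?J z * S h U z) q + ennpow (?J z * T h U z) q) \<partial>lborel)"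
      using q by (intro nn_integral_mono) (simp only: distrib_left[of "?J _"] ennpow_add_le)
    also have "\<dots> = ennreal (2 powr q) * ((\<integral>\<^sup>+ z. ennpow (?J z * S h U z) q \<partial>lborel) + (\<integral>\<^sup>+ z. ennpow (?J z * T h U z) q \<partial>lborel))"
      by (simp add: nn_integral_cmult nn_integral_add)
    also have "\<dots> \<le> ennreal (2 powr q) * (ennreal (C * h powr q) * ?I + ennreal (D * h powr q) * ?I)"
      by (intro mult_left_mono add_mono C(3) D(3) h U) simp
    also have "\<dots> = ennreal (2 powr q) * (ennreal (C * h powr q) + ennreal (D * h powr q)) * ?I"
      by (simp add: distrib_right mult.assoc)
    also have "ennreal (2 powr q) * (ennreal (C * h powr q) + ennreal (D * h powr q)) = ennreal (2 powr q * (C + D) * h powr q)"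
      using C(1) D(1) by (simp add: algebra_simps flip: ennreal_plus ennreal_mult)
    finally show "(\<integral>\<^sup>+ z. ennpow (?J z * (S h U z + T h U z)) q \<partial>lborel) \<le> ennreal (2 powr q * (C + D) * h powr q) * ?I" .
  qed (use C(1) D(1) in simp)
qed

lemma uniformly_bounded_sum:
  assumes "finite I" "\<And>i. i \<in> I \<Longrightarrow> uniformly_bounded (T i)"
  shows "uniformly_bounded (\<lambda>h U z. \<Sum>i\<in>I. T i h U z)"
  using assms
proof (induction I rule: finite_induct)
  case empty
  then show ?case unfolding uniformly_bounded_def by (intro exI[of _ 0]) simp
next
  case (insert i I)
  then show ?case using uniformly_bounded_add[of "T i" "\<lambda>h U z. \<Sum>i\<in>I. T i h U z"] by simp
qed

lemma kernel_op_bound_to_regular: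
  assumes "regular_measure 1 \<mu>"
  obtains C where "0 \<le> C" "\<And>U. U \<in> borel_measurable borel \<Longrightarrow> (\<integral>\<^sup>+ z. ennpow (kernel_op cauchy_kernel (area \<Omega>) U z) q \<partial>\<mu>) \<le> ennreal C * (\<integral>\<^sup>+ w. ennpow (U w) q \<partial>area \<Omega>)"
proof -
  obtain C where C: "\<And>f. f \<in> borel_measurable borel \<Longrightarrow> (\<integral>\<^sup>+ z. ennpow (\<integral>\<^sup>+ w. local_kernel (z - w) * f w \<partial>area \<Omega>) q \<partial>\<mu>) \<le> ennreal C * (\<integral>\<^sup>+ w. ennpow (f w) q \<partial>area \<Omega>)"
    using kernel_to_regular1[OF q assms regular_area] by blast
  show ?thesis
  proof (rule that[of "max 0 C"])
    fix U :: "complex \<Rightarrow> ennreal" assume U: "U \<in> borel_measurable borel"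
    have "(\<integral>\<^sup>+ z. ennpow (kernel_op cauchy_kernel (area \<Omega>) U z) q \<partial>\<mu>) \<le> (\<integral>\<^sup>+ z. ennpow (\<integral>\<^sup>+ w. local_kernel (z - w) * U w \<partial>area \<Omega>) q \<partial>\<mu>)"
      unfolding kernel_op_def using q by (intro nn_integral_mono ennpow_mono mult_right_mono local_kernel_ge) auto
    also have "\<dots> \<le> ennreal C * (\<integral>\<^sup>+ w. ennpow (U w) q \<partial>area \<Omega>)" by (rule C[OF U])
    also have "\<dots> \<le> ennreal (max 0 C) * (\<integral>\<^sup>+ w. ennpow (U w) q \<partial>area \<Omega>)" by (intro mult_right_mono ennreal_leI) auto
    finally show "(\<integral>\<^sup>+ z. ennpow (kernel_op cauchy_kernel (area \<Omega>) U z) q \<partial>\<mu>) \<le> \<dots>" .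
  qed simp
qed

lemma measurable_kernel_op_area:
  "K \<in> borel_measurable borel \<Longrightarrow> f \<in> borel_measurable borel \<Longrightarrow> kernel_op K (area \<Omega>) f \<in> borel_measurable borel"
  by (rule measurable_kernel_op) (auto simp: sets_area[OF op cv bd] sigma_finite_area[OF op cv bd])

text \<open>Serves twice: with a boundary measure for the chord-end terms, and with the area itself
  for the a priori finiteness of the double integral.\<close>

lemma bound_through_regular:
  assumes \<nu>: "regular_measure 1 \<nu>" and ae: "AE x in \<nu>. cmod x \<le> R"
  obtains C where "0 \<le> C" "\<And>U. U \<in> borel_measurable borel \<Longrightarrow>
    (\<integral>\<^sup>+ z. ennpow (ennreal (jbr z powr (-\<epsilon>)) * kernel_op cauchy_kernel \<nu> (kernel_op cauchy_kernel (area \<Omega>) U) z) q \<partial>lborel) \<le> ennreal C * (\<integral>\<^sup>+ w. ennpow (U w) q \<partial>area \<Omega>)"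
proof -
  obtain C where C: "0 \<le> C" "\<And>U. U \<in> borel_measurable borel \<Longrightarrow> (\<integral>\<^sup>+ z. ennpow (kernel_op cauchy_kernel (area \<Omega>) U z) q \<partial>\<nu>) \<le> ennreal C * (\<integral>\<^sup>+ w. ennpow (U w) q \<partial>area \<Omega>)"
    by (rule kernel_op_bound_to_regular[OF \<nu>]) blast
  obtain D where D: "0 \<le> D" "\<And>g. g \<in> borel_measurable borel \<Longrightarrow>
    (\<integral>\<^sup>+ z. ennpow (ennreal (jbr z powr (-\<epsilon>)) * kernel_op cauchy_kernel \<nu> g z) q \<partial>lborel) \<le> ennreal D * (\<integral>\<^sup>+ w. ennpow (g w) q \<partial>\<nu>)"
    using weighted_bound_from_regular[OF q \<epsilon> \<nu> ae R] by blast
  show ?thesis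
  proof (rule that[of "D * C"])
    fix U :: "complex \<Rightarrow> ennreal" assume U: "U \<in> borel_measurable borel"
    have "(\<integral>\<^sup>+ z. ennpow (ennreal (jbr z powr (-\<epsilon>)) * kernel_op cauchy_kernel \<nu> (kernel_op cauchy_kernel (area \<Omega>) U) z) q \<partial>lborel) \<le> ennreal D * (\<integral>\<^sup>+ z. ennpow (kernel_op cauchy_kernel (area \<Omega>) U z) q \<partial>\<nu>)"
      using U by (intro D(2) measurable_kernel_op_area) auto
    also have "\<dots> \<le> ennreal D * (ennreal C * (\<integral>\<^sup>+ w. ennpow (U w) q \<partial>area \<Omega>))" by (intro mult_left_mono C(2) U) simp
    also have "\<dots> = ennreal (D * C) * (\<integral>\<^sup>+ w. ennpow (U w) q \<partial>area \<Omega>)" using C(1) D(1) by (simp add: ennreal_mult mult.assoc)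
    finally show "(\<integral>\<^sup>+ z. ennpow (ennreal (jbr z powr (-\<epsilon>)) * kernel_op cauchy_kernel \<nu> (kernel_op cauchy_kernel (area \<Omega>) U) z) q \<partial>lborel) \<le> \<dots>" .
  qed (use C D in simp)
qed

text \<open>Extending \<open>U\<close> by zero outside \<Omega> reduces this to the convolution
  bound on the whole plane.\<close>

lemma remainder_kernel_area_bound:
  obtains C :: real where "0 < C" "\<And>h U. 0 < h \<Longrightarrow> U \<in> borel_measurable borel \<Longrightarrow>
    (\<integral>\<^sup>+ z. ennpow (kernel_op (remainder_kernel h) (area \<Omega>) U z) q \<partial>lborel) \<le> ennreal (C * h powr q) * (\<integral>\<^sup>+ w. ennpow (U w) q \<partial>area \<Omega>)"
proof -
  note [measurable] = measurable_domain[OF op cv bd]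
  obtain C :: real where C: "0 < C" "\<And>h f. 0 < h \<Longrightarrow> f \<in> borel_measurable borel \<Longrightarrow>
    (\<integral>\<^sup>+ z. ennpow (\<integral>\<^sup>+ w. remainder_kernel h (z - w) * f w \<partial>lborel) q \<partial>lborel) \<le> ennreal (C * h powr q) * (\<integral>\<^sup>+ w. ennpow (f w) q \<partial>lborel)"
    by (rule remainder_kernel_operator_bound[OF q]) blast
  show ?thesis
  proof (rule that[OF C(1)])
    fix h :: real and U :: "complex \<Rightarrow> ennreal" assume h: "0 < h" and [measurable]: "U \<in> borel_measurable borel"
    have "kernel_op (remainder_kernel h) (area \<Omega>) U z = (\<integral>\<^sup>+ w. remainder_kernel h (z - w) * (indicator \<Omega> w * U w) \<partial>lborel)" for z
      unfolding kernel_op_def by (subst nn_integral_area[OF op cv bd]) (auto simp: mult_ac)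
    moreover have "(\<integral>\<^sup>+ w. ennpow (U w) q \<partial>area \<Omega>) = (\<integral>\<^sup>+ w. ennpow (indicator \<Omega> w * U w) q \<partial>lborel)"
      by (subst nn_integral_area[OF op cv bd]) (auto simp: indicator_def intro!: nn_integral_cong)
    ultimately show "(\<integral>\<^sup>+ z. ennpow (kernel_op (remainder_kernel h) (area \<Omega>) U z) q \<partial>lborel) \<le> ennreal (C * h powr q) * (\<integral>\<^sup>+ w. ennpow (U w) q \<partial>area \<Omega>)"
      using C(2)[OF h, of "\<lambda>w. indicator \<Omega> w * U w"] by simp
  qed
qed

lemma jbr_weight_le_1: "ennreal (jbr z powr (-\<epsilon>)) \<le> 1"
  using powr_mono2'[of "-\<epsilon>" 1 "jbr z"] jbr_ge_1[of z] \<epsilon> by simp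

text \<open>The outer convolution is O(h) on the whole plane, so the weight is simply bounded by 1;
  the inner Cauchy operator stays within \<Omega>.\<close>

lemma uniformly_bounded_remainder_kernel_cauchy_kernel: "uniformly_bounded (\<lambda>h U. kernel_op (remainder_kernel h) (area \<Omega>) (kernel_op cauchy_kernel (area \<Omega>) U))"
proof -
  obtain C where C: "0 \<le> C" "\<And>U. U \<in> borel_measurable borel \<Longrightarrow> (\<integral>\<^sup>+ z. ennpow (kernel_op cauchy_kernel (area \<Omega>) U z) q \<partial>area \<Omega>) \<le> ennreal C * (\<integral>\<^sup>+ w. ennpow (U w) q \<partial>area \<Omega>)"
    by (rule kernel_op_bound_to_regular[OF regular_measure_mono[OF regular_area]]) auto
  obtain D where D: "0 < D" "\<And>h U. 0 < h \<Longrightarrow> U \<in> borel_measurable borel \<Longrightarrow>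
    (\<integral>\<^sup>+ z. ennpow (kernel_op (remainder_kernel h) (area \<Omega>) U z) q \<partial>lborel) \<le> ennreal (D * h powr q) * (\<integral>\<^sup>+ w. ennpow (U w) q \<partial>area \<Omega>)"
    by (rule remainder_kernel_area_bound) blast
  show ?thesis unfolding uniformly_bounded_def
  proof (intro exI[of _ "D * C"] conjI allI impI)
    fix h :: real and U :: "complex \<Rightarrow> ennreal" assume h: "0 < h" and U: "U \<in> borel_measurable borel"
    have m: "kernel_op cauchy_kernel (area \<Omega>) U \<in> borel_measurable borel" using U by (intro measurable_kernel_op_area) auto
    then show "kernel_op (remainder_kernel h) (area \<Omega>) (kernel_op cauchy_kernel (area \<Omega>) U) \<in> borel_measurable borel" by (rule measurable_kernel_op_area[OF measurable_remainder_kernel])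
    have "(\<integral>\<^sup>+ z. ennpow (ennreal (jbr z powr (-\<epsilon>)) * kernel_op (remainder_kernel h) (area \<Omega>) (kernel_op cauchy_kernel (area \<Omega>) U) z) q \<partial>lborel) \<le> (\<integral>\<^sup>+ z. ennpow (1 * kernel_op (remainder_kernel h) (area \<Omega>) (kernel_op cauchy_kernel (area \<Omega>) U) z) q \<partial>lborel)"
      using q by (intro nn_integral_mono ennpow_mono mult_right_mono jbr_weight_le_1) auto
    also have "\<dots> \<le> ennreal (D * h powr q) * (\<integral>\<^sup>+ w. ennpow (kernel_op cauchy_kernel (area \<Omega>) U w) q \<partial>area \<Omega>)"
      using D(2)[OF h m] by simp
    also have "\<dots> \<le> ennreal (D * h powr q) * (ennreal C * (\<integral>\<^sup>+ w. ennpow (U w) q \<partial>area \<Omega>))"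
      by (intro mult_left_mono C(2) U) simp
    also have "\<dots> = ennreal (D * C * h powr q) * (\<integral>\<^sup>+ w. ennpow (U w) q \<partial>area \<Omega>)"
      using C(1) D(1) by (simp add: ennreal_mult mult_ac)
    finally show "(\<integral>\<^sup>+ z. ennpow (ennreal (jbr z powr (-\<epsilon>)) * kernel_op (remainder_kernel h) (area \<Omega>) (kernel_op cauchy_kernel (area \<Omega>) U) z) q \<partial>lborel) \<le> \<dots>" .
  qed (use C(1) D(1) in simp)
qed

text \<open>Here the weight is essential, since the outer Cauchy operator spreads to infinity; the
  factor h comes from the inner convolution restricted to \<Omega>.\<close>

lemma uniformly_bounded_cauchy_kernel_remainder_kernel: "uniformly_bounded (\<lambda>h U. kernel_op cauchy_kernel (area \<Omega>) (kernel_op (remainder_kernel h) (area \<Omega>) U))"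
proof -
  note [measurable] = measurable_domain[OF op cv bd]
  obtain C where C: "0 \<le> C" "\<And>g. g \<in> borel_measurable borel \<Longrightarrow>
    (\<integral>\<^sup>+ z. ennpow (ennreal (jbr z powr (-\<epsilon>)) * kernel_op cauchy_kernel (area \<Omega>) g z) q \<partial>lborel) \<le> ennreal C * (\<integral>\<^sup>+ w. ennpow (g w) q \<partial>area \<Omega>)"
    using weighted_bound_from_regular[OF q \<epsilon> regular_measure_mono[OF regular_area] AE_area R] by auto
  obtain D where D: "0 < D" "\<And>h U. 0 < h \<Longrightarrow> U \<in> borel_measurable borel \<Longrightarrow>
    (\<integral>\<^sup>+ z. ennpow (kernel_op (remainder_kernel h) (area \<Omega>) U z) q \<partial>lborel) \<le> ennreal (D * h powr q) * (\<integral>\<^sup>+ w. ennpow (U w) q \<partial>area \<Omega>)"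
    by (rule remainder_kernel_area_bound) blast
  show ?thesis unfolding uniformly_bounded_def
  proof (intro exI[of _ "C * D"] conjI allI impI)
    fix h :: real and U :: "complex \<Rightarrow> ennreal" assume h: "0 < h" and U: "U \<in> borel_measurable borel"
    have m[measurable]: "kernel_op (remainder_kernel h) (area \<Omega>) U \<in> borel_measurable borel" using U by (intro measurable_kernel_op_area) auto
    then show "kernel_op cauchy_kernel (area \<Omega>) (kernel_op (remainder_kernel h) (area \<Omega>) U) \<in> borel_measurable borel" by (rule measurable_kernel_op_area[OF measurable_cauchy_kernel])
    have "(\<integral>\<^sup>+ z. ennpow (ennreal (jbr z powr (-\<epsilon>)) * kernel_op cauchy_kernel (area \<Omega>) (kernel_op (remainder_kernel h) (area \<Omega>) U) z) q \<partial>lborel) \<le> ennreal C * (\<integral>\<^sup>+ w. ennpow (kernel_op (remainder_kernel h) (area \<Omega>) U w) q \<partial>area \<Omega>)"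
      by (rule C(2)[OF m])
    also have "\<dots> \<le> ennreal C * (\<integral>\<^sup>+ w. ennpow (kernel_op (remainder_kernel h) (area \<Omega>) U w) q \<partial>lborel)"
      by (subst nn_integral_area[OF op cv bd]) (auto simp: indicator_def intro!: mult_left_mono nn_integral_mono)
    also have "\<dots> \<le> ennreal C * (ennreal (D * h powr q) * (\<integral>\<^sup>+ w. ennpow (U w) q \<partial>area \<Omega>))"
      by (intro mult_left_mono D(2) h U) simp
    also have "\<dots> = ennreal (C * D * h powr q) * (\<integral>\<^sup>+ w. ennpow (U w) q \<partial>area \<Omega>)"
      using C(1) D(1) by (simp add: ennreal_mult mult_ac)
    finally show "(\<integral>\<^sup>+ z. ennpow (ennreal (jbr z powr (-\<epsilon>)) * kernel_op cauchy_kernel (area \<Omega>) (kernel_op (remainder_kernel h) (area \<Omega>) U) z) q \<partial>lborel) \<le> \<dots>" .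
  qed (use C(1) D(1) in simp)
qed

lemma uniformly_bounded_boundary:
  "uniformly_bounded (\<lambda>h U z. ennreal h * kernel_op cauchy_kernel (boundary_measure up b \<Omega>) (kernel_op cauchy_kernel (area \<Omega>) U) z)"
proof -
  obtain C where C: "0 \<le> C" "\<And>U. U \<in> borel_measurable borel \<Longrightarrow>
    (\<integral>\<^sup>+ z. ennpow (ennreal (jbr z powr (-\<epsilon>)) * kernel_op cauchy_kernel (boundary_measure up b \<Omega>) (kernel_op cauchy_kernel (area \<Omega>) U) z) q \<partial>lborel) \<le> ennreal C * (\<integral>\<^sup>+ w. ennpow (U w) q \<partial>area \<Omega>)"
    by (rule bound_through_regular[OF regular_boundary_measure[OF op cv bd] AE_boundary_measure]) blast
  show ?thesis unfolding uniformly_bounded_def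
  proof (intro exI[of _ C] conjI allI impI)
    fix h :: real and U :: "complex \<Rightarrow> ennreal" assume h: "0 < h" and U: "U \<in> borel_measurable borel"
    have m: "kernel_op cauchy_kernel (area \<Omega>) U \<in> borel_measurable borel" using U by (intro measurable_kernel_op_area) auto
    have [measurable]: "kernel_op cauchy_kernel (boundary_measure up b \<Omega>) (kernel_op cauchy_kernel (area \<Omega>) U) \<in> borel_measurable borel"
      by (rule measurable_kernel_op[OF measurable_cauchy_kernel m sets_boundary_measure[OF op cv bd] sigma_finite_boundary_measure[OF op cv bd]])
    show "(\<lambda>z. ennreal h * kernel_op cauchy_kernel (boundary_measure up b \<Omega>) (kernel_op cauchy_kernel (area \<Omega>) U) z) \<in> borel_measurable borel" by measurable
    have "(\<integral>\<^sup>+ z. ennpow (ennreal (jbr z powr (-\<epsilon>)) * (ennreal h * kernel_op cauchy_kernel (boundary_measure up b \<Omega>) (kernel_op cauchy_kernel (area \<Omega>) U) z)) q \<partial>lborel)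
      = (\<integral>\<^sup>+ z. ennreal (h powr q) * ennpow (ennreal (jbr z powr (-\<epsilon>)) * kernel_op cauchy_kernel (boundary_measure up b \<Omega>) (kernel_op cauchy_kernel (area \<Omega>) U) z) q \<partial>lborel)"
      using h by (intro nn_integral_cong) (simp add: ennpow_mult ennpow_ennreal mult_ac)
    also have "\<dots> = ennreal (h powr q) * (\<integral>\<^sup>+ z. ennpow (ennreal (jbr z powr (-\<epsilon>)) * kernel_op cauchy_kernel (boundary_measure up b \<Omega>) (kernel_op cauchy_kernel (area \<Omega>) U) z) q \<partial>lborel)"
      by (intro nn_integral_cmult) measurable
    also have "\<dots> \<le> ennreal (h powr q) * (ennreal C * (\<integral>\<^sup>+ w. ennpow (U w) q \<partial>area \<Omega>))"
      by (intro mult_left_mono C(2) U) simp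
    also have "\<dots> = ennreal (C * h powr q) * (\<integral>\<^sup>+ w. ennpow (U w) q \<partial>area \<Omega>)"
      using C(1) by (simp add: ennreal_mult mult_ac)
    finally show "(\<integral>\<^sup>+ z. ennpow (ennreal (jbr z powr (-\<epsilon>)) * (ennreal h * kernel_op cauchy_kernel (boundary_measure up b \<Omega>) (kernel_op cauchy_kernel (area \<Omega>) U) z)) q \<partial>lborel) \<le> \<dots>" .
  qed (rule C(1))
qed

text \<open>Contains both halves of the theorem; the pointwise domination is integrated and the q-th
  powers are undone in the constant.\<close>

lemma opA_opB_weighted_bound:
  assumes \<sigma>: "\<sigma> = 1 \<or> \<sigma> = -1"
  shows "\<exists>C. \<forall>k u. 1 \<le> cmod k \<longrightarrow> u \<in> borel_measurable lborel \<longrightarrow> Lq_pow q u < \<infinity> \<longrightarrow>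
     Lq_pow q (\<lambda>z. complex_of_real (jbr z powr (- \<epsilon>)) * opA \<Omega> k (opB \<Omega> \<sigma> k u) z) \<le> ennreal ((C / cmod k) powr q) * Lq_pow q u"
proof -
  note [measurable] = measurable_domain[OF op cv bd]
  let ?J = "\<lambda>z. ennreal (jbr z powr (-\<epsilon>))"
  define T where "T h U z = kernel_op (remainder_kernel h) (area \<Omega>) (kernel_op cauchy_kernel (area \<Omega>) U) z + kernel_op cauchy_kernel (area \<Omega>) (kernel_op (remainder_kernel h) (area \<Omega>) U) z
     + ennreal h * (\<Sum>(up, b)\<in>UNIV. kernel_op cauchy_kernel (boundary_measure up b \<Omega>) (kernel_op cauchy_kernel (area \<Omega>) U) z)" for h U z
  have "uniformly_bounded T"
    unfolding T_def[abs_def] sum_distrib_left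
    by (intro uniformly_bounded_add uniformly_bounded_remainder_kernel_cauchy_kernel uniformly_bounded_cauchy_kernel_remainder_kernel uniformly_bounded_sum)
      (auto simp: uniformly_bounded_boundary)
  then obtain C where C: "0 \<le> C" "\<And>h U. 0 < h \<Longrightarrow> U \<in> borel_measurable borel \<Longrightarrow> T h U \<in> borel_measurable borel"
    "\<And>h U. 0 < h \<Longrightarrow> U \<in> borel_measurable borel \<Longrightarrow> (\<integral>\<^sup>+ z. ennpow (?J z * T h U z) q \<partial>lborel) \<le> ennreal (C * h powr q) * (\<integral>\<^sup>+ w. ennpow (U w) q \<partial>area \<Omega>)"
    unfolding uniformly_bounded_def by blast
  \<comment> \<open>This bound has no gain in h. It makes the composed Cauchy operators finite
    almost everywhere, which is the hypothesis of the pointwise estimate.\<close>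
  obtain D where D: "0 \<le> D" "\<And>U. U \<in> borel_measurable borel \<Longrightarrow>
    (\<integral>\<^sup>+ z. ennpow (?J z * kernel_op cauchy_kernel (area \<Omega>) (kernel_op cauchy_kernel (area \<Omega>) U) z) q \<partial>lborel) \<le> ennreal D * (\<integral>\<^sup>+ w. ennpow (U w) q \<partial>area \<Omega>)"
    by (rule bound_through_regular[OF regular_measure_mono[OF regular_area] AE_area]) auto
  show ?thesis
  proof (intro exI[of _ "33 * C powr (1/q)"] allI impI)
    fix k and u :: "complex \<Rightarrow> complex"
    assume k: "1 \<le> cmod k" and u: "u \<in> borel_measurable lborel" and fin: "Lq_pow q u < \<infinity>"
    define h where "h = 1 / cmod k"
    have h: "0 < h" "1 \<le> h * cmod k" using k by (auto simp: h_def)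
    have um[measurable]: "u \<in> borel_measurable borel" using u by simp
    define U where "U w = ennreal (cmod (u w))" for w
    have U[measurable]: "U \<in> borel_measurable borel" unfolding U_def[abs_def] by measurable
    have Uq: "(\<integral>\<^sup>+ w. ennpow (U w) q \<partial>area \<Omega>) \<le> Lq_pow q u"
      unfolding Lq_pow_def by (subst nn_integral_area[OF op cv bd]) (auto simp: U_def ennpow_ennreal indicator_def intro!: nn_integral_mono)
    have "(\<integral>\<^sup>+ z. ennpow (?J z * kernel_op cauchy_kernel (area \<Omega>) (kernel_op cauchy_kernel (area \<Omega>) U) z) q \<partial>lborel) \<le> ennreal D * (\<integral>\<^sup>+ w. ennpow (U w) q \<partial>area \<Omega>)"
      by (rule D(2)[OF U])
    also have "\<dots> < top" using le_less_trans[OF Uq fin] by (simp add: ennreal_mult_less_top)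
    finally have "(\<integral>\<^sup>+ z. ennpow (?J z * kernel_op cauchy_kernel (area \<Omega>) (kernel_op cauchy_kernel (area \<Omega>) U) z) q \<partial>lborel) \<noteq> \<infinity>" by simp
    moreover have [measurable]: "kernel_op cauchy_kernel (area \<Omega>) (kernel_op cauchy_kernel (area \<Omega>) U) \<in> borel_measurable borel"
      by (rule measurable_kernel_op_area[OF measurable_cauchy_kernel measurable_kernel_op_area[OF measurable_cauchy_kernel U]])
    ultimately have "AE z in lborel. ennpow (?J z * kernel_op cauchy_kernel (area \<Omega>) (kernel_op cauchy_kernel (area \<Omega>) U) z) q \<noteq> \<infinity>"
      by (intro nn_integral_PInf_AE) auto
    then have AE: "AE z in lborel. kernel_op cauchy_kernel (area \<Omega>) (kernel_op cauchy_kernel (area \<Omega>) U) z < top"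
    proof eventually_elim
      case (elim z)
      \<comment> \<open>Positivity of the weight transfers finiteness of the weighted value to the
        unweighted one.\<close>
      have "?J z \<noteq> 0" using jbr_pos[of z] by simp
      moreover have "?J z * kernel_op cauchy_kernel (area \<Omega>) (kernel_op cauchy_kernel (area \<Omega>) U) z < top" using elim by (metis ennpow_top infinity_ennreal_def less_top)
      ultimately show ?case by (auto simp: ennreal_mult_less_top less_top)
    qed
    have "Lq_pow q (\<lambda>z. complex_of_real (jbr z powr (- \<epsilon>)) * opA \<Omega> k (opB \<Omega> \<sigma> k u) z)
      = (\<integral>\<^sup>+ z. ennpow (?J z * ennreal (cmod (opA \<Omega> k (opB \<Omega> \<sigma> k u) z))) q \<partial>lborel)"
      unfolding Lq_pow_def by (intro nn_integral_cong) (simp add: norm_mult ennpow_ennreal flip: ennreal_mult)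
    also have "\<dots> \<le> (\<integral>\<^sup>+ z. ennreal (33 powr q) * ennpow (?J z * T h U z) q \<partial>lborel)"
    proof (rule nn_integral_mono_AE)
      show "AE z in lborel. ennpow (?J z * ennreal (cmod (opA \<Omega> k (opB \<Omega> \<sigma> k u) z))) q \<le> ennreal (33 powr q) * ennpow (?J z * T h U z) q"
        using AE
      proof eventually_elim
        case (elim z)
        have "ennreal (cmod (opA \<Omega> k (opB \<Omega> \<sigma> k u) z)) \<le> 33 * T h U z"
          unfolding T_def U_def[abs_def]
          by (rule opA_opB_pointwise[OF op cv bd h _ um elim[unfolded U_def[abs_def]]]) (use \<sigma> in auto)
        then have "ennpow (?J z * ennreal (cmod (opA \<Omega> k (opB \<Omega> \<sigma> k u) z))) q \<le> ennpow (?J z * (ennreal 33 * T h U z)) q"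
          using q by (intro ennpow_mono mult_left_mono) auto
        also have "\<dots> = ennreal (33 powr q) * ennpow (?J z * T h U z) q"
          by (simp add: ennpow_mult ennpow_ennreal mult_ac del: ennreal_numeral)
        finally show ?case .
      qed
    qed
    also have "\<dots> = ennreal (33 powr q) * (\<integral>\<^sup>+ z. ennpow (?J z * T h U z) q \<partial>lborel)"
      using C(2)[OF h(1) U] by (intro nn_integral_cmult) measurable
    also have "\<dots> \<le> ennreal (33 powr q) * (ennreal (C * h powr q) * Lq_pow q u)"
      by (intro mult_left_mono order_trans[OF C(3)[OF h(1) U]] Uq) auto
    also have "\<dots> = ennreal (33 powr q * (C * h powr q)) * Lq_pow q u"
      using C(1) by (simp add: ennreal_mult mult.assoc)
    also have "33 powr q * (C * h powr q) = (33 * C powr (1/q) / cmod k) powr q"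
    proof -
      have "33 * C powr (1/q) / cmod k = 33 * (C powr (1/q) * h)" by (simp add: h_def)
      then show ?thesis using C(1) h(1) q by (simp add: powr_mult powr_powr)
    qed
    finally show "Lq_pow q (\<lambda>z. complex_of_real (jbr z powr (- \<epsilon>)) * opA \<Omega> k (opB \<Omega> \<sigma> k u) z)
      \<le> ennreal ((33 * C powr (1/q) / cmod k) powr q) * Lq_pow q u" .
  qed
qed

end

theorem theorem2p2:
  fixes \<Omega> :: "complex set" and \<sigma> q \<epsilon> :: real
  assumes "open \<Omega>" and "bounded \<Omega>" and "strictly_convex \<Omega>" and "smooth_boundary \<Omega>"
    and "\<sigma> = 1 \<or> \<sigma> = -1"
  shows "(2 < q \<longrightarrow>
           (\<exists>C. \<forall>k u. 1 \<le> cmod k \<longrightarrow> u \<in> borel_measurable lborel \<longrightarrow> Lq_pow q u < \<infinity> \<longrightarrow>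
              Lq_pow q (opA \<Omega> k (opB \<Omega> \<sigma> k u)) \<le> ennreal ((C / cmod k) powr q) * Lq_pow q u))
       \<and> (1 < q \<and> q \<le> 2 \<and> \<epsilon> > 2 / q - 1 \<longrightarrow>
           (\<exists>C. \<forall>k u. 1 \<le> cmod k \<longrightarrow> u \<in> borel_measurable lborel \<longrightarrow> Lq_pow q u < \<infinity> \<longrightarrow>
              Lq_pow q (\<lambda>z. complex_of_real (jbr z powr (- \<epsilon>)) * opA \<Omega> k (opB \<Omega> \<sigma> k u) z)
                \<le> ennreal ((C / cmod k) powr q) * Lq_pow q u))"
proof -
  have cv: "convex \<Omega>" using assms(3) by (simp add: strictly_convex_def)
  obtain R where R: "0 < R" "\<And>x. x \<in> \<Omega> \<Longrightarrow> norm x \<le> R" using assms(2) by (auto simp: bounded_pos)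
  then have bd: "\<Omega> \<subseteq> cball 0 R" and R0: "0 \<le> R" by auto
  note bound = opA_opB_weighted_bound[OF assms(1) cv bd R0 _ _ _ assms(5), of q]
  show ?thesis
  proof (intro conjI impI)
    assume q: "2 < q"
    have [simp]: "jbr z \<noteq> 0" for z using jbr_pos[of z] by simp
    show "\<exists>C. \<forall>k u. 1 \<le> cmod k \<longrightarrow> u \<in> borel_measurable lborel \<longrightarrow> Lq_pow q u < \<infinity> \<longrightarrow>
              Lq_pow q (opA \<Omega> k (opB \<Omega> \<sigma> k u)) \<le> ennreal ((C / cmod k) powr q) * Lq_pow q u"
      \<comment> \<open>For \<epsilon> = 0 the weight is identically 1 and the condition 2 < q (1 +
        \<epsilon>) reads 2 < q.\<close>
      using bound[of 0] q by simp
  next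
    assume q: "1 < q \<and> q \<le> 2 \<and> \<epsilon> > 2 / q - 1"
    then have "1 \<le> 2 / q" by simp
    then have "0 \<le> \<epsilon>" using q by linarith
    \<comment> \<open>The threshold 2/q - 1 < \<epsilon> multiplied by q is exactly the
      integrability condition for the weight.\<close>
    moreover have "2 < q * (1 + \<epsilon>)" using q pos_divide_less_eq[of q 2 "1 + \<epsilon>"] by (simp add: mult.commute)
    ultimately show "\<exists>C. \<forall>k u. 1 \<le> cmod k \<longrightarrow> u \<in> borel_measurable lborel \<longrightarrow> Lq_pow q u < \<infinity> \<longrightarrow>
              Lq_pow q (\<lambda>z. complex_of_real (jbr z powr (- \<epsilon>)) * opA \<Omega> k (opB \<Omega> \<sigma> k u) z)
                \<le> ennreal ((C / cmod k) powr q) * Lq_pow q u"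
      using q by (intro bound) auto
  qed
qed

end
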